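(* There is a universal constant $C>0$ such that the following holds. Let $(f,n_c)\ge0$ be a radially symmetric solution on $[0,T]$ of $$\frac{df}{dt}=\frac{\kappa_0}{n_c}\mathcal Q[f],\quad f(0,\cdot)=f_0,\qquad \frac{dn_c}{dt}=-\frac{\kappa_0}{n_c}\int \mathcal Q[f]\,dp,$$ with finite energy $m_3$ and finite 4th moment $m_4$. Assume also that $n_c(\cdot)>0$ is absolutely continuous on $[0,T]$ and that $\|f_0(|\cdot|)|\cdot|^2\|_{L^\infty}<\infty$. Then there exists a threshold $\mathcal C(f_0)>0$, which can be taken as $$\mathcal C(f_0)=2\sqrt{m_3\max\Big\{\|f_0(\cdot)|\cdot|^2\|_{L^\infty},\ \frac{3\max\{m_4\langle f_0\rangle,\,C\,m_3^{5/4}\}}{2\,c_0^{1/4}m_3^{3/4}}\Big\}},\qquad m_3=m_3\langle f_0\rangle,\quad c_0=\int_0^1z^2(1-z)^2dz,$$ such that for any initial condensate mass satisfying $$n_c(0)\ \ge\ \mathcal C(f_0)-m_2\langle f_0\rangle+\delta,\qquad \delta>0,$$ the condensate remains uniformly formed: $$\inf_{0\le s\le T}n_c(s)\ \ge\ \delta .$$ Here $T>0$ is any time such that $(f,n_c)\ge0$ is a radially symmetric solution on $[0,T]$ of $\frac{df}{dt}=\frac{\kappa_0}{n_c}\mathcal Q[f]$, $f(0,\cdot)=f_0$, $\frac{dn_c}{dt}=-\frac{\kappa_0}{n_c}\int \mathcal Q[f]\,dp$, with finite energy $m_3$ and finite 4th moment $m_4$, with $n_c(\cdot)>0$ absolutely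 continuous on $[0,T]$, and with $\|f_0(|\cdot|)|\cdot|^2\|_{L^\infty}<\infty$.
   Context: Radial functions on $\mathbb R^3$ are identified with functions of $r=|p|\ge0$. Line-moments: $m_k\langle f\rangle=\int_0^\infty f(r)r^k\,dr$. Collision operator. The underlying operator is $\mathcal Q[f](p)=\iint_{\mathbb R^3\times\mathbb R^3}[R(p,p_1,p_2)-R(p_1,p,p_2)-R(p_2,p_1,p)]\,dp_1dp_2$ with $R(p,p_1,p_2)=|p||p_1||p_2|\,\delta(|p|-|p_1|-|p_2|)\delta(p-p_1-p_2)[f(p_1)f(p_2)(1+f(p))-(1+f(p_1))(1+f(p_2))f(p)]$. For radial $f$ it takes the following form, with numerical factors ($8\pi^2$, $4\pi$) absorbed in the normalization of $\kappa_0$ and $n_c$. With $K(r,s)=r^2s^2(r+s)^2$, $$\mathcal Q_q[f](r)=\int_0^rK(s,r-s)f(s)f(r-s)\,ds+2\int_r^\infty K(r,s-r)f(s)f(s-r)\,ds+2f(r)\Big(\int_r^\infty K(r,s-r)f(s)\,ds-\int_0^rK(s,r-s)f(s)\,ds-\int_0^\infty K(r,s)f(s)\,ds\Big),$$ $$\mathcal L[f](r)=2\int_r^\infty K(r,s-r)f(s)\,ds-f(r)\int_0^rK(s,r-s)\,ds,$$ $$\mathcal Q[f](r):=r^{-2}\big(\mathcal Q_q[f](r)+\mathcal L[f](r)\big),\qquad \int\mathcal Q[f]\,dp:=\int_0^\infty\mathcal Q[f](r)\,r^2dr .$$ $\kappa_0>0$ is a fixed constant. Solutions are understood as radially symmetric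 solutions with $f$ continuous in time with values in $L^1(\mathbb R^3,|p|^kdp)$ for $0\le k\le5$ (so line-moments $m_2,\dots,m_7$ are continuous in time), the equations holding in time-integrated form; the energy is conserved, $m_3\langle f(t)\rangle=m_3\langle f_0\rangle$. *)

theory Defs
  imports "HOL-Analysis.Analysis" "HOL-Probability.Essential_Supremum"
begin

text \<open>
  A radial function on three-dimensional space is represented by its profile on
  \<open>{0..}\<close>; values at negative arguments are irrelevant. All conditions on profiles are
  insensitive to null sets. Since \<open>dp\<close> corresponds to \<open>4 * pi * r^2 dr\<close>, the norm of a radial
  function in \<open>L^1(|p|^k dp)\<close> is \<open>4 * pi\<close> times the line integral of \<open>|g r| * r^(k+2)\<close>.
\<close>

definition line_moment :: "nat \<Rightarrow> (real \<Rightarrow> real) \<Rightarrow> real" where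
  "line_moment k g = (LINT r:{0..}|lborel. g r * r ^ k)"

definition Linf_norm :: "(real \<Rightarrow> real) \<Rightarrow> ereal" where
  "Linf_norm g = esssup (restrict_space lborel {0..}) (\<lambda>r. ereal \<bar>g r\<bar>)"

definition kernel :: "real \<Rightarrow> real \<Rightarrow> real" where
  "kernel r s = r\<^sup>2 * s\<^sup>2 * (r + s)\<^sup>2"

definition Q_quad :: "(real \<Rightarrow> real) \<Rightarrow> real \<Rightarrow> real" where
  "Q_quad f r =
     (LINT s:{0..r}|lborel. kernel s (r - s) * f s * f (r - s))
     + 2 * (LINT s:{r..}|lborel. kernel r (s - r) * f s * f (s - r))
     + 2 * f r * ((LINT s:{r..}|lborel. kernel r (s - r) * f s)
                  - (LINT s:{0..r}|lborel. kernel s (r - s) * f s)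
                  - (LINT s:{0..}|lborel. kernel r s * f s))"

definition Q_lin :: "(real \<Rightarrow> real) \<Rightarrow> real \<Rightarrow> real" where
  "Q_lin f r =
     2 * (LINT s:{r..}|lborel. kernel r (s - r) * f s)
     - f r * (LINT s:{0..r}|lborel. kernel s (r - s))"

definition collision :: "(real \<Rightarrow> real) \<Rightarrow> real \<Rightarrow> real" where
  "collision f r = (Q_quad f r + Q_lin f r) / r\<^sup>2"

text \<open>The normalization of the total mass of the collision operator has no factor \<open>4 * pi\<close>;
  this factor is absorbed in the constants of the system.\<close>

definition collision_mass :: "(real \<Rightarrow> real) \<Rightarrow> real" where
  "collision_mass f = (LINT r:{0..}|lborel. collision f r * r\<^sup>2)"

definition abs_continuous_on_interval :: "real \<Rightarrow> real \<Rightarrow> (real \<Rightarrow> real) \<Rightarrow> bool" where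
  "abs_continuous_on_interval l u g \<longleftrightarrow>
     (\<forall>\<epsilon>>0. \<exists>\<eta>>0. \<forall>(n::nat) a b.
        (\<forall>i<n. l \<le> a i \<and> a i \<le> b i \<and> b i \<le> u) \<and>
        (\<forall>i<n. \<forall>j<n. i \<noteq> j \<longrightarrow> {a i<..<b i} \<inter> {a j<..<b j} = {}) \<and>
        (\<Sum>i<n. b i - a i) < \<eta> \<longrightarrow>
        (\<Sum>i<n. \<bar>g (b i) - g (a i)\<bar>) < \<epsilon>)"

text \<open>
  \<open>radial_solution \<kappa>\<^sub>0 T f\<^sub>0 f nc\<close>: the pair \<open>(f, nc)\<close> is a nonnegative radial solution of
  the system on \<open>[0, T]\<close> with initial profile \<open>f\<^sub>0\<close>. The curve \<open>f\<close> is continuous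
  into \<open>L^1(|p|^k dp)\<close> for \<open>0 \<le> k \<le> 5\<close> (real exponents follow from the integer ones),
  the energy is conserved, and both equations hold in time-integrated form. A curve that
  is continuous into \<open>L^1\<close> has a jointly measurable representative; \<open>f\<close> is such a
  representative, so that its equation can be stated for almost every \<open>r\<close>.
\<close>

definition radial_solution ::
  "real \<Rightarrow> real \<Rightarrow> (real \<Rightarrow> real) \<Rightarrow> (real \<Rightarrow> real \<Rightarrow> real) \<Rightarrow> (real \<Rightarrow> real) \<Rightarrow> bool" where
  "radial_solution \<kappa>\<^sub>0 T f\<^sub>0 f nc \<longleftrightarrow>
     set_borel_measurable lborel ({0..T} \<times> {0..}) (\<lambda>(t, r). f t r) \<and>
     (\<forall>t\<in>{0..T}. (AE r in lborel. 0 \<le> r \<longrightarrow> 0 \<le> f t r) \<and> 0 \<le> nc t) \<and>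
     (\<forall>k\<le>5. \<forall>t\<in>{0..T}.
        set_integrable lborel {0..} (\<lambda>r. f t r * r ^ (k + 2)) \<and>
        ((\<lambda>s. LINT r:{0..}|lborel. \<bar>f s r - f t r\<bar> * r ^ (k + 2)) \<longlongrightarrow> 0)
          (at t within {0..T})) \<and>
     (AE r in lborel. 0 \<le> r \<longrightarrow> f 0 r = f\<^sub>0 r) \<and>
     (\<forall>t\<in>{0..T}. line_moment 3 (f t) = line_moment 3 f\<^sub>0) \<and>
     (\<forall>t\<in>{0..T}. AE r in lborel. 0 \<le> r \<longrightarrow>
        set_integrable lborel {0..t} (\<lambda>s. \<kappa>\<^sub>0 / nc s * collision (f s) r) \<and>
        f t r = f\<^sub>0 r + (LINT s:{0..t}|lborel. \<kappa>\<^sub>0 / nc s * collision (f s) r)) \<and>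
     (\<forall>t\<in>{0..T}.
        set_integrable lborel {0..t} (\<lambda>s. \<kappa>\<^sub>0 / nc s * collision_mass (f s)) \<and>
        nc t = nc 0 - (LINT s:{0..t}|lborel. \<kappa>\<^sub>0 / nc s * collision_mass (f s)))"

definition c\<^sub>0 :: real where
  "c\<^sub>0 = (LINT z:{0..1}|lborel. z\<^sup>2 * (1 - z)\<^sup>2)"

definition mass_threshold :: "real \<Rightarrow> (real \<Rightarrow> real) \<Rightarrow> real" where
  "mass_threshold C f\<^sub>0 =
     (let m3 = line_moment 3 f\<^sub>0; m4 = line_moment 4 f\<^sub>0 in
      2 * sqrt (m3 * max (real_of_ereal (Linf_norm (\<lambda>r. f\<^sub>0 r * r\<^sup>2)))
                         (3 * max m4 (C * m3 powr (5/4))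
                          / (2 * c\<^sub>0 powr (1/4) * m3 powr (3/4)))))"

end

theory Submission
  imports Defs
begin

text \<open>
  Put \<open>g t r = f t r * r\<^sup>2\<close> and \<open>n\<^sub>k = \<integral> r\<^sup>k g\<close>. Total mass \<open>nc + n\<^sub>0\<close> is conserved, so it suffices to
  bound \<open>n\<^sub>0\<close>; splitting the integral at a radius \<open>\<epsilon>\<close> gives \<open>n\<^sub>0 \<le> \<epsilon> M + n\<^sub>1 / \<epsilon>\<close> whenever \<open>g \<le> M\<close>, and the
  optimal \<open>\<epsilon>\<close> gives \<open>2 * sqrt (n\<^sub>1 M)\<close>, where \<open>n\<^sub>1\<close> is the conserved energy.

  The bound \<open>g \<le> M\<close> propagates: where \<open>g\<close> exceeds \<open>M\<close>, the quadratic loss terms absorb the quadratic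
  gain terms, and what remains of the loss, at least \<open>M * (2 * n\<^sub>1 * r + c\<^sub>0 * r\<^sup>5)\<close>, absorbs the linear gain
  \<open>2 * r\<^sup>2 * n\<^sub>2\<close> by weighted AM-GM once \<open>M\<close> is of order \<open>n\<^sub>2 / (c\<^sub>0 powr (1/4) * n\<^sub>1 powr (3/4))\<close>. The excess of \<open>g\<close> over \<open>M\<close>
  then obeys a Gronwall inequality in \<open>L\<^sup>1\<close>.

  Finally \<open>n\<^sub>2 \<le> max (n\<^sub>2(0)) (5 * n\<^sub>1 powr (5/4))\<close>, since formally
  \<open>d n\<^sub>2 / dt \<le> (\<kappa>\<^sub>0 / nc) * (4 * n\<^sub>1 * n\<^sub>3 + 4 * n\<^sub>2\<^sup>2 - n\<^sub>7 / 70)\<close> and the right-hand side is negative above this level.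
  Only moments up to \<open>n\<^sub>5\<close> are known to be finite, so \<open>r\<^sup>2\<close> is replaced by a convex function that is linear
  at infinity; by conservation of energy, testing with it amounts to testing with a bounded concave function.
\<close>

section \<open>Shear maps and profiles\<close>

text \<open>The bound on \<open>g\<close> is propagated in integrated form because the equation
  holds only for almost every radius and continuity in time is only in \<open>L^1\<close>; no
  pointwise maximum principle is at hand. Test functions have to be bounded, since the linear terms
  alone already consume the fifth moment, and a test function of growth \<open>r^2\<close> would
  call for the seventh.

  The constant \<open>C = 5\<close> comes from the moment inequality: multiplied by 70, the
  quadratic terms cost at most \<open>560 * n1 * n3\<close>, and \<open>5 ^ 4 = 625\<close> exceeds
  560. The exponent \<open>5/4\<close> expresses the requirement
  \<open>(n2 / n1) ^ 4 >= 625 * n1\<close>.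

  Smoothing the positive part costs a factor two: \<open>g\<close> is bounded by
  \<open>2 * M\<close> plus the excess, not by \<open>M\<close> plus the excess. The quadratic loss
  is strong enough to pay for this, so the level \<open>M\<close> itself is preserved.

  If the energy vanishes, the explicit threshold formula has the value 0, which is not positive. In
  that case the density carries no mass and every positive threshold works.\<close>

lemma distr_shear:
  fixes c :: real
  assumes "\<bar>c\<bar> = 1"
  shows "distr (lborel \<Otimes>\<^sub>M lborel) (lborel \<Otimes>\<^sub>M lborel) (\<lambda>(x, y). (x, x + c * y)) = lborel \<Otimes>\<^sub>M lborel"
proof (rule measure_eqI)
  fix A assume "A \<in> sets (distr (lborel \<Otimes>\<^sub>M lborel) (lborel \<Otimes>\<^sub>M lborel) (\<lambda>(x::real, y::real). (x, x + c * y)))"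
  then have A[measurable]: "A \<in> sets (lborel \<Otimes>\<^sub>M lborel :: (real \<times> real) measure)" by simp
  have [simp]: "c \<noteq> 0" using assms by auto
  have "emeasure (distr (lborel \<Otimes>\<^sub>M lborel) (lborel \<Otimes>\<^sub>M lborel) (\<lambda>(x, y). (x, x + c * y))) A
     = emeasure (lborel \<Otimes>\<^sub>M lborel) ((\<lambda>(x, y). (x, x + c * y)) -` A \<inter> space (lborel \<Otimes>\<^sub>M lborel))"
    by (rule emeasure_distr) measurable
  also have "\<dots> = (\<integral>\<^sup>+x. emeasure lborel (Pair x -` ((\<lambda>(x, y). (x, x + c * y)) -` A \<inter> space (lborel \<Otimes>\<^sub>M lborel))) \<partial>lborel)"
    by (rule lborel.emeasure_pair_measure_alt) measurable
  also have "\<dots> = (\<integral>\<^sup>+x. emeasure lborel (Pair x -` A) \<partial>lborel)"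
  \<comment> \<open>On each fibre the shear is a translation, composed with a reflection if
    \<open>c = -1\<close>; both preserve one-dimensional Lebesgue measure.\<close>
  proof (rule nn_integral_cong)
    fix x :: real
    have "emeasure lborel (Pair x -` A) = emeasure (density (distr lborel borel (\<lambda>y. x + c * y)) (\<lambda>_. ennreal \<bar>c\<bar>)) (Pair x -` A)"
      by (subst lborel_real_affine[of c x]) auto
    also have "\<dots> = emeasure (distr lborel borel (\<lambda>y. x + c * y)) (Pair x -` A)"
      using assms by (simp add: density_1)
    also have "\<dots> = emeasure lborel ((\<lambda>y. x + c * y) -` (Pair x -` A))"
      by (subst emeasure_distr) (auto simp: A sets_Pair1[OF A, simplified])
    finally show "emeasure lborel (Pair x -` ((\<lambda>(x, y). (x, x + c * y)) -` A \<inter> space (lborel \<Otimes>\<^sub>M lborel)))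
       = emeasure lborel (Pair x -` A)"
      by (simp add: vimage_def space_pair_measure)
  qed
  also have "\<dots> = emeasure (lborel \<Otimes>\<^sub>M lborel) A"
    by (rule lborel.emeasure_pair_measure_alt[symmetric]) measurable
  finally show "emeasure (distr (lborel \<Otimes>\<^sub>M lborel) (lborel \<Otimes>\<^sub>M lborel) (\<lambda>(x, y). (x, x + c * y))) A
     = emeasure (lborel \<Otimes>\<^sub>M lborel) A" .
qed simp

text \<open>Shears turn convolutions and correlations of two densities into product integrals:
  \<open>c = 1\<close> serves the gain \<open>g s * g (r - s)\<close>, \<open>c = -1\<close> the
  gain \<open>g s * g (s - r)\<close>. Integrability is inferred from the product side, where it can
  be read off from moments.\<close>

lemma integrable_shear:
  fixes F :: "real \<Rightarrow> real \<Rightarrow> real"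
  assumes c: "\<bar>c\<bar> = 1" and [measurable]: "case_prod F \<in> borel_measurable (lborel \<Otimes>\<^sub>M lborel)"
    and F: "integrable (lborel \<Otimes>\<^sub>M lborel) (\<lambda>(x, y). F x (x + c * y))"
  shows "integrable (lborel \<Otimes>\<^sub>M lborel) (case_prod F)"
    and "integral\<^sup>L (lborel \<Otimes>\<^sub>M lborel) (case_prod F) = (\<integral>p. (case p of (x, y) \<Rightarrow> F x (x + c * y)) \<partial>(lborel \<Otimes>\<^sub>M lborel))"
proof -
  let ?M = "lborel \<Otimes>\<^sub>M lborel :: (real \<times> real) measure"
  let ?T = "\<lambda>(x, y). (x, x + c * y)"
  have eq: "(\<lambda>p. case_prod F (?T p)) = (\<lambda>(x, y). F x (x + c * y))" by auto
  have "integrable (distr ?M ?M ?T) (case_prod F)"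
    by (subst integrable_distr_eq) (use F eq in auto)
  then show "integrable ?M (case_prod F)" by (simp add: distr_shear[OF c])
  have "integral\<^sup>L (distr ?M ?M ?T) (case_prod F) = (\<integral>p. case_prod F (?T p) \<partial>?M)"
    by (rule integral_distr) measurable
  then show "integral\<^sup>L ?M (case_prod F) = (\<integral>p. (case p of (x, y) \<Rightarrow> F x (x + c * y)) \<partial>?M)"
    by (simp add: distr_shear[OF c] eq)
qed

lemma integrable_product_mult:
  fixes u v :: "real \<Rightarrow> real"
  assumes u: "integrable lborel u" and v: "integrable lborel v"
  shows "integrable (lborel \<Otimes>\<^sub>M lborel) (\<lambda>(x, y). u x * v y)"
    and "(\<integral>p. (case p of (x, y) \<Rightarrow> u x * v y) \<partial>(lborel \<Otimes>\<^sub>M lborel)) = integral\<^sup>L lborel u * integral\<^sup>L lborel v"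
proof -
  note [measurable] = borel_measurable_integrable[OF u] borel_measurable_integrable[OF v]
  show *: "integrable (lborel \<Otimes>\<^sub>M lborel) (\<lambda>(x, y). u x * v y)"
  proof (rule lborel_pair.Fubini_integrable)
    show "integrable lborel (\<lambda>x. \<integral>y. norm (case (x, y) of (x, y) \<Rightarrow> u x * v y) \<partial>lborel)"
      using u by (simp add: abs_mult)
  qed (use v in auto)
  show "(\<integral>p. (case p of (x, y) \<Rightarrow> u x * v y) \<partial>(lborel \<Otimes>\<^sub>M lborel)) = integral\<^sup>L lborel u * integral\<^sup>L lborel v"
    using lborel_pair.integral_fst'[OF *] by simp
qed

definition moment :: "nat \<Rightarrow> (real \<Rightarrow> real) \<Rightarrow> real" where
  "moment k g = (\<integral>x. x ^ k * g x \<partial>lborel)"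

text \<open>Extension by zero to negative arguments lets half-line integrals and convolutions be
  written over the whole line without cut-offs. The index bound 5 is that of the solution class,
  since \<open>x ^ k * g x\<close> carries \<open>r ^ (k + 2)\<close> times the radial
  profile.\<close>

locale profile =
  fixes g :: "real \<Rightarrow> real"
  assumes meas [measurable]: "g \<in> borel_measurable borel"
    and nonneg: "0 \<le> g x"
    and zero: "x < 0 \<Longrightarrow> g x = 0"
    and moments: "k \<le> 5 \<Longrightarrow> integrable lborel (\<lambda>x. x ^ k * g x)"
begin

lemma integrable_profile: "integrable lborel g"
  using moments[of 0] by simp

lemma moment_nonneg: "0 \<le> moment k g"
  unfolding moment_def
  by (rule integral_nonneg_AE, rule AE_I2) (metis linorder_not_less mult_nonneg_nonneg nonneg zero zero_le_power mult_zero_right order_refl)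

end

locale two_profiles = U: profile u + V: profile v for u v
begin

lemma poly_product:
  assumes "i \<le> 5" "j \<le> 5"
  shows "integrable (lborel \<Otimes>\<^sub>M lborel) (\<lambda>(x, y). x ^ i * y ^ j * (u x * v y))"
    and "(\<integral>p. (case p of (x, y) \<Rightarrow> x ^ i * y ^ j * (u x * v y)) \<partial>(lborel \<Otimes>\<^sub>M lborel)) = moment i u * moment j v"
  using integrable_product_mult[OF U.moments[OF assms(1)] V.moments[OF assms(2)]]
  by (simp_all add: moment_def ac_simps)

text \<open>Each kernel of the quadratic part, multiplied by a bounded test function, grows at most
  quadratically, so the moments of order 0 and 2 of the two factors suffice for Fubini.\<close>

lemma bound_product:
  assumes [measurable]: "case_prod \<Phi> \<in> borel_measurable (lborel \<Otimes>\<^sub>M lborel)"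
    and B: "\<And>x y. 0 \<le> x \<Longrightarrow> 0 \<le> y \<Longrightarrow> \<bar>\<Phi> x y\<bar> \<le> a * (x\<^sup>2 + y\<^sup>2)"
  shows "integrable (lborel \<Otimes>\<^sub>M lborel) (\<lambda>(x, y). \<Phi> x y * (u x * v y))"
proof (rule Bochner_Integration.integrable_bound)
  show "integrable (lborel \<Otimes>\<^sub>M lborel) (\<lambda>p. a * ((case p of (x, y) \<Rightarrow> x ^ 2 * y ^ 0 * (u x * v y)) + (case p of (x, y) \<Rightarrow> x ^ 0 * y ^ 2 * (u x * v y))))"
    by (intro integrable_mult_right Bochner_Integration.integrable_add poly_product) auto
  show "AE p in lborel \<Otimes>\<^sub>M lborel. norm (case p of (x, y) \<Rightarrow> \<Phi> x y * (u x * v y))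
     \<le> norm (a * ((case p of (x, y) \<Rightarrow> x ^ 2 * y ^ 0 * (u x * v y)) + (case p of (x, y) \<Rightarrow> x ^ 0 * y ^ 2 * (u x * v y))))"
  proof (rule AE_I2, safe)
    fix x y :: real
    show "norm (\<Phi> x y * (u x * v y))
     \<le> norm (a * (x ^ 2 * y ^ 0 * (u x * v y) + x ^ 0 * y ^ 2 * (u x * v y)))"
    proof (cases "0 \<le> x \<and> 0 \<le> y")
      case True
      then have "\<bar>\<Phi> x y\<bar> * (u x * v y) \<le> a * (x\<^sup>2 + y\<^sup>2) * (u x * v y)"
        by (intro mult_right_mono B) (auto simp: U.nonneg V.nonneg)
      then show ?thesis by (simp add: abs_mult U.nonneg V.nonneg algebra_simps)
    next
      case False
      then show ?thesis using U.zero[of x] V.zero[of y] by auto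
    qed
  qed
qed measurable

lemma conv_pair:
  assumes [measurable]: "\<psi> \<in> borel_measurable borel" and B: "\<And>r. \<bar>\<psi> r\<bar> \<le> B"
  shows "integrable (lborel \<Otimes>\<^sub>M lborel) (\<lambda>(s, r). \<psi> r * r\<^sup>2 * (u s * v (r - s)))"
    and "(\<integral>p. (case p of (s, r) \<Rightarrow> \<psi> r * r\<^sup>2 * (u s * v (r - s))) \<partial>(lborel \<Otimes>\<^sub>M lborel))
      = (\<integral>p. (case p of (x, y) \<Rightarrow> \<psi> (x + y) * (x + y)\<^sup>2 * (u x * v y)) \<partial>(lborel \<Otimes>\<^sub>M lborel))"
proof -
  have "integrable (lborel \<Otimes>\<^sub>M lborel) (\<lambda>(x, y). \<psi> (x + y) * (x + y)\<^sup>2 * (u x * v y))"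
  proof (rule bound_product[where a="2 * B"])
    fix x y :: real
    have "(x + y)\<^sup>2 \<le> 2 * (x\<^sup>2 + y\<^sup>2)" using sum_squares_bound[of x y] by (simp add: power2_eq_square algebra_simps)
    moreover have "0 \<le> B" using B[of 0] by linarith
    ultimately show "\<bar>\<psi> (x + y) * (x + y)\<^sup>2\<bar> \<le> 2 * B * (x\<^sup>2 + y\<^sup>2)"
      using mult_mono[OF B[of "x + y"], of "(x + y)\<^sup>2" "2 * (x\<^sup>2 + y\<^sup>2)"] by (simp add: abs_mult algebra_simps)
  qed measurable
  then have *: "integrable (lborel \<Otimes>\<^sub>M lborel) (\<lambda>(x, y). \<psi> (x + 1 * y) * (x + 1 * y)\<^sup>2 * (u x * v (x + 1 * y - x)))"
    by simp
  have m: "(\<lambda>(s, r). \<psi> r * r\<^sup>2 * (u s * v (r - s))) \<in> borel_measurable (lborel \<Otimes>\<^sub>M lborel)"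
    by measurable
  show "integrable (lborel \<Otimes>\<^sub>M lborel) (\<lambda>(s, r). \<psi> r * r\<^sup>2 * (u s * v (r - s)))"
    by (rule integrable_shear(1)[OF _ m *]) simp
  show "(\<integral>p. (case p of (s, r) \<Rightarrow> \<psi> r * r\<^sup>2 * (u s * v (r - s))) \<partial>(lborel \<Otimes>\<^sub>M lborel))
      = (\<integral>p. (case p of (x, y) \<Rightarrow> \<psi> (x + y) * (x + y)\<^sup>2 * (u x * v y)) \<partial>(lborel \<Otimes>\<^sub>M lborel))"
    using integrable_shear(2)[OF _ m *] by simp
qed

text \<open>Unlike the convolution, \<open>u s * v (s - r)\<close> need not vanish for negative
  \<open>r\<close>, so the restriction to \<open>r >= 0\<close> is carried along as an indicator. On
  the product side it becomes the sector \<open>x >= y\<close>.\<close>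

lemma corr_pair:
  assumes [measurable]: "\<psi> \<in> borel_measurable borel" and B: "\<And>r. \<bar>\<psi> r\<bar> \<le> B"
  shows "integrable (lborel \<Otimes>\<^sub>M lborel) (\<lambda>(s, r). \<psi> r * (indicator {0..} r * r\<^sup>2) * (u s * v (s - r)))"
    and "(\<integral>p. (case p of (s, r) \<Rightarrow> \<psi> r * (indicator {0..} r * r\<^sup>2) * (u s * v (s - r))) \<partial>(lborel \<Otimes>\<^sub>M lborel))
      = (\<integral>p. (case p of (x, y) \<Rightarrow> \<psi> (x - y) * (indicator {0..} (x - y) * (x - y)\<^sup>2) * (u x * v y)) \<partial>(lborel \<Otimes>\<^sub>M lborel))"
proof -
  have "integrable (lborel \<Otimes>\<^sub>M lborel) (\<lambda>(x, y). \<psi> (x - y) * (indicator {0..} (x - y) * (x - y)\<^sup>2) * (u x * v y))"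
  proof (rule bound_product[where a="B"])
    fix x y :: real assume "0 \<le> x" "0 \<le> y"
    then have "(x - y)\<^sup>2 \<le> (x\<^sup>2 + y\<^sup>2)" by (simp add: power2_eq_square algebra_simps)
    then have "indicator {0..} (x - y) * (x - y)\<^sup>2 \<le> (x\<^sup>2 + y\<^sup>2)" by (auto simp: indicator_def)
    moreover have "0 \<le> B" using B[of 0] by linarith
    ultimately show "\<bar>\<psi> (x - y) * (indicator {0..} (x - y) * (x - y)\<^sup>2)\<bar> \<le> B * (x\<^sup>2 + y\<^sup>2)"
      using mult_mono[OF B[of "x - y"], of "indicator {0..} (x - y) * (x - y)\<^sup>2" "(x\<^sup>2 + y\<^sup>2)"] by (simp add: abs_mult)
  qed measurable
  then have *: "integrable (lborel \<Otimes>\<^sub>M lborel) (\<lambda>(x, y). \<psi> (x + (-1) * y) * (indicator {0..} (x + (-1) * y) * (x + (-1) * y)\<^sup>2) * (u x * v (x - (x + (-1) * y))))"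
    by simp
  have m: "(\<lambda>(s, r). \<psi> r * (indicator {0..} r * r\<^sup>2) * (u s * v (s - r))) \<in> borel_measurable (lborel \<Otimes>\<^sub>M lborel)"
    by measurable
  show "integrable (lborel \<Otimes>\<^sub>M lborel) (\<lambda>(s, r). \<psi> r * (indicator {0..} r * r\<^sup>2) * (u s * v (s - r)))"
    by (rule integrable_shear(1)[OF _ m *]) simp
  show "(\<integral>p. (case p of (s, r) \<Rightarrow> \<psi> r * (indicator {0..} r * r\<^sup>2) * (u s * v (s - r))) \<partial>(lborel \<Otimes>\<^sub>M lborel))
      = (\<integral>p. (case p of (x, y) \<Rightarrow> \<psi> (x - y) * (indicator {0..} (x - y) * (x - y)\<^sup>2) * (u x * v y)) \<partial>(lborel \<Otimes>\<^sub>M lborel))"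
    using integrable_shear(2)[OF _ m *] by simp
qed

lemma conv_weak:
  assumes \<psi>: "\<psi> \<in> borel_measurable borel" "\<And>r. \<bar>\<psi> r\<bar> \<le> B"
  shows "integrable lborel (\<lambda>r. \<psi> r * (r\<^sup>2 * (\<integral>s. u s * v (r - s) \<partial>lborel)))"
    and "(\<integral>r. \<psi> r * (r\<^sup>2 * (\<integral>s. u s * v (r - s) \<partial>lborel)) \<partial>lborel)
      = (\<integral>p. (case p of (x, y) \<Rightarrow> \<psi> (x + y) * (x + y)\<^sup>2 * (u x * v y)) \<partial>(lborel \<Otimes>\<^sub>M lborel))"
  using lborel_pair.integrable_snd[OF conv_pair(1)[OF \<psi>]] lborel_pair.integral_snd[OF conv_pair(1)[OF \<psi>]] conv_pair(2)[OF \<psi>]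
  by (simp_all add: mult.assoc)

lemma corr_weak:
  assumes \<psi>: "\<psi> \<in> borel_measurable borel" "\<And>r. \<bar>\<psi> r\<bar> \<le> B"
  shows "integrable lborel (\<lambda>r. \<psi> r * (indicator {0..} r * r\<^sup>2 * (\<integral>s. u s * v (s - r) \<partial>lborel)))"
    and "(\<integral>r. \<psi> r * (indicator {0..} r * r\<^sup>2 * (\<integral>s. u s * v (s - r) \<partial>lborel)) \<partial>lborel)
      = (\<integral>p. (case p of (x, y) \<Rightarrow> \<psi> (x - y) * (indicator {0..} (x - y) * (x - y)\<^sup>2) * (u x * v y)) \<partial>(lborel \<Otimes>\<^sub>M lborel))"
  using lborel_pair.integrable_snd[OF corr_pair(1)[OF \<psi>]] lborel_pair.integral_snd[OF corr_pair(1)[OF \<psi>]] corr_pair(2)[OF \<psi>]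
  by (simp_all add: mult.assoc)

text \<open>Integrable factors do not make \<open>u s * v (r - s)\<close> integrable in
  \<open>s\<close> for every \<open>r\<close>. Fubini for the weighted pair gives it for almost
  every \<open>r\<close>, and the weight \<open>r^2\<close> is divided out away from the origin. The
  convolution integral can then be split into a bounded part and an excess part.\<close>

lemma AE_conv_integrable:
  "AE r in lborel. integrable lborel (\<lambda>s. u s * v (r - s))"
proof -
  have "AE r in lborel. integrable lborel (\<lambda>s. 1 * r\<^sup>2 * (u s * v (r - s)))"
    by (rule lborel_pair.AE_integrable_snd[OF conv_pair(1)[where B=1]]) auto
  with AE_lborel_singleton[of 0] show ?thesis
    by eventually_elim simp
qed

lemma AE_corr_integrable:
  "AE r in lborel. 0 < r \<longrightarrow> integrable lborel (\<lambda>s. u s * v (s - r))"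
proof -
  have "AE r in lborel. integrable lborel (\<lambda>s. 1 * (indicator {0..} r * r\<^sup>2) * (u s * v (s - r)))"
    by (rule lborel_pair.AE_integrable_snd[OF corr_pair(1)[where B=1]]) auto
  then show ?thesis
    by eventually_elim (auto simp: indicator_def)
qed

end

text \<open>These are the Beta values \<open>B(3,3)\<close>, \<open>B(4,3)\<close> and
  \<open>B(5,3)\<close>. The first is \<open>c\<^sub>0\<close>. The second is half of the first,
  which expresses energy conservation of the linear part. The third gives
  \<open>2/105 - 1/30 = -1/70\<close>, the damping of the second moment.\<close>

lemma integral_poly_power2:
  fixes x :: real
  assumes "0 \<le> x"
  shows "(\<integral>r. indicator {0..x} r * (r\<^sup>2 * (x - r)\<^sup>2) \<partial>lborel) = x ^ 5 / 30"
    and "(\<integral>r. indicator {0..x} r * (r ^ 3 * (x - r)\<^sup>2) \<partial>lborel) = x ^ 6 / 60"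
    and "(\<integral>r. indicator {0..x} r * (r ^ 4 * (x - r)\<^sup>2) \<partial>lborel) = x ^ 7 / 105"
proof -
  have "(\<integral>r. (r\<^sup>2 * (x - r)\<^sup>2) * indicator {0..x} r \<partial>lborel)
     = (x\<^sup>2 * x ^ 3 / 3 - 2 * x * x ^ 4 / 4 + x ^ 5 / 5) - (x\<^sup>2 * 0 ^ 3 / 3 - 2 * x * 0 ^ 4 / 4 + 0 ^ 5 / 5)"
    by (rule integral_FTC_Icc_real[OF assms])
      (auto intro!: derivative_eq_intros continuous_intros simp: power2_eq_square algebra_simps eval_nat_numeral)
  then show "(\<integral>r. indicator {0..x} r * (r\<^sup>2 * (x - r)\<^sup>2) \<partial>lborel) = x ^ 5 / 30"
    by (simp add: mult.commute field_simps eval_nat_numeral)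
  have "(\<integral>r. (r ^ 3 * (x - r)\<^sup>2) * indicator {0..x} r \<partial>lborel)
     = (x\<^sup>2 * x ^ 4 / 4 - 2 * x * x ^ 5 / 5 + x ^ 6 / 6) - (x\<^sup>2 * 0 ^ 4 / 4 - 2 * x * 0 ^ 5 / 5 + 0 ^ 6 / 6)"
    by (rule integral_FTC_Icc_real[OF assms])
      (auto intro!: derivative_eq_intros continuous_intros simp: power2_eq_square algebra_simps eval_nat_numeral)
  then show "(\<integral>r. indicator {0..x} r * (r ^ 3 * (x - r)\<^sup>2) \<partial>lborel) = x ^ 6 / 60"
    by (simp add: mult.commute field_simps eval_nat_numeral)
  have "(\<integral>r. (r ^ 4 * (x - r)\<^sup>2) * indicator {0..x} r \<partial>lborel)
     = (x\<^sup>2 * x ^ 5 / 5 - 2 * x * x ^ 6 / 6 + x ^ 7 / 7) - (x\<^sup>2 * 0 ^ 5 / 5 - 2 * x * 0 ^ 6 / 6 + 0 ^ 7 / 7)"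
    by (rule integral_FTC_Icc_real[OF assms])
      (auto intro!: derivative_eq_intros continuous_intros simp: power2_eq_square algebra_simps eval_nat_numeral)
  then show "(\<integral>r. indicator {0..x} r * (r ^ 4 * (x - r)\<^sup>2) \<partial>lborel) = x ^ 7 / 105"
    by (simp add: mult.commute field_simps eval_nat_numeral)
qed

lemma c0_eq: "c\<^sub>0 = 1 / 30"
  using integral_poly_power2(1)[of 1] by (simp add: c\<^sub>0_def set_lebesgue_integral_def)

section \<open>The collision operator on line densities and its weak form\<close>

text \<open>\<open>2 * (r + s)\<^sup>2 + 2 * sgn (r - s) * (r - s)\<^sup>2\<close>, the combination of the three terms of \<open>Q_quad\<close> that
  carry the factor \<open>f r\<close>.\<close>

definition loss_kernel :: "real \<Rightarrow> real \<Rightarrow> real" where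
  "loss_kernel r s = (if s \<le> r then 4 * (r\<^sup>2 + s\<^sup>2) else 8 * r * s)"

definition loss_rate :: "(real \<Rightarrow> real) \<Rightarrow> real \<Rightarrow> real" where
  "loss_rate g r = r ^ 5 / 30 + (\<integral>s. loss_kernel r s * g s \<partial>lborel)"

definition linear_gain :: "(real \<Rightarrow> real) \<Rightarrow> real \<Rightarrow> real" where
  "linear_gain g r = (\<integral>s. indicator {0..s} r * (r\<^sup>2 * (s - r)\<^sup>2) * g s \<partial>lborel)"

text \<open>This is \<open>r^2\<close> times the collision operator, in terms of the line density.
  Each factor \<open>f\<close> absorbs the squared radius at its own argument; the square of the
  remaining radius of the interacting triple survives as a weight.\<close>

definition line_collision :: "(real \<Rightarrow> real) \<Rightarrow> real \<Rightarrow> real" where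
  "line_collision g r = r\<^sup>2 * (\<integral>s. g s * g (r - s) \<partial>lborel)
     + 2 * (indicator {0..} r * r\<^sup>2 * (\<integral>s. g s * g (s - r) \<partial>lborel))
     + 2 * linear_gain g r - g r * loss_rate g r"

lemma measurable_loss_kernel [measurable]:
  "case_prod loss_kernel \<in> borel_measurable (borel \<Otimes>\<^sub>M borel)"
  unfolding loss_kernel_def by measurable

lemma loss_kernel_bound:
  assumes "0 \<le> r" "0 \<le> s"
  shows "\<bar>loss_kernel r s\<bar> \<le> 4 * (r\<^sup>2 + s\<^sup>2)"
  using assms sum_squares_bound[of r s]
  by (auto simp: loss_kernel_def abs_mult power2_eq_square algebra_simps)

context profile
begin

sublocale GG: two_profiles g g ..

lemma loss_kernel_integrable:
  assumes "0 \<le> r"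
  shows "integrable lborel (\<lambda>s. loss_kernel r s * g s)"
proof (rule Bochner_Integration.integrable_bound)
  show "integrable lborel (\<lambda>s. 4 * (r\<^sup>2 * (s ^ 0 * g s) + s ^ 2 * g s))"
    by (intro integrable_mult_right Bochner_Integration.integrable_add moments) auto
  show "AE s in lborel. norm (loss_kernel r s * g s) \<le> norm (4 * (r\<^sup>2 * (s ^ 0 * g s) + s ^ 2 * g s))"
  proof (rule AE_I2)
    fix s
    show "norm (loss_kernel r s * g s) \<le> norm (4 * (r\<^sup>2 * (s ^ 0 * g s) + s ^ 2 * g s))"
    proof (cases "0 \<le> s")
      case True
      have "\<bar>loss_kernel r s\<bar> * g s \<le> 4 * (r\<^sup>2 + s\<^sup>2) * g s"
        by (intro mult_right_mono loss_kernel_bound nonneg assms True)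
      then show ?thesis by (simp add: abs_mult nonneg algebra_simps)
    qed (simp add: zero)
  qed
qed measurable

text \<open>Integrating in \<open>r\<close> before \<open>s\<close> yields
  \<open>s ^ 5 * g s / 30\<close>. This is where the fifth moment is consumed.\<close>

lemma linear_pair:
  assumes [measurable]: "\<psi> \<in> borel_measurable borel" and B: "\<And>r. \<bar>\<psi> r\<bar> \<le> B"
  shows "integrable (lborel \<Otimes>\<^sub>M lborel) (\<lambda>(s, r). \<psi> r * (indicator {0..s} r * (r\<^sup>2 * (s - r)\<^sup>2) * g s))"
proof (rule Bochner_Integration.integrable_bound)
  show "(\<lambda>(s, r). \<psi> r * (indicator {0..s} r * (r\<^sup>2 * (s - r)\<^sup>2) * g s)) \<in> borel_measurable (lborel \<Otimes>\<^sub>M lborel)"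
    unfolding indicator_def atLeastAtMost_iff by measurable
  have int1: "integrable lborel (\<lambda>r. indicator {0..s} r * (r\<^sup>2 * (s - r)\<^sup>2))" for s :: real
  proof -
    have "continuous_on {0..s} (\<lambda>r. r\<^sup>2 * (s - r)\<^sup>2)" by (intro continuous_intros)
    from borel_integrable_compact[OF _ this] show ?thesis by simp
  qed
  show "integrable (lborel \<Otimes>\<^sub>M lborel) (\<lambda>p. B * (case p of (s, r) \<Rightarrow> indicator {0..s} r * (r\<^sup>2 * (s - r)\<^sup>2) * g s))"
  proof (rule integrable_mult_right, rule lborel_pair.Fubini_integrable)
    show "(\<lambda>(s, r). indicator {0..s} r * (r\<^sup>2 * (s - r)\<^sup>2) * g s) \<in> borel_measurable (lborel \<Otimes>\<^sub>M lborel)"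
      unfolding indicator_def atLeastAtMost_iff by measurable
    have "(\<integral>r. norm (case (s, r) of (s, r) \<Rightarrow> indicator {0..s} r * (r\<^sup>2 * (s - r)\<^sup>2) * g s) \<partial>lborel)
        = (1 / 30) * (s ^ 5 * g s)" for s
    proof (cases "0 \<le> s")
      case True
      then show ?thesis
        using integral_poly_power2(1)[OF True] by (simp add: abs_mult nonneg)
    qed (simp add: zero)
    then show "integrable lborel (\<lambda>s. \<integral>r. norm (case (s, r) of (s, r) \<Rightarrow> indicator {0..s} r * (r\<^sup>2 * (s - r)\<^sup>2) * g s) \<partial>lborel)"
      using moments[of 5] by (simp only: integrable_mult_right)
  qed (use int1 in auto)
  show "AE p in lborel \<Otimes>\<^sub>M lborel. norm (case p of (s, r) \<Rightarrow> \<psi> r * (indicator {0..s} r * (r\<^sup>2 * (s - r)\<^sup>2) * g s))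
     \<le> norm (B * (case p of (s, r) \<Rightarrow> indicator {0..s} r * (r\<^sup>2 * (s - r)\<^sup>2) * g s))"
  proof (rule AE_I2, clarify)
    fix s r :: real
    have "\<bar>\<psi> r\<bar> \<le> \<bar>B\<bar>" using B[of r] by linarith
    then show "norm (\<psi> r * (indicator {0..s} r * (r\<^sup>2 * (s - r)\<^sup>2) * g s))
     \<le> norm (B * (indicator {0..s} r * (r\<^sup>2 * (s - r)\<^sup>2) * g s))"
      by (simp add: abs_mult mult_right_mono nonneg)
  qed
qed

lemma linear_weak:
  assumes \<psi>: "\<psi> \<in> borel_measurable borel" "\<And>r. \<bar>\<psi> r\<bar> \<le> B"
  shows "integrable lborel (\<lambda>r. \<psi> r * linear_gain g r)"
    and "integrable lborel (\<lambda>s. (\<integral>r. indicator {0..s} r * (\<psi> r * (r\<^sup>2 * (s - r)\<^sup>2)) \<partial>lborel) * g s)"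
    and "(\<integral>r. \<psi> r * linear_gain g r \<partial>lborel)
      = (\<integral>s. (\<integral>r. indicator {0..s} r * (\<psi> r * (r\<^sup>2 * (s - r)\<^sup>2)) \<partial>lborel) * g s \<partial>lborel)"
proof -
  note P = linear_pair[OF \<psi>]
  have eq: "(\<integral>r. \<psi> r * (indicator {0..s} r * (r\<^sup>2 * (s - r)\<^sup>2) * g s) \<partial>lborel)
     = (\<integral>r. indicator {0..s} r * (\<psi> r * (r\<^sup>2 * (s - r)\<^sup>2)) \<partial>lborel) * g s" for s
    by (subst integral_mult_left_zero[symmetric]) (simp add: ac_simps)
  show "integrable lborel (\<lambda>r. \<psi> r * linear_gain g r)"
    using lborel_pair.integrable_snd[OF P] by (simp add: linear_gain_def)
  show "integrable lborel (\<lambda>s. (\<integral>r. indicator {0..s} r * (\<psi> r * (r\<^sup>2 * (s - r)\<^sup>2)) \<partial>lborel) * g s)"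
    using lborel_pair.integrable_fst[OF P] by (simp add: eq)
  show "(\<integral>r. \<psi> r * linear_gain g r \<partial>lborel)
      = (\<integral>s. (\<integral>r. indicator {0..s} r * (\<psi> r * (r\<^sup>2 * (s - r)\<^sup>2)) \<partial>lborel) * g s \<partial>lborel)"
    using lborel_pair.Fubini_integral[OF P] by (simp add: linear_gain_def eq)
qed

lemma loss_weak:
  assumes [measurable]: "\<psi> \<in> borel_measurable borel" and B: "\<And>r. \<bar>\<psi> r\<bar> \<le> B"
  shows "integrable (lborel \<Otimes>\<^sub>M lborel) (\<lambda>(x, y). \<psi> x * loss_kernel x y * (g x * g y))"
    and "integrable lborel (\<lambda>r. \<psi> r * r ^ 5 * g r)"
    and "integrable lborel (\<lambda>r. \<psi> r * (g r * loss_rate g r))"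
    and "(\<integral>r. \<psi> r * (g r * loss_rate g r) \<partial>lborel)
      = (\<integral>r. \<psi> r * r ^ 5 * g r \<partial>lborel) / 30
        + (\<integral>p. (case p of (x, y) \<Rightarrow> \<psi> x * loss_kernel x y * (g x * g y)) \<partial>(lborel \<Otimes>\<^sub>M lborel))"
proof -
  have B0: "0 \<le> B" using B[of 0] by linarith
  show P: "integrable (lborel \<Otimes>\<^sub>M lborel) (\<lambda>(x, y). \<psi> x * loss_kernel x y * (g x * g y))"
  proof (rule GG.bound_product[where a="B * 4"])
    fix x y :: real assume "0 \<le> x" "0 \<le> y"
    then have "\<bar>\<psi> x\<bar> * \<bar>loss_kernel x y\<bar> \<le> B * (4 * (x\<^sup>2 + y\<^sup>2))"
      by (intro mult_mono B loss_kernel_bound B0) auto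
    then show "\<bar>\<psi> x * loss_kernel x y\<bar> \<le> B * 4 * (x\<^sup>2 + y\<^sup>2)"
      by (simp add: abs_mult algebra_simps)
  qed measurable
  show I: "integrable lborel (\<lambda>r. \<psi> r * r ^ 5 * g r)"
  proof (rule Bochner_Integration.integrable_bound)
    show "integrable lborel (\<lambda>r. B * (r ^ 5 * g r))"
      by (intro integrable_mult_right moments) auto
    show "AE r in lborel. norm (\<psi> r * r ^ 5 * g r) \<le> norm (B * (r ^ 5 * g r))"
      by (rule AE_I2) (use B B0 in \<open>auto simp: abs_mult mult.assoc intro!: mult_right_mono\<close>)
  qed measurable
  have eq: "\<psi> r * (g r * loss_rate g r) = (\<psi> r * r ^ 5 * g r) / 30
      + (\<integral>s. \<psi> r * loss_kernel r s * (g r * g s) \<partial>lborel)" for r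
  proof -
    have "(\<integral>s. \<psi> r * loss_kernel r s * (g r * g s) \<partial>lborel) = (\<integral>s. \<psi> r * g r * (loss_kernel r s * g s) \<partial>lborel)"
      by (rule arg_cong[where f="integral\<^sup>L lborel"]) (auto simp: ac_simps)
    also have "\<dots> = \<psi> r * g r * (\<integral>s. loss_kernel r s * g s \<partial>lborel)"
      by (rule integral_mult_right_zero)
    finally show ?thesis unfolding loss_rate_def by (simp only: distrib_left mult.assoc[symmetric]) simp
  qed
  show "integrable lborel (\<lambda>r. \<psi> r * (g r * loss_rate g r))"
    unfolding eq using I lborel_pair.integrable_fst[OF P] by simp
  show "(\<integral>r. \<psi> r * (g r * loss_rate g r) \<partial>lborel)
      = (\<integral>r. \<psi> r * r ^ 5 * g r \<partial>lborel) / 30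
        + (\<integral>p. (case p of (x, y) \<Rightarrow> \<psi> x * loss_kernel x y * (g x * g y)) \<partial>(lborel \<Otimes>\<^sub>M lborel))"
    unfolding eq using I lborel_pair.integrable_fst[OF P] lborel_pair.integral_fst[OF P] by simp
qed

text \<open>For a bounded test function every gain and loss term is integrable separately, so the
  operator becomes one double integral plus one single integral. The bracket in the double integral
  is not symmetrised, which suits a test function without structure such as a sign; symmetrisation
  is left to \<open>concave_test_collision\<close>.\<close>

lemma collision_weak:
  assumes \<psi>: "\<psi> \<in> borel_measurable borel" "\<And>r. \<bar>\<psi> r\<bar> \<le> B"
  shows "integrable lborel (\<lambda>r. \<psi> r * line_collision g r)"
    and "integrable (lborel \<Otimes>\<^sub>M lborel) (\<lambda>(x, y). (\<psi> (x + y) * (x + y)\<^sup>2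
          + 2 * \<psi> (x - y) * (indicator {0..} (x - y) * (x - y)\<^sup>2) - \<psi> x * loss_kernel x y) * (g x * g y))"
    and "integrable lborel (\<lambda>x. (2 * (\<integral>r. indicator {0..x} r * (\<psi> r * (r\<^sup>2 * (x - r)\<^sup>2)) \<partial>lborel) - \<psi> x * x ^ 5 / 30) * g x)"
    and "(\<integral>r. \<psi> r * line_collision g r \<partial>lborel)
      = (\<integral>p. (case p of (x, y) \<Rightarrow> (\<psi> (x + y) * (x + y)\<^sup>2
          + 2 * \<psi> (x - y) * (indicator {0..} (x - y) * (x - y)\<^sup>2) - \<psi> x * loss_kernel x y) * (g x * g y)) \<partial>(lborel \<Otimes>\<^sub>M lborel))
      + (\<integral>x. (2 * (\<integral>r. indicator {0..x} r * (\<psi> r * (r\<^sup>2 * (x - r)\<^sup>2)) \<partial>lborel) - \<psi> x * x ^ 5 / 30) * g x \<partial>lborel)"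
proof -
  let ?M = "lborel \<Otimes>\<^sub>M lborel :: (real \<times> real) measure"
  note W = GG.conv_weak[OF \<psi>] GG.corr_weak[OF \<psi>] linear_weak[OF \<psi>] loss_weak[OF \<psi>]
  note [measurable] = \<psi>(1)
  have eq: "\<psi> r * line_collision g r = \<psi> r * (r\<^sup>2 * (\<integral>s. g s * g (r - s) \<partial>lborel))
     + 2 * (\<psi> r * (indicator {0..} r * r\<^sup>2 * (\<integral>s. g s * g (s - r) \<partial>lborel)))
     + 2 * (\<psi> r * linear_gain g r) - \<psi> r * (g r * loss_rate g r)" for r
    by (simp add: line_collision_def algebra_simps)
  show "integrable lborel (\<lambda>r. \<psi> r * line_collision g r)"
    unfolding eq using W by (intro Bochner_Integration.integrable_add Bochner_Integration.integrable_diff integrable_mult_right)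
  have I1: "integrable ?M (\<lambda>(x, y). \<psi> (x + y) * (x + y)\<^sup>2 * (g x * g y))"
  proof (rule GG.bound_product[where a="2 * B"])
    fix x y :: real
    have "(x + y)\<^sup>2 \<le> 2 * (x\<^sup>2 + y\<^sup>2)" using sum_squares_bound[of x y] by (simp add: power2_eq_square algebra_simps)
    moreover have "0 \<le> B" using \<psi>(2)[of 0] by linarith
    ultimately show "\<bar>\<psi> (x + y) * (x + y)\<^sup>2\<bar> \<le> 2 * B * (x\<^sup>2 + y\<^sup>2)"
      using mult_mono[OF \<psi>(2)[of "x + y"], of "(x + y)\<^sup>2" "2 * (x\<^sup>2 + y\<^sup>2)"] by (simp add: abs_mult algebra_simps)
  qed measurable
  have I2: "integrable ?M (\<lambda>(x, y). \<psi> (x - y) * (indicator {0..} (x - y) * (x - y)\<^sup>2) * (g x * g y))"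
  proof (rule GG.bound_product[where a="B"])
    fix x y :: real assume "0 \<le> x" "0 \<le> y"
    then have "(x - y)\<^sup>2 \<le> (x\<^sup>2 + y\<^sup>2)" by (simp add: power2_eq_square algebra_simps)
    then have "indicator {0..} (x - y) * (x - y)\<^sup>2 \<le> (x\<^sup>2 + y\<^sup>2)" by (auto simp: indicator_def)
    moreover have "0 \<le> B" using \<psi>(2)[of 0] by linarith
    ultimately show "\<bar>\<psi> (x - y) * (indicator {0..} (x - y) * (x - y)\<^sup>2)\<bar> \<le> B * (x\<^sup>2 + y\<^sup>2)"
      using mult_mono[OF \<psi>(2)[of "x - y"], of "indicator {0..} (x - y) * (x - y)\<^sup>2" "(x\<^sup>2 + y\<^sup>2)"] by (simp add: abs_mult)
  qed measurable
  have e: "(\<lambda>(x, y). (\<psi> (x + y) * (x + y)\<^sup>2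
          + 2 * \<psi> (x - y) * (indicator {0..} (x - y) * (x - y)\<^sup>2) - \<psi> x * loss_kernel x y) * (g x * g y))
     = (\<lambda>p. (case p of (x, y) \<Rightarrow> \<psi> (x + y) * (x + y)\<^sup>2 * (g x * g y))
        + 2 * (case p of (x, y) \<Rightarrow> \<psi> (x - y) * (indicator {0..} (x - y) * (x - y)\<^sup>2) * (g x * g y))
        - (case p of (x, y) \<Rightarrow> \<psi> x * loss_kernel x y * (g x * g y)))"
    by (auto simp: algebra_simps)
  show "integrable ?M (\<lambda>(x, y). (\<psi> (x + y) * (x + y)\<^sup>2
          + 2 * \<psi> (x - y) * (indicator {0..} (x - y) * (x - y)\<^sup>2) - \<psi> x * loss_kernel x y) * (g x * g y))"
    unfolding e using I1 I2 W by (intro Bochner_Integration.integrable_add Bochner_Integration.integrable_diff integrable_mult_right)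
  have e2: "(\<lambda>x. (2 * (\<integral>r. indicator {0..x} r * (\<psi> r * (r\<^sup>2 * (x - r)\<^sup>2)) \<partial>lborel) - \<psi> x * x ^ 5 / 30) * g x)
     = (\<lambda>x. 2 * ((\<integral>r. indicator {0..x} r * (\<psi> r * (r\<^sup>2 * (x - r)\<^sup>2)) \<partial>lborel) * g x) - (\<psi> x * x ^ 5 * g x) / 30)"
    by (auto simp: algebra_simps)
  show "integrable lborel (\<lambda>x. (2 * (\<integral>r. indicator {0..x} r * (\<psi> r * (r\<^sup>2 * (x - r)\<^sup>2)) \<partial>lborel) - \<psi> x * x ^ 5 / 30) * g x)"
    unfolding e2 using W by (intro Bochner_Integration.integrable_diff integrable_mult_right integrable_divide)
  show "(\<integral>r. \<psi> r * line_collision g r \<partial>lborel)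
      = (\<integral>p. (case p of (x, y) \<Rightarrow> (\<psi> (x + y) * (x + y)\<^sup>2
          + 2 * \<psi> (x - y) * (indicator {0..} (x - y) * (x - y)\<^sup>2) - \<psi> x * loss_kernel x y) * (g x * g y)) \<partial>?M)
      + (\<integral>x. (2 * (\<integral>r. indicator {0..x} r * (\<psi> r * (r\<^sup>2 * (x - r)\<^sup>2)) \<partial>lborel) - \<psi> x * x ^ 5 / 30) * g x \<partial>lborel)"
    unfolding e e2 eq using I1 I2 W
    by (simp only: Bochner_Integration.integral_add Bochner_Integration.integral_diff integral_mult_right_zero
        Bochner_Integration.integrable_add Bochner_Integration.integrable_diff integrable_mult_right integral_divide_zero integrable_divide)
qed

end

section \<open>A concave test function for the second moment\<close>

text \<open>Up to a multiple of the energy density, \<open>concave_test R\<close> is the negative of a convex truncation of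
  \<open>r\<^sup>2\<close>. It is bounded, so that no moments beyond those of the solution class are needed.\<close>

definition concave_test :: "real \<Rightarrow> real \<Rightarrow> real" where
  "concave_test R r = (if r < 0 then 0 else if r \<le> R then 2 * R * r - r\<^sup>2 else R\<^sup>2)"

lemma measurable_concave_test [measurable]: "concave_test R \<in> borel_measurable borel"
  unfolding concave_test_def by measurable

lemma concave_test_bounds:
  assumes "0 \<le> R"
  shows "0 \<le> concave_test R r" "concave_test R r \<le> R\<^sup>2"
proof -
  have "0 \<le> r * (2 * R - r)" if "0 \<le> r" "r \<le> R" using that by simp
  then show "0 \<le> concave_test R r" by (auto simp: concave_test_def power2_eq_square algebra_simps)
  show "concave_test R r \<le> R\<^sup>2"
    using zero_le_power2[of "R - r"] by (simp add: concave_test_def power2_eq_square algebra_simps)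
qed

lemma concave_test_abs: "0 \<le> R \<Longrightarrow> \<bar>concave_test R r\<bar> \<le> R\<^sup>2"
  using concave_test_bounds[of R r] by simp

text \<open>For \<open>r^2\<close> itself the identity
  \<open>(x + y)^2 - x^2 - y^2 = 2 * x * y\<close> holds, and truncation can only lower this defect.
  The bound does not depend on \<open>R\<close>, so the resulting moments survive the removal of the
  truncation.\<close>

lemma concave_test_defect:
  assumes "0 \<le> R" "0 \<le> x" "0 \<le> y"
  shows "concave_test R x + concave_test R y - concave_test R (x + y) \<le> 2 * x * y"
proof -
  have wlog: "concave_test R x + concave_test R y - concave_test R (x + y) \<le> 2 * x * y"
    if "0 \<le> x" "x \<le> y" for x y
  proof -
    consider "x + y \<le> R" | "x + y > R" "y \<le> R" | "x \<le> R" "y > R" | "x > R" using \<open>0 \<le> x\<close> by linarith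
    then show ?thesis
    proof cases
      case 1
      then show ?thesis using that by (simp add: concave_test_def power2_eq_square algebra_simps)
    next
      case 2
      have "0 \<le> (x + y - R)\<^sup>2" by simp
      then show ?thesis using 2 that assms(1) by (simp add: concave_test_def power2_eq_square algebra_simps)
    next
      case 3
      have "0 \<le> x * (2 * (y - R) + x)" using 3 that by simp
      then show ?thesis using 3 that by (simp add: concave_test_def power2_eq_square algebra_simps)
    next
      case 4
      have "R * R \<le> x * y" using 4 that assms(1) by (intro mult_mono) auto
      moreover have "0 \<le> x * y" using that by simp
      ultimately have "R * R \<le> 2 * x * y" by linarith
      then show ?thesis using 4 that assms(1) by (simp add: concave_test_def power2_eq_square)
    qed
  qed
  show ?thesis
  proof (cases "x \<le> y")
    case True
    then show ?thesis using wlog assms by simp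
  next
    case False
    then show ?thesis using wlog[of y x] assms by (simp add: ac_simps)
  qed
qed

text \<open>A concave function on the half-line that vanishes at the origin is subadditive; here
  this is checked on the branches of the definition.\<close>

lemma concave_test_subadd:
  assumes "0 \<le> R" "0 \<le> x" "0 \<le> y"
  shows "concave_test R (x + y) \<le> concave_test R x + concave_test R y"
proof -
  have *: "R\<^sup>2 \<le> concave_test R a + concave_test R b" if "0 \<le> a" "0 \<le> b" "a > R" for a b
    using concave_test_bounds(1)[OF assms(1), of b] that assms by (simp add: concave_test_def)
  show ?thesis
  proof (cases "x \<le> R \<and> y \<le> R")
    case False
    then have "R\<^sup>2 \<le> concave_test R x + concave_test R y"
      using *[of x y] *[of y x] assms by auto
    then show ?thesis using concave_test_bounds(2)[OF assms(1), of "x + y"] by linarith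
  next
    case True
    show ?thesis
    proof (cases "x + y \<le> R")
      case True
      then show ?thesis using assms by (simp add: concave_test_def power2_eq_square algebra_simps)
    next
      case 2: False
      have "0 \<le> (R - x) * (x + y - R) + (R - y) * (x + y - R)"
        using True 2 by (intro add_nonneg_nonneg mult_nonneg_nonneg) auto
      moreover have "0 \<le> (R - x) * (R - y)" using True by auto
      moreover have "0 \<le> x * y" using assms by auto
      moreover have "0 \<le> R * (x + y - R)" using 2 assms by auto
      moreover have "0 \<le> (R - x) * x" "0 \<le> (R - y) * y" using True assms by auto
      ultimately have "R * R \<le> 2 * R * x - x * x + (2 * R * y - y * y)"
        by (simp add: algebra_simps)
      then show ?thesis using True 2 assms by (simp add: concave_test_def power2_eq_square)
    qed
  qed
qed

text \<open>By concavity and the value 0 at the origin, \<open>concave_test R r / r\<close> is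
  nonincreasing. The form without division includes \<open>r = 0\<close>.\<close>

lemma concave_test_chord:
  assumes "0 \<le> R" "0 \<le> r" "r \<le> x"
  shows "r * concave_test R x \<le> x * concave_test R r"
proof (cases "x \<le> R")
  case True
  have "0 \<le> r * x * (x - r)" using assms by auto
  then show ?thesis using True assms by (simp add: concave_test_def power2_eq_square algebra_simps)
next
  case False
  show ?thesis
  proof (cases "r \<le> R")
    case True
    have "r * (R * R) \<le> x * (2 * R * r - r * r)"
    proof -
      have "0 \<le> r * ((x - R) * (2 * R - r) + R * (R - r))"
        using True False assms by (intro mult_nonneg_nonneg add_nonneg_nonneg) auto
      then show ?thesis by (simp add: algebra_simps)
    qed
    then show ?thesis using True False assms by (simp add: concave_test_def power2_eq_square)
  next
    case 2: False
    then show ?thesis using False assms by (simp add: concave_test_def mult_right_mono)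
  qed
qed

text \<open>On linear functions the linear gain and loss cancel, so only the deviation from
  linearity counts. For \<open>x <= R\<close> it is the term \<open>- r^2\<close>, contributing
  \<open>1/30 - 2/105 = 1/70\<close>. For \<open>x > R\<close> the test function lies above its
  chord from the origin to \<open>x\<close>, so the difference is nonnegative.\<close>

lemma concave_test_linear:
  assumes R: "0 \<le> R" and x: "0 \<le> x"
  shows "indicator {0..R} x * x ^ 7 / 70
    \<le> 2 * (\<integral>r. indicator {0..x} r * (concave_test R r * (r\<^sup>2 * (x - r)\<^sup>2)) \<partial>lborel) - concave_test R x * x ^ 5 / 30"
proof -
  have poly: "integrable lborel (\<lambda>r. indicator {0..x} r * (r ^ k * (x - r)\<^sup>2))" for k
  proof -
    have "continuous_on {0..x} (\<lambda>r. r ^ k * (x - r)\<^sup>2)" by (intro continuous_intros)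
    from borel_integrable_compact[OF _ this] show ?thesis by simp
  qed
  have int: "integrable lborel (\<lambda>r. indicator {0..x} r * (concave_test R r * (r\<^sup>2 * (x - r)\<^sup>2)))"
  proof (rule Bochner_Integration.integrable_bound[OF integrable_mult_right[OF poly[of 2], of "R\<^sup>2"]])
    show "AE r in lborel. norm (indicator {0..x} r * (concave_test R r * (r\<^sup>2 * (x - r)\<^sup>2)))
      \<le> norm (R\<^sup>2 * (indicator {0..x} r * (r\<^sup>2 * (x - r)\<^sup>2)))"
      by (rule AE_I2) (use concave_test_abs[OF R] in \<open>auto simp: indicator_def abs_mult intro!: mult_right_mono\<close>)
  qed measurable
  show ?thesis
  proof (cases "x \<le> R")
    case True
    have "(\<integral>r. indicator {0..x} r * (concave_test R r * (r\<^sup>2 * (x - r)\<^sup>2)) \<partial>lborel)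
      = (\<integral>r. 2 * R * (indicator {0..x} r * (r ^ 3 * (x - r)\<^sup>2)) - indicator {0..x} r * (r ^ 4 * (x - r)\<^sup>2) \<partial>lborel)"
      by (rule Bochner_Integration.integral_cong)
        (use True in \<open>auto simp: indicator_def concave_test_def eval_nat_numeral algebra_simps\<close>)
    also have "\<dots> = 2 * R * (x ^ 6 / 60) - x ^ 7 / 105"
      using poly by (simp add: integral_poly_power2[OF x])
    finally have "(\<integral>r. indicator {0..x} r * (concave_test R r * (r\<^sup>2 * (x - r)\<^sup>2)) \<partial>lborel) = 2 * R * (x ^ 6 / 60) - x ^ 7 / 105" .
    then show ?thesis using True x by (simp add: concave_test_def field_simps eval_nat_numeral)
  next
    case False
    then have x0: "0 < x" using R by simp
    have "concave_test R x / x * (x ^ 6 / 60) = (\<integral>r. concave_test R x / x * (indicator {0..x} r * (r ^ 3 * (x - r)\<^sup>2)) \<partial>lborel)"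
      by (simp add: integral_poly_power2[OF x])
    also have "\<dots> \<le> (\<integral>r. indicator {0..x} r * (concave_test R r * (r\<^sup>2 * (x - r)\<^sup>2)) \<partial>lborel)"
    proof (rule integral_mono[OF integrable_mult_right[OF poly] int])
      fix r
      show "concave_test R x / x * (indicator {0..x} r * (r ^ 3 * (x - r)\<^sup>2)) \<le> indicator {0..x} r * (concave_test R r * (r\<^sup>2 * (x - r)\<^sup>2))"
      proof (cases "r \<in> {0..x}")
        case True
        have "concave_test R x / x * r \<le> concave_test R r"
          using concave_test_chord[OF R, of r x] True x0 by (simp add: field_simps)
        then have "concave_test R x / x * r * (r\<^sup>2 * (x - r)\<^sup>2) \<le> concave_test R r * (r\<^sup>2 * (x - r)\<^sup>2)"
          by (rule mult_right_mono) simp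
        moreover have "c * (r ^ 3 * d) = c * r * (r\<^sup>2 * d)" for c d :: real by (simp add: eval_nat_numeral)
        moreover have "indicator {0..x} r = (1::real)" using True by simp
        ultimately show ?thesis by (simp only: mult_1)
      qed simp
    qed
    finally show ?thesis using False x0 by (simp add: eval_nat_numeral field_simps)
  qed
qed

section \<open>Size of the collision term and its action on the concave test function\<close>

context profile
begin

text \<open>Testing with the sign of the collision term realises its \<open>L^1\<close> norm. The
  kernel is then at most \<open>8 * (x^2 + y^2)\<close>: 2 from the sum \<open>x + y\<close>, 2 from
  the difference \<open>x - y\<close>, 4 from the loss. Only moments up to order 5 enter, so the
  bound is uniform in time along a solution.\<close>

lemma collision_integral_abs_le:
  "(\<integral>r. \<bar>line_collision g r\<bar> \<partial>lborel) \<le> 16 * (moment 0 g * moment 2 g) + moment 5 g"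
  and collision_integrable: "integrable lborel (line_collision g)"
proof -
  let ?M = "lborel \<Otimes>\<^sub>M lborel :: (real \<times> real) measure"
  show I: "integrable lborel (line_collision g)"
    using collision_weak(1)[of "\<lambda>_. 1" 1] by simp
  define \<psi> where "\<psi> r = sgn (line_collision g r)" for r
  have [measurable]: "\<psi> \<in> borel_measurable borel"
    using borel_measurable_integrable[OF I] unfolding \<psi>_def by measurable
  have \<psi>: "\<bar>\<psi> r\<bar> \<le> 1" for r by (simp add: \<psi>_def sgn_real_def)
  note W = collision_weak[OF \<open>\<psi> \<in> borel_measurable borel\<close> \<psi>]
  have "(\<integral>p. (case p of (x, y) \<Rightarrow> (\<psi> (x + y) * (x + y)\<^sup>2
          + 2 * \<psi> (x - y) * (indicator {0..} (x - y) * (x - y)\<^sup>2) - \<psi> x * loss_kernel x y) * (g x * g y)) \<partial>?M)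
     \<le> (\<integral>p. 8 * ((case p of (x, y) \<Rightarrow> x ^ 2 * y ^ 0 * (g x * g y)) + (case p of (x, y) \<Rightarrow> x ^ 0 * y ^ 2 * (g x * g y))) \<partial>?M)"
  proof (rule integral_mono[OF W(2)])
    show "integrable ?M (\<lambda>p. 8 * ((case p of (x, y) \<Rightarrow> x ^ 2 * y ^ 0 * (g x * g y)) + (case p of (x, y) \<Rightarrow> x ^ 0 * y ^ 2 * (g x * g y))))"
      by (intro integrable_mult_right Bochner_Integration.integrable_add GG.poly_product) auto
    fix p :: "real \<times> real"
    obtain x y where p: "p = (x, y)" by (cases p)
    show "(case p of (x, y) \<Rightarrow> (\<psi> (x + y) * (x + y)\<^sup>2
          + 2 * \<psi> (x - y) * (indicator {0..} (x - y) * (x - y)\<^sup>2) - \<psi> x * loss_kernel x y) * (g x * g y))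
       \<le> 8 * ((case p of (x, y) \<Rightarrow> x ^ 2 * y ^ 0 * (g x * g y)) + (case p of (x, y) \<Rightarrow> x ^ 0 * y ^ 2 * (g x * g y)))"
    proof (cases "0 \<le> x \<and> 0 \<le> y")
      case True
      have arith: "- d \<le> 4 * c \<Longrightarrow> a \<le> 2 * c \<Longrightarrow> b \<le> c \<Longrightarrow> a + 2 * b - d \<le> 8 * c" for a b c d :: real
        by linarith
      have u: "\<psi> z * a \<le> a" "- (\<psi> z * a) \<le> a" if "0 \<le> a" for z a
        using mult_right_mono[of "\<psi> z" 1 a] mult_right_mono[of "- \<psi> z" 1 a] \<psi>[of z] that by auto
      have "- (\<psi> x * loss_kernel x y) \<le> 4 * (x\<^sup>2 + y\<^sup>2)"
      proof -
        have "0 \<le> loss_kernel x y" using True by (simp add: loss_kernel_def)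
        then show ?thesis using u(2)[of "loss_kernel x y" x] loss_kernel_bound[of x y] True by linarith
      qed
      moreover have "\<psi> (x + y) * (x + y)\<^sup>2 \<le> 2 * (x\<^sup>2 + y\<^sup>2)"
      proof -
        have "(x + y)\<^sup>2 \<le> 2 * (x\<^sup>2 + y\<^sup>2)" using sum_squares_bound[of x y] by (simp add: power2_eq_square algebra_simps)
        with u(1)[OF zero_le_power2, of "x + y" "x + y"] show ?thesis by linarith
      qed
      moreover have "\<psi> (x - y) * (indicator {0..} (x - y) * (x - y)\<^sup>2) \<le> x\<^sup>2 + y\<^sup>2"
      proof -
        have "indicator {0..} (x - y) * (x - y)\<^sup>2 \<le> x\<^sup>2 + y\<^sup>2"
          using True by (auto simp: indicator_def power2_eq_square algebra_simps)
        then show ?thesis using u(1)[of "indicator {0..} (x - y) * (x - y)\<^sup>2" "x - y"] by simp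
      qed
      ultimately have "\<psi> (x + y) * (x + y)\<^sup>2
          + 2 * (\<psi> (x - y) * (indicator {0..} (x - y) * (x - y)\<^sup>2)) - \<psi> x * loss_kernel x y \<le> 8 * (x\<^sup>2 + y\<^sup>2)"
        by (rule arith)
      then have "\<psi> (x + y) * (x + y)\<^sup>2
          + 2 * \<psi> (x - y) * (indicator {0..} (x - y) * (x - y)\<^sup>2) - \<psi> x * loss_kernel x y \<le> 8 * (x\<^sup>2 + y\<^sup>2)"
        by (simp only: mult.assoc)
      then have "(\<psi> (x + y) * (x + y)\<^sup>2
          + 2 * \<psi> (x - y) * (indicator {0..} (x - y) * (x - y)\<^sup>2) - \<psi> x * loss_kernel x y) * (g x * g y)
          \<le> 8 * (x\<^sup>2 + y\<^sup>2) * (g x * g y)"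
        by (rule mult_right_mono) (simp add: nonneg)
      then show ?thesis by (simp add: p algebra_simps)
    qed (use zero[of x] zero[of y] p in auto)
  qed
  also have "\<dots> = 16 * (moment 0 g * moment 2 g)"
    using GG.poly_product[of 2 0] GG.poly_product[of 0 2] by simp
  finally have 1: "(\<integral>p. (case p of (x, y) \<Rightarrow> (\<psi> (x + y) * (x + y)\<^sup>2
          + 2 * \<psi> (x - y) * (indicator {0..} (x - y) * (x - y)\<^sup>2) - \<psi> x * loss_kernel x y) * (g x * g y)) \<partial>?M)
     \<le> 16 * (moment 0 g * moment 2 g)" .
  have "(\<integral>x. (2 * (\<integral>r. indicator {0..x} r * (\<psi> r * (r\<^sup>2 * (x - r)\<^sup>2)) \<partial>lborel) - \<psi> x * x ^ 5 / 30) * g x \<partial>lborel)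
     \<le> (\<integral>x. x ^ 5 * g x \<partial>lborel)"
  proof (rule integral_mono[OF W(3)])
    show "integrable lborel (\<lambda>x. x ^ 5 * g x)" by (rule moments) simp
    fix x
    show "(2 * (\<integral>r. indicator {0..x} r * (\<psi> r * (r\<^sup>2 * (x - r)\<^sup>2)) \<partial>lborel) - \<psi> x * x ^ 5 / 30) * g x \<le> x ^ 5 * g x"
    proof (cases "0 \<le> x")
      case True
      have "continuous_on {0..x} (\<lambda>r. r\<^sup>2 * (x - r)\<^sup>2)" by (intro continuous_intros)
      from borel_integrable_compact[OF _ this]
      have "integrable lborel (\<lambda>r. indicator {0..x} r * (r\<^sup>2 * (x - r)\<^sup>2))" by simp
      then have "(\<integral>r. indicator {0..x} r * (\<psi> r * (r\<^sup>2 * (x - r)\<^sup>2)) \<partial>lborel) \<le> (\<integral>r. indicator {0..x} r * (r\<^sup>2 * (x - r)\<^sup>2) \<partial>lborel)"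
      proof (rule integral_mono')
        fix r
        have "\<psi> r * (r\<^sup>2 * (x - r)\<^sup>2) \<le> 1 * (r\<^sup>2 * (x - r)\<^sup>2)"
          using \<psi>[of r] by (intro mult_right_mono) auto
        then show "indicator {0..x} r * (\<psi> r * (r\<^sup>2 * (x - r)\<^sup>2)) \<le> indicator {0..x} r * (r\<^sup>2 * (x - r)\<^sup>2)"
          by (auto simp: indicator_def)
      qed simp
      moreover have "- (\<psi> x * x ^ 5) \<le> x ^ 5"
        using mult_right_mono[of "- \<psi> x" 1 "x ^ 5"] \<psi>[of x] True by simp
      moreover have "0 \<le> x ^ 5" using True by simp
      ultimately have "2 * (\<integral>r. indicator {0..x} r * (\<psi> r * (r\<^sup>2 * (x - r)\<^sup>2)) \<partial>lborel) - \<psi> x * x ^ 5 / 30 \<le> x ^ 5"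
        using integral_poly_power2(1)[OF True] by linarith
      then show ?thesis by (rule mult_right_mono) (rule nonneg)
    qed (simp add: zero)
  qed
  then have 2: "(\<integral>x. (2 * (\<integral>r. indicator {0..x} r * (\<psi> r * (r\<^sup>2 * (x - r)\<^sup>2)) \<partial>lborel) - \<psi> x * x ^ 5 / 30) * g x \<partial>lborel)
     \<le> moment 5 g" by (simp add: moment_def)
  have "(\<integral>r. \<bar>line_collision g r\<bar> \<partial>lborel) = (\<integral>r. \<psi> r * line_collision g r \<partial>lborel)"
    by (rule Bochner_Integration.integral_cong) (auto simp: \<psi>_def sgn_real_def)
  with 1 2 W(4) show "(\<integral>r. \<bar>line_collision g r\<bar> \<partial>lborel) \<le> 16 * (moment 0 g * moment 2 g) + moment 5 g"
    by linarith
qed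

text \<open>Exchanging \<open>x\<close> and \<open>y\<close> and adding groups the kernel, for
  \<open>y <= x\<close>, into a multiple of \<open>\<psi> x + \<psi> y - \<psi> (x + y)\<close> with
  a negative sign and a multiple of \<open>\<psi> (x - y) + \<psi> y - \<psi> x\<close> with a
  positive one. The first is controlled by the defect estimate; the second is nonnegative by
  subadditivity and is dropped.\<close>

lemma concave_test_collision:
  assumes R: "0 \<le> R"
  shows "- (\<integral>r. concave_test R r * line_collision g r \<partial>lborel)
    \<le> 4 * (moment 1 g * moment 3 g + (moment 2 g)\<^sup>2) - (\<integral>x. indicator {0..R} x * (x ^ 7 * g x) \<partial>lborel) / 70"
proof -
  let ?M = "lborel \<Otimes>\<^sub>M lborel :: (real \<times> real) measure"
  let ?\<psi> = "concave_test R"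
  note W = collision_weak[OF measurable_concave_test concave_test_abs[OF R]]
  define S where "S x y = (?\<psi> (x + y) * (x + y)\<^sup>2
          + 2 * ?\<psi> (x - y) * (indicator {0..} (x - y) * (x - y)\<^sup>2) - ?\<psi> x * loss_kernel x y) * (g x * g y)" for x y
  have S: "integrable ?M (case_prod S)" using W(2) unfolding S_def .
  have S': "integrable ?M (\<lambda>(x, y). S y x)"
    using lborel_pair.integrable_product_swap[OF S] by simp
  have swap: "integral\<^sup>L ?M (\<lambda>(x, y). S y x) = integral\<^sup>L ?M (case_prod S)"
    using lborel_pair.integral_product_swap[of "case_prod S"] S by (auto simp: split_def)
  have sym: "S x y + S y x + 4 * (x ^ 3 * y ^ 1 * (g x * g y)) + 8 * (x ^ 2 * y ^ 2 * (g x * g y)) + 4 * (x ^ 1 * y ^ 3 * (g x * g y)) \<ge> 0"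
    if "y \<le> x" for x y
  proof (cases "0 \<le> x \<and> 0 \<le> y")
    case True
    \<comment> \<open>In the sector \<open>y <= x\<close> the two loss kernels are
      \<open>2 * (x + y)^2 + 2 * (x - y)^2\<close> and \<open>2 * (x + y)^2 - 2 * (x - y)^2\<close>,
      the weights carried by the two gains.\<close>
    have k: "?\<psi> x * loss_kernel x y + ?\<psi> y * loss_kernel y x
       = 2 * (x + y)\<^sup>2 * (?\<psi> x + ?\<psi> y) + 2 * (x - y)\<^sup>2 * (?\<psi> x - ?\<psi> y)"
      using that by (auto simp: loss_kernel_def power2_eq_square algebra_simps)
    have i: "?\<psi> (x - y) * (indicator {0..} (x - y) * (x - y)\<^sup>2) + ?\<psi> (y - x) * (indicator {0..} (y - x) * (y - x)\<^sup>2)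
       = ?\<psi> (x - y) * (x - y)\<^sup>2"
      using that by (auto simp: indicator_def)
    have "?\<psi> (x + y) * (x + y)\<^sup>2 + 2 * ?\<psi> (x - y) * (indicator {0..} (x - y) * (x - y)\<^sup>2) - ?\<psi> x * loss_kernel x y
      + (?\<psi> (y + x) * (y + x)\<^sup>2 + 2 * ?\<psi> (y - x) * (indicator {0..} (y - x) * (y - x)\<^sup>2) - ?\<psi> y * loss_kernel y x)
      = 2 * (x + y)\<^sup>2 * ?\<psi> (x + y) + 2 * (?\<psi> (x - y) * (x - y)\<^sup>2) - (2 * (x + y)\<^sup>2 * (?\<psi> x + ?\<psi> y) + 2 * (x - y)\<^sup>2 * (?\<psi> x - ?\<psi> y))"
      unfolding k[symmetric] i[symmetric] by (simp add: add.commute)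
    also have "\<dots> = - 2 * (x + y)\<^sup>2 * (?\<psi> x + ?\<psi> y - ?\<psi> (x + y)) + 2 * (x - y)\<^sup>2 * (?\<psi> (x - y) + ?\<psi> y - ?\<psi> x)"
      by (simp add: algebra_simps)
    also have "\<dots> \<ge> - 2 * (x + y)\<^sup>2 * (2 * x * y)"
    proof -
      have "(x + y)\<^sup>2 * (?\<psi> x + ?\<psi> y - ?\<psi> (x + y)) \<le> (x + y)\<^sup>2 * (2 * x * y)"
        using True by (intro mult_left_mono concave_test_defect R) auto
      moreover have "0 \<le> (x - y)\<^sup>2 * (?\<psi> (x - y) + ?\<psi> y - ?\<psi> x)"
        using concave_test_subadd[OF R, of "x - y" y] True that by auto
      ultimately show ?thesis by linarith
    qed
    finally have "0 \<le> (?\<psi> (x + y) * (x + y)\<^sup>2 + 2 * ?\<psi> (x - y) * (indicator {0..} (x - y) * (x - y)\<^sup>2) - ?\<psi> x * loss_kernel x y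
      + (?\<psi> (y + x) * (y + x)\<^sup>2 + 2 * ?\<psi> (y - x) * (indicator {0..} (y - x) * (y - x)\<^sup>2) - ?\<psi> y * loss_kernel y x)
      + 2 * (x + y)\<^sup>2 * (2 * x * y)) * (g x * g y)"
      by (intro mult_nonneg_nonneg) (auto simp: nonneg)
    also have "\<dots> = S x y + S y x + 4 * (x ^ 3 * y ^ 1 * (g x * g y)) + 8 * (x ^ 2 * y ^ 2 * (g x * g y)) + 4 * (x ^ 1 * y ^ 3 * (g x * g y))"
      unfolding S_def by (simp add: algebra_simps eval_nat_numeral)
    finally show ?thesis .
  qed (use zero[of x] zero[of y] in \<open>auto simp: S_def\<close>)
  have sym': "S x y + S y x + 4 * (x ^ 3 * y ^ 1 * (g x * g y)) + 8 * (x ^ 2 * y ^ 2 * (g x * g y)) + 4 * (x ^ 1 * y ^ 3 * (g x * g y)) \<ge> 0" for x y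
    using sym[of y x] sym[of x y] by (cases "y \<le> x") (auto simp: algebra_simps)
  note P = GG.poly_product[of 3 1] GG.poly_product[of 2 2] GG.poly_product[of 1 3]
  have "0 \<le> (\<integral>p. (case p of (x, y) \<Rightarrow> S x y) + (case p of (x, y) \<Rightarrow> S y x) + 4 * (case p of (x, y) \<Rightarrow> x ^ 3 * y ^ 1 * (g x * g y))
     + 8 * (case p of (x, y) \<Rightarrow> x ^ 2 * y ^ 2 * (g x * g y)) + 4 * (case p of (x, y) \<Rightarrow> x ^ 1 * y ^ 3 * (g x * g y)) \<partial>?M)"
    by (rule integral_nonneg_AE, rule AE_I2) (use sym' in auto)
  also have "\<dots> = 2 * integral\<^sup>L ?M (case_prod S) + 4 * (moment 3 g * moment 1 g) + 8 * (moment 2 g * moment 2 g) + 4 * (moment 1 g * moment 3 g)"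
    using S S' swap P by simp
  finally have quad: "- integral\<^sup>L ?M (case_prod S) \<le> 4 * (moment 1 g * moment 3 g + (moment 2 g)\<^sup>2)"
    by (simp add: power2_eq_square algebra_simps)
  have "(\<integral>x. indicator {0..R} x * (x ^ 7 * g x) \<partial>lborel) / 70 = (\<integral>x. indicator {0..R} x * x ^ 7 / 70 * g x \<partial>lborel)"
    by (simp add: mult.assoc)
  also have "\<dots> \<le> (\<integral>x. (2 * (\<integral>r. indicator {0..x} r * (?\<psi> r * (r\<^sup>2 * (x - r)\<^sup>2)) \<partial>lborel) - ?\<psi> x * x ^ 5 / 30) * g x \<partial>lborel)"
  proof (rule integral_mono'[OF W(3)])
    fix x
    show *: "indicator {0..R} x * x ^ 7 / 70 * g x \<le> (2 * (\<integral>r. indicator {0..x} r * (?\<psi> r * (r\<^sup>2 * (x - r)\<^sup>2)) \<partial>lborel) - ?\<psi> x * x ^ 5 / 30) * g x"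
    proof (cases "0 \<le> x")
      case True
      show ?thesis by (rule mult_right_mono[OF concave_test_linear[OF R True] nonneg])
    qed (simp add: zero)
    have "0 \<le> indicator {0..R} x * x ^ 7 / 70 * g x" by (auto simp: indicator_def nonneg)
    with * show "0 \<le> (2 * (\<integral>r. indicator {0..x} r * (?\<psi> r * (r\<^sup>2 * (x - r)\<^sup>2)) \<partial>lborel) - ?\<psi> x * x ^ 5 / 30) * g x"
      by (rule order_trans[rotated])
  qed
  finally show ?thesis using quad W(4) unfolding S_def by linarith
qed

end

section \<open>Pointwise and moment estimates\<close>

text \<open>A \<open>C\<^sup>1\<close> convex substitute for the positive part of \<open>x - M\<close>: the continuity of its derivative is
  what allows the passage to the limit in \<open>excess_chain\<close> below.\<close>

definition excess :: "real \<Rightarrow> real \<Rightarrow> real" where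
  "excess M x = (max M x - M)\<^sup>2 / max M x"

definition excess_deriv :: "real \<Rightarrow> real \<Rightarrow> real" where
  "excess_deriv M x = 1 - (M / max M x)\<^sup>2"

lemma measurable_excess [measurable]:
  "excess M \<in> borel_measurable borel" "excess_deriv M \<in> borel_measurable borel"
  unfolding excess_def excess_deriv_def by measurable

context
  fixes M :: real
  assumes M: "0 < M"
begin

lemma max_pos: "0 < max M x"
  using M by linarith

lemma excess_alt: "excess M x = max M x - 2 * M + M\<^sup>2 / max M x"
  using max_pos[of x] by (simp add: excess_def power2_eq_square field_simps)

lemma excess_nonneg: "0 \<le> excess M x"
  using max_pos[of x] by (simp add: excess_def)

lemma excess_below: "x \<le> M \<Longrightarrow> excess M x = 0"
  by (simp add: excess_def)

lemma excess_eq_0_imp: "excess M x = 0 \<Longrightarrow> x \<le> M"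
  using max_pos[of x] by (auto simp: excess_def)

lemma excess_le: 
  assumes "0 \<le> x" shows "excess M x \<le> x"
proof (cases "x \<le> M")
  case False
  then have "M\<^sup>2 / x \<le> M" using M by (simp add: power2_eq_square field_simps)
  then show ?thesis using False M unfolding excess_alt by simp
qed (use assms excess_below in simp)

text \<open>The asymptote of the excess is \<open>x - 2 * M\<close>, not \<open>x - M\<close>; hence
  the factor two.\<close>

lemma excess_lower: "x \<le> 2 * M + excess M x"
proof -
  have "0 \<le> M\<^sup>2 / max M x" using max_pos[of x] by simp
  then show ?thesis unfolding excess_alt by linarith
qed

lemma excess_deriv_nonneg: "0 \<le> excess_deriv M x"
proof -
  have "(M / max M x)\<^sup>2 \<le> 1\<^sup>2" using M by (intro power_mono) auto
  then show ?thesis by (simp add: excess_deriv_def)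
qed

lemma excess_deriv_le: "excess_deriv M x \<le> 1"
  by (simp add: excess_deriv_def)

text \<open>This is the gradient inequality with the derivative taken at the later value
  \<open>b\<close>, the form needed when \<open>a\<close> and \<open>b\<close> are densities at the
  two ends of a time cell.\<close>

lemma excess_convex: "excess M b - excess M a \<le> excess_deriv M b * (b - a)"
proof -
  let ?a = "max M a" and ?b = "max M b"
  \<comment> \<open>The convexity defect of \<open>x + M^2 / x\<close> has this closed form. Passing
    from \<open>max M b - max M a\<close> to \<open>b - a\<close> is harmless, because the
    derivative vanishes for \<open>b <= M\<close> and \<open>max M a >= a\<close> otherwise.\<close>
  have "excess_deriv M b * (?b - ?a) - (excess M b - excess M a) = M\<^sup>2 * (?b - ?a)\<^sup>2 / (?a * ?b\<^sup>2)"
    using max_pos[of a] max_pos[of b] unfolding excess_alt excess_deriv_def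
    by (simp add: power2_eq_square divide_simps) algebra
  also have "\<dots> \<ge> 0" using max_pos[of a] by simp
  finally have "excess M b - excess M a \<le> excess_deriv M b * (?b - ?a)" by simp
  also have "\<dots> \<le> excess_deriv M b * (b - a)"
  proof (cases "b \<le> M")
    case True
    then show ?thesis using M by (simp add: excess_deriv_def)
  next
    case False
    then show ?thesis by (intro mult_left_mono excess_deriv_nonneg) auto
  qed
  finally show ?thesis .
qed

lemma excess_le_deriv: "excess M x \<le> excess_deriv M x * (x - M)"
  using excess_convex[of x M] excess_below[of M] by simp

lemma excess_lipschitz: "\<bar>excess M b - excess M a\<bar> \<le> \<bar>b - a\<bar>"
proof -
  have *: "excess M b - excess M a \<le> \<bar>b - a\<bar>" for a b
  proof -
    have "excess_deriv M b * (b - a) \<le> 1 * \<bar>b - a\<bar>"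
      using excess_deriv_nonneg[of b] excess_deriv_le[of b]
      by (metis abs_ge_self abs_ge_zero abs_mult abs_of_nonneg mult_right_mono order_trans)
    from order_trans[OF excess_convex this] show ?thesis by simp
  qed
  show ?thesis using *[of a b] *[of b a] by linarith
qed

text \<open>The slope of \<open>1 - M^2 / x^2\<close> is \<open>2 * M^2 / x^3\<close>, at most
  \<open>2 / M\<close> on \<open>x >= M\<close>. This regularity would fail for the step function
  that is the derivative of the true positive part.\<close>

lemma excess_deriv_lipschitz: "\<bar>excess_deriv M b - excess_deriv M a\<bar> \<le> 2 / M * \<bar>b - a\<bar>"
proof -
  let ?p = "M / max M a" and ?q = "M / max M b"
  have p: "0 \<le> ?p" "?p \<le> 1" and q: "0 \<le> ?q" "?q \<le> 1"
    using M by auto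
  have "excess_deriv M b - excess_deriv M a = (?p - ?q) * (?p + ?q)"
    by (simp add: excess_deriv_def power2_eq_square algebra_simps)
  then have "\<bar>excess_deriv M b - excess_deriv M a\<bar> = \<bar>?p - ?q\<bar> * (?p + ?q)"
    using p q by (simp add: abs_mult)
  also have "\<dots> \<le> \<bar>?p - ?q\<bar> * 2"
    by (rule mult_left_mono) (use p q in auto)
  also have "?p - ?q = ?p * ?q * (max M b - max M a) / M"
    using M max_pos[of a] max_pos[of b] by (simp add: divide_simps algebra_simps)
  also have "\<bar>?p * ?q * (max M b - max M a) / M\<bar> \<le> \<bar>max M b - max M a\<bar> / M"
  proof -
    have "\<bar>p * q * d / M\<bar> \<le> \<bar>d\<bar> / M" if "0 \<le> p" "p \<le> 1" "0 \<le> q" "q \<le> 1" for p q d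
      using mult_right_mono[OF mult_le_one[of p q], of "\<bar>d\<bar>"] that M
      by (simp add: abs_mult divide_right_mono)
    then show ?thesis using p q by blast
  qed
  also have "\<dots> \<le> \<bar>b - a\<bar> / M"
    using M by (intro divide_right_mono) auto
  finally show ?thesis by (simp add: mult.commute)
qed

end

section \<open>Effect of collisions on the excess, and inequalities between moments\<close>

context profile
begin

lemma profile_excess:
  assumes M: "0 < M"
  shows "profile (\<lambda>x. excess M (g x))"
proof
  show "(\<lambda>x. excess M (g x)) \<in> borel_measurable borel" by measurable
  show "0 \<le> excess M (g x)" for x by (rule excess_nonneg[OF M])
  show "excess M (g x) = 0" if "x < 0" for x using excess_below[OF M, of 0] M that by (simp add: zero)
  show "integrable lborel (\<lambda>x. x ^ k * excess M (g x))" if "k \<le> 5" for k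
  proof (rule Bochner_Integration.integrable_bound[OF moments[OF that]])
    show "AE x in lborel. norm (x ^ k * excess M (g x)) \<le> norm (x ^ k * g x)"
      by (rule AE_I2) (use excess_le[OF M nonneg] excess_nonneg[OF M] nonneg in \<open>auto simp: abs_mult intro!: mult_left_mono\<close>)
  qed measurable
qed

text \<open>This part of the loss, acting on the excess, compensates the second moment of the excess
  that the convolution creates.\<close>

lemma loss_rate_lower:
  assumes "0 \<le> r"
  shows "4 * r\<^sup>2 * moment 0 g \<le> loss_rate g r"
proof -
  have "4 * r\<^sup>2 * moment 0 g = (\<integral>s. 4 * r\<^sup>2 * g s \<partial>lborel)" by (simp add: moment_def)
  also have "\<dots> \<le> (\<integral>s. loss_kernel r s * g s \<partial>lborel)"
  proof (rule integral_mono)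
    show "integrable lborel (\<lambda>s. 4 * r\<^sup>2 * g s)" by (intro integrable_mult_right integrable_profile)
    show "integrable lborel (\<lambda>s. loss_kernel r s * g s)" by (rule loss_kernel_integrable[OF assms])
    fix s
    have "4 * r\<^sup>2 \<le> loss_kernel r s"
    proof (cases "s \<le> r")
      case False
      then have "r * r \<le> r * s" "0 \<le> r * s" using assms by (auto intro: mult_left_mono)
      then have "4 * (r * r) \<le> 8 * (r * s)" by linarith
      then show ?thesis using False by (simp add: loss_kernel_def power2_eq_square)
    qed (simp add: loss_kernel_def)
    then show "4 * r\<^sup>2 * g s \<le> loss_kernel r s * g s" by (rule mult_right_mono) (rule nonneg)
  qed
  also have "\<dots> \<le> loss_rate g r" using assms by (simp add: loss_rate_def)
  finally show ?thesis .
qed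

text \<open>In both quadratic gains one density is replaced by its bounded part
  \<open>2 * M\<close>. The comparison with the loss is made under the integral, pointwise in
  \<open>s\<close>, and leaves \<open>2 * M * r * s\<close> of the loss to spare; after integration
  this is the first term on the right of \<open>cond\<close>, up to the factor
  \<open>r\<close>.\<close>

lemma gain_by_loss:
  assumes M: "0 < M" and r: "0 \<le> r" and cond: "2 * r * moment 2 g \<le> M * (2 * moment 1 g + r ^ 4 / 30)"
  shows "r\<^sup>2 * (\<integral>s. indicator {..r} s * (2 * M) * g s \<partial>lborel) + 2 * (r\<^sup>2 * (\<integral>s. indicator {r..} s * (2 * M) * g s \<partial>lborel))
      + 2 * linear_gain g r \<le> M * loss_rate g r"
proof -
  have I: "integrable lborel (\<lambda>s. indicator A s * (2 * M) * g s)" if [measurable]: "A \<in> sets borel" for A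
    using M by (intro Bochner_Integration.integrable_bound[OF integrable_mult_right[OF integrable_profile, of "2 * M"]])
      (auto simp: indicator_def)
  have L: "integrable lborel (\<lambda>s. indicator {0..s} r * (r\<^sup>2 * (s - r)\<^sup>2) * g s)"
  proof (rule Bochner_Integration.integrable_bound)
    show "integrable lborel (\<lambda>s. r\<^sup>2 * (s ^ 2 * g s))" by (intro integrable_mult_right moments) simp
    show "(\<lambda>s. indicator {0..s} r * (r\<^sup>2 * (s - r)\<^sup>2) * g s) \<in> borel_measurable lborel"
      unfolding indicator_def atLeastAtMost_iff by measurable
    show "AE s in lborel. norm (indicator {0..s} r * (r\<^sup>2 * (s - r)\<^sup>2) * g s) \<le> norm (r\<^sup>2 * (s ^ 2 * g s))"
      using r by (intro AE_I2) (auto simp: indicator_def nonneg abs_mult mult.assoc intro!: mult_left_mono mult_right_mono power_mono)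
  qed
  note K = loss_kernel_integrable[OF r]
  have lin: "(\<integral>s. r\<^sup>2 * F s + 2 * (r\<^sup>2 * G s) + 2 * H s - M * K s \<partial>lborel)
      = r\<^sup>2 * (\<integral>s. F s \<partial>lborel) + 2 * (r\<^sup>2 * (\<integral>s. G s \<partial>lborel)) + 2 * (\<integral>s. H s \<partial>lborel) - M * (\<integral>s. K s \<partial>lborel)"
    if "integrable lborel F" "integrable lborel G" "integrable lborel H" "integrable lborel K" for F G H K :: "real \<Rightarrow> real"
    using that by simp
  \<comment> \<open>For \<open>s < r\<close> the gain \<open>2 * M * r^2\<close> faces the loss
    \<open>4 * M * (r^2 + s^2)\<close>; for \<open>s > r\<close> the gain \<open>4 * M * r^2\<close>
    faces \<open>8 * M * r * s\<close>, and \<open>r^2 <= r * s\<close>. At \<open>s = r\<close>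
    both indicators count, giving \<open>6 * M * r^2\<close> against \<open>8 * M * r^2\<close>. The
    linear gain is enlarged to \<open>2 * r^2 * s^2\<close>.\<close>
  have pt: "r\<^sup>2 * (indicator {..r} s * (2 * M) * g s) + 2 * (r\<^sup>2 * (indicator {r..} s * (2 * M) * g s))
      + 2 * (indicator {0..s} r * (r\<^sup>2 * (s - r)\<^sup>2) * g s) - M * (loss_kernel r s * g s)
      \<le> 2 * r\<^sup>2 * (s ^ 2 * g s) - 2 * M * r * (s ^ 1 * g s)" for s
  proof (cases "0 \<le> s")
    case True
    have "r\<^sup>2 * (indicator {..r} s * (2 * M)) + 2 * (r\<^sup>2 * (indicator {r..} s * (2 * M)))
      + 2 * (indicator {0..s} r * (r\<^sup>2 * (s - r)\<^sup>2)) - M * loss_kernel r s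
      \<le> 2 * r\<^sup>2 * s\<^sup>2 - 2 * M * r * s"
    proof (cases s r rule: linorder_cases)
      case less
      have "2 * M * r\<^sup>2 - M * (4 * (r\<^sup>2 + s\<^sup>2)) = - (2 * M * r * s) - M * ((r - s)\<^sup>2 + r\<^sup>2 + 3 * s\<^sup>2)"
        by (simp add: power2_eq_square algebra_simps)
      moreover have "0 \<le> r\<^sup>2 * s\<^sup>2" "0 \<le> M * ((r - s)\<^sup>2 + r\<^sup>2 + 3 * s\<^sup>2)" using M by auto
      ultimately have "2 * M * r\<^sup>2 - M * (4 * (r\<^sup>2 + s\<^sup>2)) \<le> 2 * (r\<^sup>2 * s\<^sup>2) - 2 * M * r * s"
        by linarith
      then show ?thesis using less r True
        by (simp add: loss_kernel_def indicator_def algebra_simps)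
    next
      case equal
      have "0 \<le> r\<^sup>2 * r\<^sup>2" by simp
      then show ?thesis using equal r
        by (simp add: loss_kernel_def indicator_def power2_eq_square algebra_simps)
    next
      case greater
      have "r\<^sup>2 * (s - r)\<^sup>2 \<le> r\<^sup>2 * s\<^sup>2"
        using greater r by (intro mult_left_mono power_mono) auto
      moreover have "M * r * r \<le> M * r * s"
        using greater r M by (intro mult_left_mono) auto
      moreover have "0 \<le> M * r * s" using greater r M by auto
      ultimately have "4 * M * r * r + 2 * (r\<^sup>2 * (s - r)\<^sup>2) - 8 * M * r * s \<le> 2 * (r\<^sup>2 * s\<^sup>2) - 2 * M * r * s"
        by linarith
      then show ?thesis using greater r
        by (simp add: loss_kernel_def indicator_def power2_eq_square algebra_simps)
    qed
    from mult_right_mono[OF this nonneg[of s]] show ?thesis by (simp add: algebra_simps)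
  qed (simp add: zero)
  have "r\<^sup>2 * (\<integral>s. indicator {..r} s * (2 * M) * g s \<partial>lborel) + 2 * (r\<^sup>2 * (\<integral>s. indicator {r..} s * (2 * M) * g s \<partial>lborel))
      + 2 * linear_gain g r - M * (\<integral>s. loss_kernel r s * g s \<partial>lborel)
     = (\<integral>s. r\<^sup>2 * (indicator {..r} s * (2 * M) * g s) + 2 * (r\<^sup>2 * (indicator {r..} s * (2 * M) * g s))
      + 2 * (indicator {0..s} r * (r\<^sup>2 * (s - r)\<^sup>2) * g s) - M * (loss_kernel r s * g s) \<partial>lborel)"
    unfolding linear_gain_def using I[OF atMost_borel, of r] I[OF atLeast_borel, of r] L K
    by (intro lin[symmetric]) auto
  also have "\<dots> \<le> (\<integral>s. 2 * r\<^sup>2 * (s ^ 2 * g s) - 2 * M * r * (s ^ 1 * g s) \<partial>lborel)"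
  proof (rule integral_mono)
    show "integrable lborel (\<lambda>s. r\<^sup>2 * (indicator {..r} s * (2 * M) * g s) + 2 * (r\<^sup>2 * (indicator {r..} s * (2 * M) * g s))
      + 2 * (indicator {0..s} r * (r\<^sup>2 * (s - r)\<^sup>2) * g s) - M * (loss_kernel r s * g s))"
      using L K by (intro Bochner_Integration.integrable_add Bochner_Integration.integrable_diff integrable_mult_right I) auto
    show "integrable lborel (\<lambda>s. 2 * r\<^sup>2 * (s ^ 2 * g s) - 2 * M * r * (s ^ 1 * g s))"
      by (intro Bochner_Integration.integrable_diff integrable_mult_right moments) auto
  qed (rule pt)
  also have "\<dots> = 2 * r\<^sup>2 * moment 2 g - 2 * M * r * moment 1 g"
    using moments[of 2] moments[of 1] by (simp add: moment_def)
  also have "\<dots> = r * (2 * r * moment 2 g) - 2 * M * r * moment 1 g"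
    by (simp add: power2_eq_square)
  also have "\<dots> \<le> r * (M * (2 * moment 1 g + r ^ 4 / 30)) - 2 * M * r * moment 1 g"
    using mult_left_mono[OF cond r] by simp
  also have "\<dots> = M * (r ^ 5 / 30)" by (simp add: algebra_simps eval_nat_numeral)
  finally show ?thesis by (simp add: loss_rate_def algebra_simps)
qed

text \<open>One density in each gain is split as \<open>2 * M + h\<close>. The constant part is
  absorbed through \<open>gain_by_loss\<close>. The \<open>h\<close> part integrates to at most
  \<open>4 * n2 * h0 + 2 * n0 * h2\<close>, where \<open>hk\<close> denotes the moment of order
  \<open>k\<close> of \<open>h\<close>, while the loss acting on \<open>h\<close> removes
  \<open>4 * n0 * h2\<close>. Hence only \<open>h0\<close>, the plain integral of the excess,
  remains and Gronwall closes without weights.\<close>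

lemma excess_collision:
  assumes M: "0 < M" and cond: "\<And>r. 0 \<le> r \<Longrightarrow> 2 * r * moment 2 g \<le> M * (2 * moment 1 g + r ^ 4 / 30)"
  shows "(\<integral>r. excess_deriv M (g r) * line_collision g r \<partial>lborel) \<le> 4 * moment 2 g * (\<integral>r. excess M (g r) \<partial>lborel)"
proof -
  let ?M = "lborel \<Otimes>\<^sub>M lborel :: (real \<times> real) measure"
  define h where "h x = excess M (g x)" for x
  define \<theta> where "\<theta> x = excess_deriv M (g x)" for x
  interpret H: profile h unfolding h_def by (rule profile_excess[OF M])
  interpret GH: two_profiles g h ..
  have [measurable]: "\<theta> \<in> borel_measurable borel" unfolding \<theta>_def by measurable
  have \<theta>: "0 \<le> \<theta> x" "\<theta> x \<le> 1" for x
    unfolding \<theta>_def by (rule excess_deriv_nonneg[OF M]) (rule excess_deriv_le[OF M])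
  have gh: "g x \<le> 2 * M + h x" for x unfolding h_def by (rule excess_lower[OF M])
  have h\<theta>: "h x \<le> \<theta> x * (g x - M)" for x unfolding h_def \<theta>_def by (rule excess_le_deriv[OF M])
  have one: "(\<lambda>_. 1::real) \<in> borel_measurable borel" "\<And>r::real. \<bar>1::real\<bar> \<le> 1" by auto
  have cw: "integrable lborel (\<lambda>r. r\<^sup>2 * (\<integral>s. g s * h (r - s) \<partial>lborel))"
    "(\<integral>r. r\<^sup>2 * (\<integral>s. g s * h (r - s) \<partial>lborel) \<partial>lborel) = (\<integral>p. (case p of (x, y) \<Rightarrow> (x + y)\<^sup>2 * (g x * h y)) \<partial>?M)"
    using GH.conv_weak[OF one] by simp_all
  have cr: "integrable lborel (\<lambda>r. indicator {0..} r * r\<^sup>2 * (\<integral>s. g s * h (s - r) \<partial>lborel))"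
    "(\<integral>r. indicator {0..} r * r\<^sup>2 * (\<integral>s. g s * h (s - r) \<partial>lborel) \<partial>lborel)
      = (\<integral>p. (case p of (x, y) \<Rightarrow> indicator {0..} (x - y) * (x - y)\<^sup>2 * (g x * h y)) \<partial>?M)"
    using GH.corr_weak[OF one] by simp_all
  have "(\<integral>r. \<theta> r * line_collision g r \<partial>lborel)
    \<le> (\<integral>r. r\<^sup>2 * (\<integral>s. g s * h (r - s) \<partial>lborel)
       + 2 * (indicator {0..} r * r\<^sup>2 * (\<integral>s. g s * h (s - r) \<partial>lborel)) - 4 * moment 0 g * (r ^ 2 * h r) \<partial>lborel)"
  proof (rule integral_mono_AE)
    show "integrable lborel (\<lambda>r. \<theta> r * line_collision g r)"
      by (rule collision_weak(1)[where B=1]) (use \<theta> in auto)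
    show "integrable lborel (\<lambda>r. r\<^sup>2 * (\<integral>s. g s * h (r - s) \<partial>lborel)
       + 2 * (indicator {0..} r * r\<^sup>2 * (\<integral>s. g s * h (s - r) \<partial>lborel)) - 4 * moment 0 g * (r ^ 2 * h r))"
      by (intro Bochner_Integration.integrable_add Bochner_Integration.integrable_diff integrable_mult_right cw cr H.moments) simp
    show "AE r in lborel. \<theta> r * line_collision g r \<le> r\<^sup>2 * (\<integral>s. g s * h (r - s) \<partial>lborel)
       + 2 * (indicator {0..} r * r\<^sup>2 * (\<integral>s. g s * h (s - r) \<partial>lborel)) - 4 * moment 0 g * (r ^ 2 * h r)"
      using GH.AE_conv_integrable GH.AE_corr_integrable AE_lborel_singleton[of 0]
    proof eventually_elim
      fix r :: real
      assume c1: "integrable lborel (\<lambda>s. g s * h (r - s))"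
        and c2: "0 < r \<longrightarrow> integrable lborel (\<lambda>s. g s * h (s - r))" and "r \<noteq> 0"
      show "\<theta> r * line_collision g r \<le> r\<^sup>2 * (\<integral>s. g s * h (r - s) \<partial>lborel)
       + 2 * (indicator {0..} r * r\<^sup>2 * (\<integral>s. g s * h (s - r) \<partial>lborel)) - 4 * moment 0 g * (r ^ 2 * h r)"
      proof (cases "r < 0")
        case True
        then have "\<theta> r = 0" using M by (simp add: \<theta>_def zero excess_deriv_def)
        moreover have "0 \<le> (\<integral>s. g s * h (r - s) \<partial>lborel)"
          by (intro integral_nonneg_AE AE_I2) (auto simp: nonneg H.nonneg)
        ultimately show ?thesis using True by (simp add: H.zero)
      next
        case False
        then have r: "0 < r" using \<open>r \<noteq> 0\<close> by simp
        let ?A = "\<integral>s. indicator {..r} s * (2 * M) * g s \<partial>lborel" and ?B = "\<integral>s. indicator {r..} s * (2 * M) * g s \<partial>lborel"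
        let ?a = "\<integral>s. g s * h (r - s) \<partial>lborel" and ?b = "\<integral>s. g s * h (s - r) \<partial>lborel"
        have I: "integrable lborel (\<lambda>s. indicator A s * (2 * M) * g s)" if [measurable]: "A \<in> sets borel" for A
          using M by (intro Bochner_Integration.integrable_bound[OF integrable_mult_right[OF integrable_profile, of "2 * M"]])
            (auto simp: indicator_def)
        have ab: "0 \<le> ?a" "0 \<le> ?b"
          by (intro integral_nonneg_AE AE_I2; auto simp: nonneg H.nonneg)+
        \<comment> \<open>Integrability of the left integrand at this \<open>r\<close> is not known.
          An integrable nonnegative majorant suffices, because a non-integrable function has
          integral 0.\<close>
        have "(\<integral>s. g s * g (r - s) \<partial>lborel) \<le> (\<integral>s. indicator {..r} s * (2 * M) * g s + g s * h (r - s) \<partial>lborel)"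
        proof (rule integral_mono')
          fix s
          show "g s * g (r - s) \<le> indicator {..r} s * (2 * M) * g s + g s * h (r - s)"
          proof (cases "s \<le> r")
            case True
            then show ?thesis using mult_left_mono[OF gh[of "r - s"] nonneg[of s]] by (simp add: algebra_simps)
          qed (simp add: zero H.zero)
          show "0 \<le> indicator {..r} s * (2 * M) * g s + g s * h (r - s)"
            using M by (simp add: nonneg H.nonneg)
        qed (intro Bochner_Integration.integrable_add I c1; simp)
        also have "\<dots> = ?A + ?a" using I[of "{..r}"] c1 by simp
        finally have A: "(\<integral>s. g s * g (r - s) \<partial>lborel) \<le> ?A + ?a" .
        have "(\<integral>s. g s * g (s - r) \<partial>lborel) \<le> (\<integral>s. indicator {r..} s * (2 * M) * g s + g s * h (s - r) \<partial>lborel)"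
        proof (rule integral_mono')
          fix s
          show "g s * g (s - r) \<le> indicator {r..} s * (2 * M) * g s + g s * h (s - r)"
          proof (cases "r \<le> s")
            case True
            then show ?thesis using mult_left_mono[OF gh[of "s - r"] nonneg[of s]] by (simp add: algebra_simps)
          qed (simp add: zero H.zero)
          show "0 \<le> indicator {r..} s * (2 * M) * g s + g s * h (s - r)"
            using M by (simp add: nonneg H.nonneg)
        qed (intro Bochner_Integration.integrable_add I; use c2 r in simp)
        also have "\<dots> = ?B + ?b" using I[of "{r..}"] c2 r by simp
        finally have B: "(\<integral>s. g s * g (s - r) \<partial>lborel) \<le> ?B + ?b" .
        have \<Lambda>: "4 * r\<^sup>2 * moment 0 g \<le> loss_rate g r" using loss_rate_lower r by simp
        then have \<Lambda>0: "0 \<le> loss_rate g r" using moment_nonneg[of 0] by (meson mult_nonneg_nonneg order_trans zero_le_numeral zero_le_power2)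
        \<comment> \<open>By \<open>h <= \<theta> * (g - M)\<close> the loss splits into a part
          proportional to \<open>h\<close> and a part \<open>\<theta> * M * loss_rate\<close>; the
          latter is exactly what \<open>gain_by_loss\<close>, multiplied by \<theta>,
          requires.\<close>
        have "(h r + \<theta> r * M) * loss_rate g r \<le> \<theta> r * g r * loss_rate g r"
          using h\<theta>[of r] \<Lambda>0 by (intro mult_right_mono) (auto simp: algebra_simps)
        moreover have "h r * (4 * r\<^sup>2 * moment 0 g) \<le> h r * loss_rate g r"
          by (rule mult_left_mono[OF \<Lambda> H.nonneg])
        ultimately have loss: "h r * (4 * r\<^sup>2 * moment 0 g) + \<theta> r * (M * loss_rate g r) \<le> \<theta> r * g r * loss_rate g r"
          by (simp add: algebra_simps)
        have A': "r\<^sup>2 * (\<integral>s. g s * g (r - s) \<partial>lborel) \<le> r\<^sup>2 * (?A + ?a)"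
          by (rule mult_left_mono[OF A]) simp
        have B': "r\<^sup>2 * (\<integral>s. g s * g (s - r) \<partial>lborel) \<le> r\<^sup>2 * (?B + ?b)"
          by (rule mult_left_mono[OF B]) simp
        have "r\<^sup>2 * (\<integral>s. g s * g (r - s) \<partial>lborel) + 2 * (r\<^sup>2 * (\<integral>s. g s * g (s - r) \<partial>lborel)) + 2 * linear_gain g r
           \<le> M * loss_rate g r + (r\<^sup>2 * ?a + 2 * (r\<^sup>2 * ?b))"
          using A' B' gain_by_loss[OF M _ cond, of r] r by (simp add: distrib_left)
        then have "\<theta> r * (r\<^sup>2 * (\<integral>s. g s * g (r - s) \<partial>lborel) + 2 * (r\<^sup>2 * (\<integral>s. g s * g (s - r) \<partial>lborel)) + 2 * linear_gain g r)
           \<le> \<theta> r * (M * loss_rate g r + (r\<^sup>2 * ?a + 2 * (r\<^sup>2 * ?b)))"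
          by (rule mult_left_mono[OF _ \<theta>(1)])
        also have "\<dots> = \<theta> r * (M * loss_rate g r) + \<theta> r * (r\<^sup>2 * ?a + 2 * (r\<^sup>2 * ?b))"
          by (rule distrib_left)
        also have "\<dots> \<le> \<theta> r * (M * loss_rate g r) + 1 * (r\<^sup>2 * ?a + 2 * (r\<^sup>2 * ?b))"
          using ab by (intro add_left_mono mult_right_mono \<theta>(2)) auto
        finally have gain: "\<theta> r * (r\<^sup>2 * (\<integral>s. g s * g (r - s) \<partial>lborel) + 2 * (r\<^sup>2 * (\<integral>s. g s * g (s - r) \<partial>lborel)) + 2 * linear_gain g r)
           \<le> \<theta> r * (M * loss_rate g r) + (r\<^sup>2 * ?a + 2 * (r\<^sup>2 * ?b))" by simp
        have "\<theta> r * line_collision g r = \<theta> r * (r\<^sup>2 * (\<integral>s. g s * g (r - s) \<partial>lborel) + 2 * (r\<^sup>2 * (\<integral>s. g s * g (s - r) \<partial>lborel)) + 2 * linear_gain g r)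
           - \<theta> r * g r * loss_rate g r"
          using r by (simp add: line_collision_def algebra_simps)
        also have "\<dots> \<le> r\<^sup>2 * ?a + 2 * (r\<^sup>2 * ?b) - h r * (4 * r\<^sup>2 * moment 0 g)"
          using gain loss by linarith
        finally show ?thesis using r by (simp add: ac_simps)
      qed
    qed
  qed
  also have "\<dots> = (\<integral>p. (case p of (x, y) \<Rightarrow> (x + y)\<^sup>2 * (g x * h y)) \<partial>?M)
      + 2 * (\<integral>p. (case p of (x, y) \<Rightarrow> indicator {0..} (x - y) * (x - y)\<^sup>2 * (g x * h y)) \<partial>?M)
      - 4 * moment 0 g * moment 2 h"
    using cw cr H.moments[of 2] by (simp add: moment_def)
  also have "(\<integral>p. (case p of (x, y) \<Rightarrow> (x + y)\<^sup>2 * (g x * h y)) \<partial>?M)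
     \<le> (\<integral>p. 2 * (case p of (x, y) \<Rightarrow> x ^ 2 * y ^ 0 * (g x * h y)) + 2 * (case p of (x, y) \<Rightarrow> x ^ 0 * y ^ 2 * (g x * h y)) \<partial>?M)"
  proof (rule integral_mono')
    show "integrable ?M (\<lambda>p. 2 * (case p of (x, y) \<Rightarrow> x ^ 2 * y ^ 0 * (g x * h y)) + 2 * (case p of (x, y) \<Rightarrow> x ^ 0 * y ^ 2 * (g x * h y)))"
      by (intro integrable_mult_right Bochner_Integration.integrable_add GH.poly_product) auto
    fix p :: "real \<times> real"
    obtain x y where p: "p = (x, y)" by (cases p)
    have "(x + y)\<^sup>2 \<le> 2 * x\<^sup>2 + 2 * y\<^sup>2" using sum_squares_bound[of x y] by (simp add: power2_eq_square algebra_simps)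
    from mult_right_mono[OF this, of "g x * h y"]
    show "(case p of (x, y) \<Rightarrow> (x + y)\<^sup>2 * (g x * h y))
      \<le> 2 * (case p of (x, y) \<Rightarrow> x ^ 2 * y ^ 0 * (g x * h y)) + 2 * (case p of (x, y) \<Rightarrow> x ^ 0 * y ^ 2 * (g x * h y))"
      by (simp add: p nonneg H.nonneg algebra_simps)
    show "0 \<le> 2 * (case p of (x, y) \<Rightarrow> x ^ 2 * y ^ 0 * (g x * h y)) + 2 * (case p of (x, y) \<Rightarrow> x ^ 0 * y ^ 2 * (g x * h y))"
      by (simp add: p nonneg H.nonneg)
  qed
  also have "\<dots> = 2 * moment 2 g * moment 0 h + 2 * moment 0 g * moment 2 h"
    using GH.poly_product[of 2 0] GH.poly_product[of 0 2] by simp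
  also have "(\<integral>p. (case p of (x, y) \<Rightarrow> indicator {0..} (x - y) * (x - y)\<^sup>2 * (g x * h y)) \<partial>?M)
     \<le> (\<integral>p. (case p of (x, y) \<Rightarrow> x ^ 2 * y ^ 0 * (g x * h y)) \<partial>?M)"
  proof (rule integral_mono')
    show "integrable ?M (\<lambda>(x, y). x ^ 2 * y ^ 0 * (g x * h y))"
      by (rule GH.poly_product) auto
    fix p :: "real \<times> real"
    obtain x y where p: "p = (x, y)" by (cases p)
    show "(case p of (x, y) \<Rightarrow> indicator {0..} (x - y) * (x - y)\<^sup>2 * (g x * h y)) \<le> (case p of (x, y) \<Rightarrow> x ^ 2 * y ^ 0 * (g x * h y))"
    proof (cases "0 \<le> y \<and> y \<le> x")
      case True
      then have "(x - y)\<^sup>2 \<le> x\<^sup>2" by (intro power_mono) auto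
      from mult_right_mono[OF this, of "g x * h y"] show ?thesis using True by (simp add: p nonneg H.nonneg)
    qed (use H.zero[of y] in \<open>auto simp: p nonneg H.nonneg\<close>)
    show "0 \<le> (case p of (x, y) \<Rightarrow> x ^ 2 * y ^ 0 * (g x * h y))" by (simp add: p nonneg H.nonneg)
  qed
  also have "\<dots> = moment 2 g * moment 0 h"
    using GH.poly_product[of 2 0] by simp
  finally have "(\<integral>r. \<theta> r * line_collision g r \<partial>lborel) \<le> 4 * moment 2 g * moment 0 h - 2 * (moment 0 g * moment 2 h)"
    by (simp add: algebra_simps)
  moreover have "0 \<le> moment 0 g * moment 2 h" by (intro mult_nonneg_nonneg moment_nonneg H.moment_nonneg)
  ultimately have "(\<integral>r. \<theta> r * line_collision g r \<partial>lborel) \<le> 4 * moment 2 g * moment 0 h" by linarith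
  then show ?thesis by (simp add: \<theta>_def h_def moment_def)
qed

text \<open>The tangent line of \<open>t^3\<close> at \<open>t = \<rho>^2\<close>, taken at
  \<open>t = x^2\<close> and multiplied by \<open>x\<close>, gives
  \<open>x^7 >= 3 * \<rho>^4 * x^3 - 2 * \<rho>^6 * x\<close>. The minorant involves finite moments
  only, whereas the seventh moment may be infinite; hence the truncation at \<open>R\<close> and a
  conclusion for large \<open>R\<close>, not uniform in the profile.\<close>

lemma seventh_moment_dominates:
  assumes n1: "0 < moment 1 g" and n2: "625 * moment 1 g ^ 5 \<le> moment 2 g ^ 4" 
  shows "\<forall>\<^sub>F R in at_top. 4 * (moment 1 g * moment 3 g + (moment 2 g)\<^sup>2) \<le> (\<integral>x. indicator {0..R} x * (x ^ 7 * g x) \<partial>lborel) / 70"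
proof -
  define \<rho> where "\<rho> = moment 2 g / moment 1 g"
  have m2: "moment 2 g = \<rho> * moment 1 g" using n1 by (simp add: \<rho>_def)
  have "0 < moment 2 g ^ 4" using n1 n2 by (smt (verit) zero_less_power)
  then have "moment 2 g \<noteq> 0" by auto
  then have \<rho>: "0 < \<rho>" using n1 moment_nonneg[of 2] by (simp add: \<rho>_def)
  \<comment> \<open>Cauchy-Schwarz between the moments 1, 2 and 3, in the form
    \<open>n3 >= \<rho>^2 * n1\<close>.\<close>
  have "0 \<le> (\<integral>x. x ^ 3 * g x - 2 * \<rho> * (x ^ 2 * g x) + \<rho>\<^sup>2 * (x ^ 1 * g x) \<partial>lborel)"
  proof (rule integral_nonneg_AE, rule AE_I2)
    fix x
    have "0 \<le> x * (x - \<rho>)\<^sup>2 * g x" by (cases "0 \<le> x") (auto simp: nonneg zero)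
    then show "0 \<le> x ^ 3 * g x - 2 * \<rho> * (x ^ 2 * g x) + \<rho>\<^sup>2 * (x ^ 1 * g x)"
      by (simp add: power2_eq_square eval_nat_numeral algebra_simps)
  qed
  also have "\<dots> = moment 3 g - 2 * \<rho> * moment 2 g + \<rho>\<^sup>2 * moment 1 g"
    using moments[of 3] moments[of 2] moments[of 1] by (simp add: moment_def)
  finally have m3: "\<rho>\<^sup>2 * moment 1 g \<le> moment 3 g"
    by (simp add: m2 power2_eq_square algebra_simps)
  have m3_pos: "0 < moment 3 g" using m3 \<rho> n1 by (smt (verit) mult_pos_pos zero_less_power)
  have "625 * moment 1 g ^ 5 \<le> \<rho> ^ 4 * moment 1 g ^ 4" using n2 by (simp add: m2 power_mult_distrib)
  then have "625 * moment 1 g * moment 1 g ^ 4 \<le> \<rho> ^ 4 * moment 1 g ^ 4" by (simp add: eval_nat_numeral algebra_simps)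
  then have \<rho>4: "625 * moment 1 g \<le> \<rho> ^ 4" using n1 by simp
  have int: "integrable lborel (\<lambda>x. 3 * \<rho> ^ 4 * (x ^ 3 * g x) - 2 * \<rho> ^ 6 * (x ^ 1 * g x))"
    by (intro Bochner_Integration.integrable_diff integrable_mult_right moments) auto
  have "((\<lambda>R. \<integral>x. indicator {0..R} x * (3 * \<rho> ^ 4 * (x ^ 3 * g x) - 2 * \<rho> ^ 6 * (x ^ 1 * g x)) \<partial>lborel)
      \<longlongrightarrow> (\<integral>x. 3 * \<rho> ^ 4 * (x ^ 3 * g x) - 2 * \<rho> ^ 6 * (x ^ 1 * g x) \<partial>lborel)) at_top"
  proof (rule integral_dominated_convergence_at_top[where w="\<lambda>x. \<bar>3 * \<rho> ^ 4 * (x ^ 3 * g x) - 2 * \<rho> ^ 6 * (x ^ 1 * g x)\<bar>"])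
    show "integrable lborel (\<lambda>x. \<bar>3 * \<rho> ^ 4 * (x ^ 3 * g x) - 2 * \<rho> ^ 6 * (x ^ 1 * g x)\<bar>)"
      using int by (rule integrable_abs)
    show "AE x in lborel. ((\<lambda>R. indicator {0..R} x * (3 * \<rho> ^ 4 * (x ^ 3 * g x) - 2 * \<rho> ^ 6 * (x ^ 1 * g x)))
       \<longlongrightarrow> 3 * \<rho> ^ 4 * (x ^ 3 * g x) - 2 * \<rho> ^ 6 * (x ^ 1 * g x)) at_top"
    proof (rule AE_I2, rule tendsto_eventually)
      fix x
      show "\<forall>\<^sub>F R in at_top. indicator {0..R} x * (3 * \<rho> ^ 4 * (x ^ 3 * g x) - 2 * \<rho> ^ 6 * (x ^ 1 * g x))
        = 3 * \<rho> ^ 4 * (x ^ 3 * g x) - 2 * \<rho> ^ 6 * (x ^ 1 * g x)"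
        using eventually_ge_at_top[of x]
        by eventually_elim (cases "x < 0", auto simp: zero indicator_def)
    qed
    show "\<forall>\<^sub>F R in at_top. AE x in lborel. norm (indicator {0..R} x * (3 * \<rho> ^ 4 * (x ^ 3 * g x) - 2 * \<rho> ^ 6 * (x ^ 1 * g x)))
       \<le> \<bar>3 * \<rho> ^ 4 * (x ^ 3 * g x) - 2 * \<rho> ^ 6 * (x ^ 1 * g x)\<bar>"
      by (intro always_eventually allI AE_I2) (simp add: indicator_def)
  qed measurable
  also have "(\<integral>x. 3 * \<rho> ^ 4 * (x ^ 3 * g x) - 2 * \<rho> ^ 6 * (x ^ 1 * g x) \<partial>lborel) = 3 * \<rho> ^ 4 * moment 3 g - 2 * \<rho> ^ 6 * moment 1 g"
    using moments[of 3] moments[of 1] by (simp add: moment_def)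
  finally have lim: "((\<lambda>R. \<integral>x. indicator {0..R} x * (3 * \<rho> ^ 4 * (x ^ 3 * g x) - 2 * \<rho> ^ 6 * (x ^ 1 * g x)) \<partial>lborel)
      \<longlongrightarrow> 3 * \<rho> ^ 4 * moment 3 g - 2 * \<rho> ^ 6 * moment 1 g) at_top" .
  \<comment> \<open>Strictness is what lets the inequality pass from the limit to all large
    \<open>R\<close>.\<close>
  have "70 * (4 * (moment 1 g * moment 3 g + (moment 2 g)\<^sup>2)) < 3 * \<rho> ^ 4 * moment 3 g - 2 * \<rho> ^ 6 * moment 1 g"
  proof -
    have "(moment 2 g)\<^sup>2 = moment 1 g * (\<rho>\<^sup>2 * moment 1 g)" by (simp add: m2 power2_eq_square)
    also have "\<dots> \<le> moment 1 g * moment 3 g" using m3 n1 by simp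
    finally have "70 * (4 * (moment 1 g * moment 3 g + (moment 2 g)\<^sup>2)) \<le> 560 * (moment 1 g * moment 3 g)"
      by (simp add: algebra_simps)
    also have "\<dots> < 625 * (moment 1 g * moment 3 g)" using n1 m3_pos by simp
    also have "\<dots> \<le> \<rho> ^ 4 * moment 3 g" using \<rho>4 m3_pos by (simp add: mult.assoc[symmetric])
    also have "\<dots> = 3 * \<rho> ^ 4 * moment 3 g - 2 * \<rho> ^ 4 * moment 3 g" by simp
    also have "\<dots> \<le> 3 * \<rho> ^ 4 * moment 3 g - 2 * \<rho> ^ 4 * (\<rho>\<^sup>2 * moment 1 g)"
      using m3 by (intro diff_left_mono mult_left_mono) auto
    also have "\<dots> = 3 * \<rho> ^ 4 * moment 3 g - 2 * \<rho> ^ 6 * moment 1 g" by (simp add: eval_nat_numeral)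
    finally show ?thesis .
  qed
  from order_tendstoD(1)[OF lim this] eventually_ge_at_top[of 0]
  show ?thesis
  proof eventually_elim
    fix R :: real assume R: "0 \<le> R" and *: "70 * (4 * (moment 1 g * moment 3 g + (moment 2 g)\<^sup>2))
       < (\<integral>x. indicator {0..R} x * (3 * \<rho> ^ 4 * (x ^ 3 * g x) - 2 * \<rho> ^ 6 * (x ^ 1 * g x)) \<partial>lborel)"
    note *
    also have "\<dots> \<le> (\<integral>x. indicator {0..R} x * (x ^ 7 * g x) \<partial>lborel)"
    proof (rule integral_mono')
      show "integrable lborel (\<lambda>x. indicator {0..R} x * (x ^ 7 * g x))"
      proof (rule Bochner_Integration.integrable_bound[OF integrable_mult_right[OF integrable_profile, of "R ^ 7"]])
        show "AE x in lborel. norm (indicator {0..R} x * (x ^ 7 * g x)) \<le> norm (R ^ 7 * g x)"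
          by (rule AE_I2) (auto simp: indicator_def abs_mult nonneg R intro!: mult_right_mono power_mono)
      qed measurable
      fix x
      \<comment> \<open>With \<open>t = x^2\<close> and \<open>q = \<rho>^2\<close>, this is the
        factorisation \<open>t^3 - 3 * q^2 * t + 2 * q^3 = (t - q)^2 * (t + 2 * q)\<close>.\<close>
      have "0 \<le> x * ((x\<^sup>2 - \<rho>\<^sup>2)\<^sup>2 * (x\<^sup>2 + 2 * \<rho>\<^sup>2)) * g x" if "0 \<le> x"
        using that by (intro mult_nonneg_nonneg) (auto simp: nonneg)
      also have "x * ((x\<^sup>2 - \<rho>\<^sup>2)\<^sup>2 * (x\<^sup>2 + 2 * \<rho>\<^sup>2)) * g x = x ^ 7 * g x - (3 * \<rho> ^ 4 * (x ^ 3 * g x) - 2 * \<rho> ^ 6 * (x ^ 1 * g x))"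
        by (simp add: power2_eq_square eval_nat_numeral algebra_simps)
      finally show "indicator {0..R} x * (3 * \<rho> ^ 4 * (x ^ 3 * g x) - 2 * \<rho> ^ 6 * (x ^ 1 * g x)) \<le> indicator {0..R} x * (x ^ 7 * g x)"
        by (auto simp: indicator_def)
      show "0 \<le> indicator {0..R} x * (x ^ 7 * g x)" by (auto simp: indicator_def nonneg)
    qed
    finally show "4 * (moment 1 g * moment 3 g + (moment 2 g)\<^sup>2) \<le> (\<integral>x. indicator {0..R} x * (x ^ 7 * g x) \<partial>lborel) / 70"
      by linarith
  qed
qed

lemma mass_le_sqrt:
  assumes M: "0 < M" and le: "AE x in lborel. g x \<le> M" and n1: "0 < moment 1 g"
  shows "moment 0 g \<le> 2 * sqrt (moment 1 g * M)"
proof -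
  define \<epsilon> where "\<epsilon> = sqrt (moment 1 g / M)"
  have \<epsilon>: "0 < \<epsilon>" using M n1 by (simp add: \<epsilon>_def)
  have "moment 0 g = (\<integral>x. g x \<partial>lborel)" by (simp add: moment_def)
  also have "\<dots> \<le> (\<integral>x. M * indicator {0..\<epsilon>} x + x ^ 1 * g x / \<epsilon> \<partial>lborel)"
  proof (rule integral_mono_AE[OF integrable_profile])
    have "integrable lborel (indicator {0..\<epsilon>} :: real \<Rightarrow> real)"
      by (rule integrable_real_indicator) (use \<epsilon> in auto)
    then show "integrable lborel (\<lambda>x. M * indicator {0..\<epsilon>} x + x ^ 1 * g x / \<epsilon>)"
      by (intro Bochner_Integration.integrable_add integrable_mult_right integrable_divide moments) auto
    show "AE x in lborel. g x \<le> M * indicator {0..\<epsilon>} x + x ^ 1 * g x / \<epsilon>"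
      using le
    proof eventually_elim
      fix x assume "g x \<le> M"
      show "g x \<le> M * indicator {0..\<epsilon>} x + x ^ 1 * g x / \<epsilon>"
      proof (cases "x \<in> {0..\<epsilon>}")
        case True
        then have "0 \<le> x * g x / \<epsilon>" using \<epsilon> by (simp add: nonneg)
        then show ?thesis using True \<open>g x \<le> M\<close> by simp
      next
        case False
        then show ?thesis
          using \<epsilon> mult_right_mono[of \<epsilon> x "g x"] by (cases "x < 0") (auto simp: zero nonneg field_simps)
      qed
    qed
  qed
  also have "\<dots> = M * \<epsilon> + moment 1 g / \<epsilon>"
    using moments[of 1] \<epsilon> by (simp add: moment_def)
  also have "M * \<epsilon> = sqrt (moment 1 g * M)"
    using M n1 by (simp add: \<epsilon>_def real_sqrt_divide real_sqrt_mult field_simps)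
  also have "moment 1 g / \<epsilon> = sqrt (moment 1 g * M)"
    using M n1 by (simp add: \<epsilon>_def real_sqrt_divide real_sqrt_mult field_simps)
  finally show ?thesis by simp
qed

end

text \<open>In the units \<open>\<beta> = b powr (1/4)\<close> and
  \<open>X = a powr (1/4) * r\<close>, weighted AM-GM reads
  \<open>4 * \<beta>^3 * X <= 3 * \<beta>^4 + X^4\<close>, and this is at most
  \<open>3 * (2 * \<beta>^4 + X^4)\<close>. The factor \<open>3/2\<close> of the threshold leaves
  this much room.\<close>

lemma young_threshold:
  fixes a b r :: real
  assumes a: "0 < a" and b: "0 < b" and r: "0 \<le> r" and m: "0 \<le> m"
    and M: "3 * m / (2 * a powr (1/4) * b powr (3/4)) \<le> M"
  shows "2 * r * m \<le> M * (2 * b + a * r ^ 4)"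
proof -
  define \<alpha> where "\<alpha> = a powr (1/4)"
  define \<beta> where "\<beta> = b powr (1/4)"
  have pos: "0 < \<alpha>" "0 < \<beta>" using a b by (auto simp: \<alpha>_def \<beta>_def)
  have a4: "a = \<alpha> ^ 4" and b4: "b = \<beta> ^ 4" and b3: "b powr (3/4) = \<beta> ^ 3"
    using a b by (simp_all add: \<alpha>_def \<beta>_def powr_powr flip: powr_realpow)
  define X where "X = \<alpha> * r"
  \<comment> \<open>The product equals \<open>3 * \<beta>^4 - 4 * \<beta>^3 * X + X^4\<close>, so
    AM-GM follows without roots.\<close>
  have "0 \<le> (\<beta> - X)\<^sup>2 * (3 * \<beta>\<^sup>2 + 2 * (\<beta> * X) + X\<^sup>2)"
    using pos r by (intro mult_nonneg_nonneg add_nonneg_nonneg) (auto simp: X_def)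
  moreover have "0 \<le> \<beta> ^ 4" "0 \<le> X ^ 4" by simp_all
  ultimately have "4 * \<beta> ^ 3 * X \<le> 3 * (2 * \<beta> ^ 4 + X ^ 4)"
    by (simp add: power2_eq_square eval_nat_numeral algebra_simps)
  then have "4 * \<beta> ^ 3 * (\<alpha> * r) \<le> 3 * (2 * b + a * r ^ 4)"
    by (simp add: X_def a4 b4 power_mult_distrib)
  from mult_left_mono[OF this m]
  have "2 * r * m \<le> 3 * m / (2 * \<alpha> * \<beta> ^ 3) * (2 * b + a * r ^ 4)"
    using pos by (simp add: field_simps)
  also have "\<dots> \<le> M * (2 * b + a * r ^ 4)"
    using M a b by (intro mult_right_mono) (auto simp: \<alpha>_def b3)
  finally show ?thesis .
qed

section \<open>Evolution of line densities\<close>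

lemma tendsto_integral_lipschitz_mult:
  fixes f :: "nat \<Rightarrow> 'a \<Rightarrow> real"
  assumes f: "\<And>n. integrable M (f n)" and f0: "integrable M f0" and q: "integrable M q"
    and lim: "(\<lambda>n. \<integral>x. \<bar>f n x - f0 x\<bar> \<partial>M) \<longlonglongrightarrow> 0"
    and [measurable]: "\<theta> \<in> borel_measurable borel"
    and \<theta>: "\<And>x. 0 \<le> \<theta> x" "\<And>x. \<theta> x \<le> 1" and lip: "\<And>x y. \<bar>\<theta> x - \<theta> y\<bar> \<le> L * \<bar>x - y\<bar>"
  shows "(\<lambda>n. \<integral>x. \<theta> (f n x) * q x \<partial>M) \<longlonglongrightarrow> (\<integral>x. \<theta> (f0 x) * q x \<partial>M)"
proof (rule LIMSEQ_I)
  fix e :: real assume e: "0 < e"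
  note [measurable] = borel_measurable_integrable[OF f] borel_measurable_integrable[OF f0] borel_measurable_integrable[OF q]
  have L: "0 \<le> L" using lip[of 1 0] by (simp add: abs_if split: if_splits)
  have "(\<lambda>N. \<integral>x. \<bar>q x\<bar> - min \<bar>q x\<bar> (real N) \<partial>M) \<longlonglongrightarrow> (\<integral>x. 0 \<partial>M)"
  proof (rule integral_dominated_convergence[where w="\<lambda>x. \<bar>q x\<bar>"])
    show "AE x in M. (\<lambda>N. \<bar>q x\<bar> - min \<bar>q x\<bar> (real N)) \<longlonglongrightarrow> 0"
    proof (rule AE_I2, rule tendsto_eventually)
      fix x
      obtain N0 where "\<bar>q x\<bar> \<le> real N0" using real_arch_simple by blast
      then show "\<forall>\<^sub>F N in sequentially. \<bar>q x\<bar> - min \<bar>q x\<bar> (real N) = 0"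
        by (intro eventually_sequentiallyI[of N0]) auto
    qed
  qed (use q in auto)
  then have "\<forall>\<^sub>F N in sequentially. (\<integral>x. \<bar>q x\<bar> - min \<bar>q x\<bar> (real N) \<partial>M) < e / 2"
    by (rule order_tendstoD(2)) (use e in simp)
  then obtain N where N: "(\<integral>x. \<bar>q x\<bar> - min \<bar>q x\<bar> (real N) \<partial>M) < e / 2"
    by (auto simp: eventually_sequentially)
  have "(\<lambda>n. real N * L * (\<integral>x. \<bar>f n x - f0 x\<bar> \<partial>M)) \<longlonglongrightarrow> real N * L * 0"
    by (intro tendsto_mult_left lim)
  then have "\<forall>\<^sub>F n in sequentially. real N * L * (\<integral>x. \<bar>f n x - f0 x\<bar> \<partial>M) < e / 2"
    by (rule order_tendstoD(2)) (use e in simp)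
  then obtain n0 where n0: "\<And>n. n0 \<le> n \<Longrightarrow> real N * L * (\<integral>x. \<bar>f n x - f0 x\<bar> \<partial>M) < e / 2"
    by (auto simp: eventually_sequentially)
  have int: "integrable M (\<lambda>x. \<theta> (h x) * q x)" if [measurable]: "h \<in> borel_measurable M" for h
    by (rule Bochner_Integration.integrable_bound[OF q])
      (use \<theta> in \<open>auto simp: abs_mult intro!: AE_I2 mult_left_le_one_le\<close>)
  have minI: "integrable M (\<lambda>x. min \<bar>q x\<bar> (real N))"
    by (rule Bochner_Integration.integrable_bound[OF q]) auto
  show "\<exists>n0. \<forall>n\<ge>n0. norm ((\<integral>x. \<theta> (f n x) * q x \<partial>M) - (\<integral>x. \<theta> (f0 x) * q x \<partial>M)) < e"
  proof (intro exI allI impI)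
    fix n assume n: "n0 \<le> n"
    have "norm ((\<integral>x. \<theta> (f n x) * q x \<partial>M) - (\<integral>x. \<theta> (f0 x) * q x \<partial>M)) = norm (\<integral>x. \<theta> (f n x) * q x - \<theta> (f0 x) * q x \<partial>M)"
      by (subst Bochner_Integration.integral_diff) (auto intro: int)
    also have "\<dots> \<le> (\<integral>x. norm (\<theta> (f n x) * q x - \<theta> (f0 x) * q x) \<partial>M)"
      by (rule integral_norm_bound)
    also have "\<dots> \<le> (\<integral>x. real N * L * \<bar>f n x - f0 x\<bar> + (\<bar>q x\<bar> - min \<bar>q x\<bar> (real N)) \<partial>M)"
    proof (rule integral_mono)
      show "integrable M (\<lambda>x. norm (\<theta> (f n x) * q x - \<theta> (f0 x) * q x))"
        by (intro integrable_norm Bochner_Integration.integrable_diff int) auto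
      show "integrable M (\<lambda>x. real N * L * \<bar>f n x - f0 x\<bar> + (\<bar>q x\<bar> - min \<bar>q x\<bar> (real N)))"
        by (intro Bochner_Integration.integrable_add Bochner_Integration.integrable_diff integrable_mult_right integrable_abs f f0 q minI)
      fix x
      let ?d = "\<bar>\<theta> (f n x) - \<theta> (f0 x)\<bar>"
      have d: "0 \<le> ?d" "?d \<le> 1" "?d \<le> L * \<bar>f n x - f0 x\<bar>"
        using \<theta>[of "f n x"] \<theta>[of "f0 x"] lip by auto
      have "norm (\<theta> (f n x) * q x - \<theta> (f0 x) * q x) = ?d * \<bar>q x\<bar>"
        by (simp add: abs_mult left_diff_distrib[symmetric])
      also have "\<dots> = ?d * min \<bar>q x\<bar> (real N) + ?d * (\<bar>q x\<bar> - min \<bar>q x\<bar> (real N))"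
        by (simp add: algebra_simps)
      also have "\<dots> \<le> (L * \<bar>f n x - f0 x\<bar>) * real N + 1 * (\<bar>q x\<bar> - min \<bar>q x\<bar> (real N))"
        using d L by (intro add_mono mult_mono) auto
      finally show "norm (\<theta> (f n x) * q x - \<theta> (f0 x) * q x) \<le> real N * L * \<bar>f n x - f0 x\<bar> + (\<bar>q x\<bar> - min \<bar>q x\<bar> (real N))"
        by (simp add: algebra_simps)
    qed
    also have "\<dots> = real N * L * (\<integral>x. \<bar>f n x - f0 x\<bar> \<partial>M) + (\<integral>x. \<bar>q x\<bar> - min \<bar>q x\<bar> (real N) \<partial>M)"
      using f f0 q minI by simp
    also have "\<dots> < e" using n0[OF n] N by linarith
    finally show "norm ((\<integral>x. \<theta> (f n x) * q x \<partial>M) - (\<integral>x. \<theta> (f0 x) * q x \<partial>M)) < e" .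
  qed
qed

text \<open>In the norm weighted by \<open>exp (- 2 * K * t)\<close> the integral operator contracts
  by the factor \<open>1/2\<close>. At a maximum point of the weighted function this gives
  \<open>A <= A / 2\<close>.\<close>

lemma gronwall_zero:
  fixes H :: "real \<Rightarrow> real"
  assumes cont: "continuous_on {0..T} H" and nonneg: "\<And>t. t \<in> {0..T} \<Longrightarrow> 0 \<le> H t" and K: "0 < K"
    and le: "\<And>t. t \<in> {0..T} \<Longrightarrow> H t \<le> (\<integral>s. indicator {0..t} s * (K * H s) \<partial>lborel)"
    and t: "t \<in> {0..T}"
  shows "H t = 0"
proof -
  have "\<exists>x\<in>{0..T}. \<forall>y\<in>{0..T}. exp (- (2 * K * y)) * H y \<le> exp (- (2 * K * x)) * H x"
    by (rule continuous_attains_sup) (use t in \<open>auto intro!: continuous_intros cont\<close>)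
  then obtain m where m: "m \<in> {0..T}" and max: "\<And>y. y \<in> {0..T} \<Longrightarrow> exp (- (2 * K * y)) * H y \<le> exp (- (2 * K * m)) * H m"
    by blast
  define A where "A = exp (- (2 * K * m)) * H m"
  have A0: "0 \<le> A" using nonneg[OF m] by (simp add: A_def)
  have HA: "H y \<le> A * exp (2 * K * y)" if "y \<in> {0..T}" for y
    using max[OF that] by (simp add: A_def exp_minus field_simps)
  have "H m \<le> (\<integral>s. indicator {0..m} s * (K * H s) \<partial>lborel)" by (rule le[OF m])
  also have "\<dots> \<le> (\<integral>s. indicator {0..m} s * (K * (A * exp (2 * K * s))) \<partial>lborel)"
  proof (rule integral_mono')
    have "continuous_on {0..m} (\<lambda>s. K * (A * exp (2 * K * s)))" by (intro continuous_intros)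
    from borel_integrable_compact[OF _ this]
    show "integrable lborel (\<lambda>s. indicator {0..m} s * (K * (A * exp (2 * K * s))))" by simp
    fix s
    show "indicator {0..m} s * (K * H s) \<le> indicator {0..m} s * (K * (A * exp (2 * K * s)))"
      using K m HA[of s] by (auto simp: indicator_def)
    show "0 \<le> indicator {0..m} s * (K * (A * exp (2 * K * s)))" using A0 K by simp
  qed
  also have "\<dots> = (\<integral>s. (K * (A * exp (2 * K * s))) * indicator {0..m} s \<partial>lborel)" by (simp add: mult.commute)
  also have "\<dots> = A / 2 * exp (2 * K * m) - A / 2 * exp (2 * K * 0)"
    by (rule integral_FTC_Icc_real) (use m in \<open>auto intro!: derivative_eq_intros continuous_intros\<close>)
  also have "\<dots> \<le> A / 2 * exp (2 * K * m)" using A0 by simp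
  finally have "H m \<le> A / 2 * exp (2 * K * m)" .
  then have "exp (- (2 * K * m)) * H m \<le> exp (- (2 * K * m)) * (A / 2 * exp (2 * K * m))"
    by (rule mult_left_mono) simp
  also have "\<dots> = A / 2" by (simp add: exp_minus field_simps)
  finally have "A \<le> A / 2" by (simp only: A_def)
  then have "A = 0" using A0 by linarith
  with HA[OF t] nonneg[OF t] show ?thesis by simp
qed

context profile
begin

text \<open>The function \<open>2 * R * r - concave_test R r\<close> is \<open>r^2\<close> up to
  \<open>R\<close> and the tangent line at \<open>R\<close> beyond it, so \<open>r^2\<close>
  dominates it for every \<open>R >= 0\<close>.\<close>

lemma truncated_second_moment:
  "((\<lambda>R. 2 * R * moment 1 g - (\<integral>r. concave_test R r * g r \<partial>lborel)) \<longlongrightarrow> moment 2 g) at_top"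
proof -
  have int: "integrable lborel (\<lambda>r. concave_test R r * g r)" if "0 \<le> R" for R
    by (rule Bochner_Integration.integrable_bound[OF integrable_mult_right[OF integrable_profile, of "R\<^sup>2"]])
      (use concave_test_abs[OF that] in \<open>auto simp: abs_mult nonneg intro!: AE_I2 mult_right_mono\<close>)
  have "((\<lambda>R. \<integral>r. (2 * R * r - concave_test R r) * g r \<partial>lborel) \<longlongrightarrow> (\<integral>r. r ^ 2 * g r \<partial>lborel)) at_top"
  proof (rule integral_dominated_convergence_at_top[where w="\<lambda>r. r ^ 2 * g r"])
    show "integrable lborel (\<lambda>r. r ^ 2 * g r)" by (rule moments) simp
    show "AE r in lborel. ((\<lambda>R. (2 * R * r - concave_test R r) * g r) \<longlongrightarrow> r ^ 2 * g r) at_top"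
    proof (rule AE_I2, rule tendsto_eventually)
      fix r
      show "\<forall>\<^sub>F R in at_top. (2 * R * r - concave_test R r) * g r = r ^ 2 * g r"
        using eventually_ge_at_top[of r]
        by eventually_elim (auto simp: concave_test_def zero)
    qed
    show "\<forall>\<^sub>F R in at_top. AE r in lborel. norm ((2 * R * r - concave_test R r) * g r) \<le> r ^ 2 * g r"
      using eventually_ge_at_top[of 0]
    proof eventually_elim
      fix R :: real assume R: "0 \<le> R"
      show "AE r in lborel. norm ((2 * R * r - concave_test R r) * g r) \<le> r ^ 2 * g r"
      proof (rule AE_I2)
        fix r
        show "norm ((2 * R * r - concave_test R r) * g r) \<le> r ^ 2 * g r"
        proof (cases "0 \<le> r")
          case True
          have "\<bar>2 * R * r - concave_test R r\<bar> \<le> r\<^sup>2"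
          proof (cases "r \<le> R")
            case False
            have "R * R \<le> R * r" using False R by (intro mult_left_mono) auto
            moreover have "0 \<le> R * R" using R by simp
            ultimately have "R * R \<le> 2 * R * r" by linarith
            moreover have "0 \<le> (r - R)\<^sup>2" by simp
            ultimately show ?thesis using True False by (simp add: concave_test_def power2_eq_square algebra_simps)
          qed (use True in \<open>simp add: concave_test_def\<close>)
          from mult_right_mono[OF this nonneg[of r]] show ?thesis by (simp add: abs_mult nonneg)
        qed (simp add: zero)
      qed
    qed
  qed measurable
  moreover have "\<forall>\<^sub>F R in at_top. (\<integral>r. (2 * R * r - concave_test R r) * g r \<partial>lborel)
      = 2 * R * moment 1 g - (\<integral>r. concave_test R r * g r \<partial>lborel)"
    using eventually_ge_at_top[of 0]
  proof eventually_elim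
    fix R :: real assume R: "0 \<le> R"
    have "(\<integral>r. (2 * R * r - concave_test R r) * g r \<partial>lborel) = (\<integral>r. 2 * R * (r ^ 1 * g r) - concave_test R r * g r \<partial>lborel)"
      by (simp add: algebra_simps)
    also have "\<dots> = 2 * R * moment 1 g - (\<integral>r. concave_test R r * g r \<partial>lborel)"
      using moments[of 1] int[OF R] by (simp add: moment_def)
    finally show "(\<integral>r. (2 * R * r - concave_test R r) * g r \<partial>lborel)
      = 2 * R * moment 1 g - (\<integral>r. concave_test R r * g r \<partial>lborel)" .
  qed
  ultimately show ?thesis unfolding moment_def[of 2] by (rule Lim_transform_eventually)
qed

end

text \<open>The condensate acts on the density only as a time-dependent factor \<open>w\<close>,
  nonnegative and bounded. Isolating it makes the estimates statements about one equation,
  independent of how \<open>w\<close> is produced.\<close>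

locale evolution =
  fixes T W :: real and w :: "real \<Rightarrow> real" and g :: "real \<Rightarrow> real \<Rightarrow> real"
  assumes T: "0 \<le> T"
    and w_meas [measurable]: "w \<in> borel_measurable borel"
    and w_bounds: "0 \<le> w s" "w s \<le> W"
    and g_meas [measurable]: "case_prod g \<in> borel_measurable (borel \<Otimes>\<^sub>M borel)"
    and g_profile: "profile (g t)"
    and g_cont: "k \<le> 5 \<Longrightarrow> t \<in> {0..T} \<Longrightarrow>
      ((\<lambda>s. \<integral>r. \<bar>g s r - g t r\<bar> * r ^ k \<partial>lborel) \<longlongrightarrow> 0) (at t within {0..T})"
    and g_eq: "t \<in> {0..T} \<Longrightarrow>
      AE r in lborel. g t r = g 0 r + (\<integral>s. indicator {0..t} s * (w s * line_collision (g s) r) \<partial>lborel)"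
    and energy: "t \<in> {0..T} \<Longrightarrow> moment 1 (g t) = moment 1 (g 0)"
begin

sublocale P: profile "g t" for t by (rule g_profile)

lemma W_nonneg: "0 \<le> W"
  using w_bounds[of 0] by linarith

lemma continuous_L1:
  assumes F: "\<And>s t. t \<in> {0..T} \<Longrightarrow> s \<in> {0..T} \<Longrightarrow> \<bar>F s - F t\<bar> \<le> (\<integral>r. \<bar>g s r - g t r\<bar> * r ^ k \<partial>lborel)" and k: "k \<le> 5"
  shows "continuous_on {0..T} F"
  unfolding continuous_on_def
proof
  fix t assume t: "t \<in> {0..T}"
  have "((\<lambda>s. F s - F t) \<longlongrightarrow> 0) (at t within {0..T})"
    by (rule Lim_null_comparison[OF _ g_cont[OF k t]])
      (use F[OF t] in \<open>auto simp: eventually_at_filter\<close>)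
  then show "(F \<longlongrightarrow> F t) (at t within {0..T})" by (simp add: LIM_zero_iff)
qed

lemma moment_continuous:
  assumes k: "k \<le> 5"
  shows "continuous_on {0..T} (\<lambda>t. moment k (g t))"
proof (rule continuous_L1[OF _ k])
  fix s t
  have "moment k (g s) - moment k (g t) = (\<integral>r. r ^ k * g s r - r ^ k * g t r \<partial>lborel)"
    using P.moments[OF k] by (simp add: moment_def)
  also have "\<bar>\<dots>\<bar> \<le> (\<integral>r. \<bar>g s r - g t r\<bar> * r ^ k \<partial>lborel)"
  proof -
    have e: "\<bar>r ^ k * g s r - r ^ k * g t r\<bar> = \<bar>g s r - g t r\<bar> * r ^ k" for r
    proof (cases "0 \<le> r")
      case True
      have "r ^ k * g s r - r ^ k * g t r = (g s r - g t r) * r ^ k" by (simp add: algebra_simps)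
      with True show ?thesis by (simp add: abs_mult)
    qed (simp add: P.zero)
    show ?thesis using integral_abs_bound[of lborel "\<lambda>r. r ^ k * g s r - r ^ k * g t r"] unfolding e .
  qed
  finally show "\<bar>moment k (g s) - moment k (g t)\<bar> \<le> (\<integral>r. \<bar>g s r - g t r\<bar> * r ^ k \<partial>lborel)" .
qed

lemma moment_bounded:
  assumes k: "k \<le> 5"
  obtains B where "0 < B" "\<And>t. t \<in> {0..T} \<Longrightarrow> moment k (g t) \<le> B"
proof -
  have "bounded ((\<lambda>t. moment k (g t)) ` {0..T})"
    by (intro compact_imp_bounded compact_continuous_image moment_continuous k) auto
  then obtain B where "0 < B" "\<forall>x\<in>(\<lambda>t. moment k (g t)) ` {0..T}. norm x \<le> B"
    using bounded_pos by blast
  then show thesis by (intro that[of B]) force+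
qed

lemma line_collision_measurable [measurable]:
  "(\<lambda>(s, r). line_collision (g s) r) \<in> borel_measurable (borel \<Otimes>\<^sub>M borel)"
  unfolding line_collision_def linear_gain_def loss_rate_def indicator_def atLeastAtMost_iff atLeast_iff
  by measurable

lemma collision_L1_bounded:
  obtains K where "0 \<le> K" "\<And>s. s \<in> {0..T} \<Longrightarrow> (\<integral>r. \<bar>line_collision (g s) r\<bar> \<partial>lborel) \<le> K"
proof -
  obtain B0 where B0: "0 < B0" "\<And>t. t \<in> {0..T} \<Longrightarrow> moment 0 (g t) \<le> B0" using moment_bounded[of 0] by auto
  obtain B2 where B2: "0 < B2" "\<And>t. t \<in> {0..T} \<Longrightarrow> moment 2 (g t) \<le> B2" using moment_bounded[of 2] by auto
  obtain B5 where B5: "0 < B5" "\<And>t. t \<in> {0..T} \<Longrightarrow> moment 5 (g t) \<le> B5" using moment_bounded[of 5] by auto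
  show thesis
  proof (rule that)
    show "0 \<le> 16 * (B0 * B2) + B5" using B0 B2 B5 by simp
    fix s assume s: "s \<in> {0..T}"
    have "moment 0 (g s) * moment 2 (g s) \<le> B0 * B2"
      using B0 B2 s by (intro mult_mono P.moment_nonneg) auto
    then show "(\<integral>r. \<bar>line_collision (g s) r\<bar> \<partial>lborel) \<le> 16 * (B0 * B2) + B5"
      using P.collision_integral_abs_le[of s] B5(2)[OF s] by linarith
  qed
qed

lemma collision_pair_integrable:
  assumes A: "A \<subseteq> {0..T}" and [measurable]: "A \<in> sets borel"
  shows "integrable (lborel \<Otimes>\<^sub>M lborel) (\<lambda>(s, r). indicator A s * (w s * line_collision (g s) r))"
proof (rule lborel_pair.Fubini_integrable)
  obtain K where K: "0 \<le> K" "\<And>s. s \<in> {0..T} \<Longrightarrow> (\<integral>r. \<bar>line_collision (g s) r\<bar> \<partial>lborel) \<le> K"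
    by (rule collision_L1_bounded) blast
  show "integrable lborel (\<lambda>s. \<integral>r. norm (case (s, r) of (s, r) \<Rightarrow> indicator A s * (w s * line_collision (g s) r)) \<partial>lborel)"
  proof (rule Bochner_Integration.integrable_bound)
    have "integrable lborel (indicator {0..T} :: real \<Rightarrow> real)"
      by (rule integrable_real_indicator) (use T in auto)
    then show "integrable lborel (\<lambda>s. W * K * indicator {0..T} s)" by (rule integrable_mult_right)
    show "AE s in lborel. norm (\<integral>r. norm (case (s, r) of (s, r) \<Rightarrow> indicator A s * (w s * line_collision (g s) r)) \<partial>lborel)
      \<le> norm (W * K * indicator {0..T} s)"
    proof (rule AE_I2)
      fix s
      have e: "(\<integral>r. norm (case (s, r) of (s, r) \<Rightarrow> indicator A s * (w s * line_collision (g s) r)) \<partial>lborel)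
         = indicator A s * (w s * (\<integral>r. \<bar>line_collision (g s) r\<bar> \<partial>lborel))"
        using w_bounds(1)[of s] by (simp add: abs_mult)
      show "norm (\<integral>r. norm (case (s, r) of (s, r) \<Rightarrow> indicator A s * (w s * line_collision (g s) r)) \<partial>lborel)
      \<le> norm (W * K * indicator {0..T} s)"
      proof (cases "s \<in> A")
        case True
        have "w s * (\<integral>r. \<bar>line_collision (g s) r\<bar> \<partial>lborel) \<le> W * K"
          using w_bounds[of s] W_nonneg K(2)[of s] True A by (intro mult_mono) auto
        then show ?thesis unfolding e using True A w_bounds(1)[of s] W_nonneg K(1) by auto
      qed (simp add: e)
    qed
  qed measurable
  show "AE s in lborel. integrable lborel (\<lambda>r. case (s, r) of (s, r) \<Rightarrow> indicator A s * (w s * line_collision (g s) r))"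
    by (rule AE_I2) (simp add: P.collision_integrable)
qed measurable

text \<open>For fixed times the equation holds for almost every radius, so it can be integrated
  against a bounded \<psi>; the \<open>L^1\<close> bound on the collision term, uniform in time,
  licenses the exchange of integrals. Half-open time cells make adjacent increments add without
  overlap.\<close>

lemma weak_form:
  assumes ab: "0 \<le> a" "a \<le> b" "b \<le> T" and [measurable]: "\<psi> \<in> borel_measurable borel" and B: "\<And>r. \<bar>\<psi> r\<bar> \<le> B"
  shows "integrable lborel (\<lambda>s. indicator {a<..b} s * (w s * (\<integral>r. \<psi> r * line_collision (g s) r \<partial>lborel)))"
    and "(\<integral>r. \<psi> r * g b r \<partial>lborel) - (\<integral>r. \<psi> r * g a r \<partial>lborel)
      = (\<integral>s. indicator {a<..b} s * (w s * (\<integral>r. \<psi> r * line_collision (g s) r \<partial>lborel)) \<partial>lborel)"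
proof -
  have Ag: "integrable lborel (\<lambda>r. \<psi> r * g t r)" for t
    by (rule Bochner_Integration.integrable_bound[OF integrable_mult_right[OF P.integrable_profile, of "B" t]])
      (use B in \<open>auto simp: abs_mult P.nonneg intro!: AE_I2 mult_right_mono intro: order_trans[OF B abs_ge_self]\<close>)
  have P: "integrable (lborel \<Otimes>\<^sub>M lborel) (\<lambda>(s, r). indicator A s * (w s * line_collision (g s) r))"
    if "A \<subseteq> {0..T}" "A \<in> sets borel" for A
    by (rule collision_pair_integrable[OF that])
  have bT: "b \<in> {0..T}" and aT: "a \<in> {0..T}" using ab by auto
  have subs: "{0..a} \<subseteq> {0..T}" "{0..a} \<in> sets borel" "{a<..b} \<subseteq> {0..T}" "{a<..b} \<in> sets borel" using ab by auto
  have P\<psi>: "integrable (lborel \<Otimes>\<^sub>M lborel) (\<lambda>(s, r). indicator {a<..b} s * (w s * (\<psi> r * line_collision (g s) r)))"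
  proof (rule Bochner_Integration.integrable_bound[OF integrable_mult_right[OF P[of "{a<..b}"], of B]])
    show "AE p in lborel \<Otimes>\<^sub>M lborel. norm (case p of (s, r) \<Rightarrow> indicator {a<..b} s * (w s * (\<psi> r * line_collision (g s) r)))
      \<le> norm (B * (case p of (s, r) \<Rightarrow> indicator {a<..b} s * (w s * line_collision (g s) r)))"
    proof (rule AE_I2, clarify)
      fix s r :: real
      have "\<bar>\<psi> r\<bar> \<le> \<bar>B\<bar>" using B[of r] by linarith
      then have "\<bar>\<psi> r\<bar> * \<bar>indicator {a<..b} s * (w s * line_collision (g s) r)\<bar> \<le> \<bar>B\<bar> * \<bar>indicator {a<..b} s * (w s * line_collision (g s) r)\<bar>"
        by (rule mult_right_mono) simp
      then show "norm (indicator {a<..b} s * (w s * (\<psi> r * line_collision (g s) r)))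
        \<le> norm (B * (indicator {a<..b} s * (w s * line_collision (g s) r)))"
        by (simp add: abs_mult ac_simps)
    qed
  qed (use ab in auto)
  have in1: "(\<integral>r. indicator {a<..b} s * (w s * (\<psi> r * line_collision (g s) r)) \<partial>lborel)
     = indicator {a<..b} s * (w s * (\<integral>r. \<psi> r * line_collision (g s) r \<partial>lborel))" for s
    by simp
  show "integrable lborel (\<lambda>s. indicator {a<..b} s * (w s * (\<integral>r. \<psi> r * line_collision (g s) r \<partial>lborel)))"
    using lborel_pair.integrable_fst[OF P\<psi>] by simp
  have "(\<integral>r. \<psi> r * g b r \<partial>lborel) - (\<integral>r. \<psi> r * g a r \<partial>lborel) = (\<integral>r. \<psi> r * g b r - \<psi> r * g a r \<partial>lborel)"
    using Ag by simp
  also have "\<dots> = (\<integral>r. \<integral>s. indicator {a<..b} s * (w s * (\<psi> r * line_collision (g s) r)) \<partial>lborel \<partial>lborel)"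
  proof (rule integral_cong_AE)
    show "AE r in lborel. \<psi> r * g b r - \<psi> r * g a r = (\<integral>s. indicator {a<..b} s * (w s * (\<psi> r * line_collision (g s) r)) \<partial>lborel)"
      using g_eq[OF bT] g_eq[OF aT] lborel_pair.AE_integrable_snd[OF P[OF subs(1,2)]] lborel_pair.AE_integrable_snd[OF P[OF subs(3,4)]]
    proof eventually_elim
      fix r
      let ?F = "\<lambda>A s. indicator A s * (w s * line_collision (g s) r)"
      assume b: "g b r = g 0 r + (\<integral>s. ?F {0..b} s \<partial>lborel)" and a: "g a r = g 0 r + (\<integral>s. ?F {0..a} s \<partial>lborel)"
        and Ia: "integrable lborel (?F {0..a})" and Iab: "integrable lborel (?F {a<..b})"
      have "?F {0..b} s = ?F {0..a} s + ?F {a<..b} s" for s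
        using ab by (auto simp: indicator_def)
      then have "(\<integral>s. ?F {0..b} s \<partial>lborel) = (\<integral>s. ?F {0..a} s \<partial>lborel) + (\<integral>s. ?F {a<..b} s \<partial>lborel)"
        using Ia Iab by simp
      then have "\<psi> r * g b r - \<psi> r * g a r = \<psi> r * (\<integral>s. ?F {a<..b} s \<partial>lborel)"
        using a b by (simp add: algebra_simps)
      also have "\<dots> = (\<integral>s. \<psi> r * ?F {a<..b} s \<partial>lborel)" by simp
      also have "\<dots> = (\<integral>s. indicator {a<..b} s * (w s * (\<psi> r * line_collision (g s) r)) \<partial>lborel)"
        by (rule Bochner_Integration.integral_cong) (auto simp: ac_simps)
      finally show "\<psi> r * g b r - \<psi> r * g a r = (\<integral>s. indicator {a<..b} s * (w s * (\<psi> r * line_collision (g s) r)) \<partial>lborel)" .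
    qed
  qed (use Ag in measurable)
  also have "\<dots> = (\<integral>s. \<integral>r. indicator {a<..b} s * (w s * (\<psi> r * line_collision (g s) r)) \<partial>lborel \<partial>lborel)"
    using lborel_pair.Fubini_integral[OF P\<psi>] .
  finally show "(\<integral>r. \<psi> r * g b r \<partial>lborel) - (\<integral>r. \<psi> r * g a r \<partial>lborel)
      = (\<integral>s. indicator {a<..b} s * (w s * (\<integral>r. \<psi> r * line_collision (g s) r \<partial>lborel)) \<partial>lborel)"
    unfolding in1 .
qed

end

section \<open>Propagation in time of the upper bound and of the second moment\<close>

context evolution
begin

text \<open>The derivative frozen at time \<open>b\<close> is a bounded function of the radius
  alone, hence an admissible test function; convexity turns the resulting identity into an
  inequality for the nonlinear excess.\<close>

lemma excess_increment:
  assumes M: "0 < M" and ab: "0 \<le> a" "a \<le> b" "b \<le> T"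
  shows "(\<integral>r. excess M (g b r) \<partial>lborel) - (\<integral>r. excess M (g a r) \<partial>lborel)
    \<le> (\<integral>s. indicator {a<..b} s * (w s * (\<integral>r. excess_deriv M (g b r) * line_collision (g s) r \<partial>lborel)) \<partial>lborel)"
proof -
  have ex: "integrable lborel (\<lambda>r. excess M (g t r))" for t
    using profile.integrable_profile[OF P.profile_excess[OF M]] .
  have \<theta>: "\<bar>excess_deriv M (g b r)\<bar> \<le> 1" for r
    using excess_deriv_nonneg[OF M, of "g b r"] excess_deriv_le[OF M, of "g b r"] by simp
  have d: "integrable lborel (\<lambda>r. excess_deriv M (g b r) * g t r)" for t
    by (rule Bochner_Integration.integrable_bound[OF P.integrable_profile[of t]])
      (use \<theta> in \<open>auto simp: abs_mult P.nonneg intro!: AE_I2 mult_left_le_one_le\<close>)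
  have "(\<integral>r. excess M (g b r) \<partial>lborel) - (\<integral>r. excess M (g a r) \<partial>lborel) = (\<integral>r. excess M (g b r) - excess M (g a r) \<partial>lborel)"
    using ex by simp
  also have "\<dots> \<le> (\<integral>r. excess_deriv M (g b r) * g b r - excess_deriv M (g b r) * g a r \<partial>lborel)"
    by (intro integral_mono Bochner_Integration.integrable_diff ex d)
      (use excess_convex[OF M] in \<open>simp add: right_diff_distrib\<close>)
  also have "\<dots> = (\<integral>r. excess_deriv M (g b r) * g b r \<partial>lborel) - (\<integral>r. excess_deriv M (g b r) * g a r \<partial>lborel)"
    using d by simp
  also have "\<dots> = (\<integral>s. indicator {a<..b} s * (w s * (\<integral>r. excess_deriv M (g b r) * line_collision (g s) r \<partial>lborel)) \<partial>lborel)"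
    by (rule weak_form(2)[OF ab _ \<theta>]) measurable
  finally show ?thesis .
qed

text \<open>The chain rule for the excess, proved by discretising time: convexity gives the inequality
  over each cell with the derivative frozen at its right endpoint \<open>\<tau> n s\<close>, and
  \<open>L\<^sup>1\<close>-continuity in time lets the mesh tend to zero.\<close>

lemma excess_chain:
  assumes M: "0 < M" and t: "0 < t" "t \<le> T"
  shows "(\<integral>r. excess M (g t r) \<partial>lborel) - (\<integral>r. excess M (g 0 r) \<partial>lborel)
    \<le> (\<integral>s. indicator {0<..t} s * (w s * (\<integral>r. excess_deriv M (g s r) * line_collision (g s) r \<partial>lborel)) \<partial>lborel)"
proof -
  \<comment> \<open>Rounding up, with cells open on the left, gives the same right endpoint on the
    whole cell, as \<open>excess_increment\<close> demands.\<close>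
  define \<tau> where "\<tau> n s = t * of_int \<lceil>real n * s / t\<rceil> / real n" for n :: nat and s :: real
  have [measurable]: "\<tau> n \<in> borel_measurable borel" for n
    unfolding \<tau>_def by measurable
  define F where "F n s = w s * (\<integral>r. excess_deriv M (g (\<tau> n s) r) * line_collision (g s) r \<partial>lborel)" for n s
  have [measurable]: "F n \<in> borel_measurable borel" for n
    unfolding F_def by measurable
  have abs_\<theta>: "\<bar>excess_deriv M x\<bar> \<le> 1" for x
    using excess_deriv_nonneg[OF M, of x] excess_deriv_le[OF M, of x] by simp
  obtain K where K: "0 \<le> K" "\<And>s. s \<in> {0..T} \<Longrightarrow> (\<integral>r. \<bar>line_collision (g s) r\<bar> \<partial>lborel) \<le> K"
    by (rule collision_L1_bounded) blast
  have F_bound: "\<bar>F n s\<bar> \<le> W * K" if "s \<in> {0..T}" for n s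
  proof -
    have "\<bar>\<integral>r. excess_deriv M (g (\<tau> n s) r) * line_collision (g s) r \<partial>lborel\<bar> \<le> (\<integral>r. \<bar>excess_deriv M (g (\<tau> n s) r) * line_collision (g s) r\<bar> \<partial>lborel)"
      by (rule integral_abs_bound)
    also have "\<dots> \<le> (\<integral>r. \<bar>line_collision (g s) r\<bar> \<partial>lborel)"
      by (rule integral_mono')
        (auto simp: abs_mult P.collision_integrable intro!: mult_left_le_one_le abs_\<theta>)
    also have "\<dots> \<le> K" by (rule K(2)[OF that])
    finally show ?thesis
      unfolding F_def abs_mult using w_bounds[of s] K(1) by (intro mult_mono) auto
  qed
  have F_int: "integrable lborel (\<lambda>s. indicator A s * F n s)" if "A \<subseteq> {0..T}" and [measurable]: "A \<in> sets borel" for A n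
  proof (rule Bochner_Integration.integrable_bound)
    have "integrable lborel (indicator {0..T} :: real \<Rightarrow> real)"
      by (rule integrable_real_indicator) (use T in auto)
    then show "integrable lborel (\<lambda>s. W * K * indicator {0..T} s)" by (rule integrable_mult_right)
    show "AE s in lborel. norm (indicator A s * F n s) \<le> norm (W * K * indicator {0..T} s)"
      using that F_bound W_nonneg K(1) by (intro AE_I2) (auto simp: indicator_def)
  qed measurable
  have step: "(\<integral>r. excess M (g (t * real m / real n) r) \<partial>lborel) - (\<integral>r. excess M (g 0 r) \<partial>lborel)
     \<le> (\<integral>s. indicator {0<..t * real m / real n} s * F n s \<partial>lborel)" if n: "0 < n" and "m \<le> n" for m n :: nat
    using \<open>m \<le> n\<close>
  proof (induction m)
    case 0
    then show ?case by simp
  next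
    case (Suc m)
    define a where "a = t * real m / real n"
    define b where "b = t * real (Suc m) / real n"
    have a0: "0 \<le> a" using t by (simp add: a_def)
    have ab: "a \<le> b" using t n by (simp add: a_def b_def divide_right_mono)
    have "real (Suc m) / real n \<le> 1" using Suc.prems n by simp
    from mult_left_mono[OF this, of t] have bt: "b \<le> t" using t by (simp add: b_def)
    have \<tau>: "\<tau> n s = b" if "s \<in> {a<..b}" for s
    proof -
      have "real m < real n * s / t" "real n * s / t \<le> real (Suc m)"
        using that t n by (auto simp: a_def b_def field_simps)
      then have "\<lceil>real n * s / t\<rceil> = int (Suc m)"
        by (intro ceiling_unique) auto
      then show ?thesis by (simp add: \<tau>_def b_def)
    qed
    have "(\<integral>r. excess M (g b r) \<partial>lborel) - (\<integral>r. excess M (g a r) \<partial>lborel)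
      \<le> (\<integral>s. indicator {a<..b} s * (w s * (\<integral>r. excess_deriv M (g b r) * line_collision (g s) r \<partial>lborel)) \<partial>lborel)"
      by (rule excess_increment[OF M a0 ab]) (use bt t in simp)
    also have "\<dots> = (\<integral>s. indicator {a<..b} s * F n s \<partial>lborel)"
      by (rule Bochner_Integration.integral_cong) (auto simp: F_def \<tau> indicator_def)
    finally have 1: "(\<integral>r. excess M (g b r) \<partial>lborel) - (\<integral>r. excess M (g a r) \<partial>lborel) \<le> (\<integral>s. indicator {a<..b} s * F n s \<partial>lborel)" .
    have 2: "(\<integral>r. excess M (g a r) \<partial>lborel) - (\<integral>r. excess M (g 0 r) \<partial>lborel) \<le> (\<integral>s. indicator {0<..a} s * F n s \<partial>lborel)"
      using Suc by (simp add: a_def)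
    have "(\<integral>s. indicator {0<..b} s * F n s \<partial>lborel) = (\<integral>s. indicator {0<..a} s * F n s + indicator {a<..b} s * F n s \<partial>lborel)"
      by (rule Bochner_Integration.integral_cong) (use a0 ab in \<open>auto simp: indicator_def\<close>)
    also have "\<dots> = (\<integral>s. indicator {0<..a} s * F n s \<partial>lborel) + (\<integral>s. indicator {a<..b} s * F n s \<partial>lborel)"
      using a0 ab bt t by (intro Bochner_Integration.integral_add F_int) auto
    finally show ?case using 1 2 unfolding b_def[symmetric] by linarith
  qed
  \<comment> \<open>The index is shifted so that the mesh \<open>t / n\<close> never divides by
    zero.\<close>
  have step': "(\<integral>r. excess M (g t r) \<partial>lborel) - (\<integral>r. excess M (g 0 r) \<partial>lborel)
     \<le> (\<integral>s. indicator {0<..t} s * F (Suc n) s \<partial>lborel)" for n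
    using step[of "Suc n" "Suc n"] by (simp del: of_nat_Suc)
  have "(\<lambda>n. \<integral>s. indicator {0<..t} s * F (Suc n) s \<partial>lborel)
     \<longlonglongrightarrow> (\<integral>s. indicator {0<..t} s * (w s * (\<integral>r. excess_deriv M (g s r) * line_collision (g s) r \<partial>lborel)) \<partial>lborel)"
  proof (rule integral_dominated_convergence)
    have "integrable lborel (indicator {0..T} :: real \<Rightarrow> real)"
      by (rule integrable_real_indicator) (use T in auto)
    then show "integrable lborel (\<lambda>s. W * K * indicator {0..T} s)" by (rule integrable_mult_right)
    show "AE s in lborel. norm (indicator {0<..t} s * F (Suc n) s) \<le> W * K * indicator {0..T} s" for n
      using F_bound t W_nonneg K(1) by (intro AE_I2) (auto simp: indicator_def)
    show "AE s in lborel. (\<lambda>n. indicator {0<..t} s * F (Suc n) s)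
      \<longlonglongrightarrow> indicator {0<..t} s * (w s * (\<integral>r. excess_deriv M (g s r) * line_collision (g s) r \<partial>lborel))"
    proof (rule AE_I2)
      fix s
      show "(\<lambda>n. indicator {0<..t} s * F (Suc n) s)
        \<longlonglongrightarrow> indicator {0<..t} s * (w s * (\<integral>r. excess_deriv M (g s r) * line_collision (g s) r \<partial>lborel))"
      proof (cases "s \<in> {0<..t}")
        case True
        then have sT: "s \<in> {0..T}" using t by auto
        have \<tau>_ge: "s \<le> \<tau> (Suc n) s" and \<tau>_le: "\<tau> (Suc n) s \<le> t" and \<tau>_near: "\<tau> (Suc n) s \<le> s + t / real (Suc n)" for n
        proof -
          let ?N = "real (Suc n)"
          have N: "0 < ?N" by simp
          let ?c = "of_int \<lceil>?N * s / t\<rceil> :: real"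
          have c: "?N * s / t \<le> ?c" "?c \<le> ?N * s / t + 1"
            by (rule le_of_int_ceiling) (rule of_int_ceiling_le_add_one)
          have "?N * s / t \<le> of_int (int (Suc n))" using True t by (simp add: field_simps del: of_nat_Suc)
          then have "\<lceil>?N * s / t\<rceil> \<le> int (Suc n)" by (simp only: ceiling_le_iff)
          then have "?c \<le> of_int (int (Suc n))" by (simp only: of_int_le_iff)
          then have c2: "?c \<le> ?N" by (simp only: of_int_of_nat_eq)
          have m: "t * x / ?N \<le> t * y / ?N" if "x \<le> y" for x y
            using that t N by (intro divide_right_mono mult_left_mono) auto
          show "s \<le> \<tau> (Suc n) s"
            using m[OF c(1)] t N by (simp add: \<tau>_def del: of_nat_Suc)
          show "\<tau> (Suc n) s \<le> t"
            using m[OF c2] t N by (simp add: \<tau>_def del: of_nat_Suc)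
          have "t * (?N * s / t + 1) / ?N = s + t / ?N"
            using t N by (simp add: field_simps del: of_nat_Suc)
          with m[OF c(2)] show "\<tau> (Suc n) s \<le> s + t / ?N"
            by (simp add: \<tau>_def del: of_nat_Suc)
        qed
        have "(\<lambda>n. t / real (Suc n)) \<longlonglongrightarrow> 0"
          by (rule LIMSEQ_Suc[OF lim_const_over_n])
        then have "(\<lambda>n. s + t / real (Suc n)) \<longlonglongrightarrow> s + 0"
          by (rule tendsto_add[OF tendsto_const])
        then have up: "(\<lambda>n. s + t / real (Suc n)) \<longlonglongrightarrow> s" by simp
        have \<tau>_lim: "(\<lambda>n. \<tau> (Suc n) s) \<longlonglongrightarrow> s"
        proof (rule tendsto_sandwich[OF _ _ tendsto_const up])
          show "\<forall>\<^sub>F n in sequentially. s \<le> \<tau> (Suc n) s"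
            by (rule always_eventually, rule allI, rule \<tau>_ge)
          show "\<forall>\<^sub>F n in sequentially. \<tau> (Suc n) s \<le> s + t / real (Suc n)"
            by (rule always_eventually, rule allI, rule \<tau>_near)
        qed
        \<comment> \<open>\<open>g_cont\<close> speaks of a punctured neighbourhood, but \<tau> can
          equal \<open>s\<close> when \<open>s\<close> is a grid point; \<open>d s = 0\<close> turns
          the limit into continuity at \<open>s\<close>.\<close>
        define d where "d u = (\<integral>r. \<bar>g u r - g s r\<bar> \<partial>lborel)" for u
        have "d s = 0" by (simp add: d_def)
        moreover have "(d \<longlongrightarrow> 0) (at s within {0..T})"
          using g_cont[of 0 s] sT by (simp add: d_def[abs_def])
        ultimately have "continuous (at s within {0..T}) d"
          by (simp add: continuous_within)
        moreover have "\<forall>\<^sub>F n in sequentially. \<tau> (Suc n) s \<in> {0..T}"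
        proof (rule always_eventually, rule allI)
          fix n
          show "\<tau> (Suc n) s \<in> {0..T}" using \<tau>_ge[of n] \<tau>_le[of n] sT t by simp
        qed
        ultimately have "(\<lambda>n. d (\<tau> (Suc n) s)) \<longlonglongrightarrow> d s"
          using \<tau>_lim by (rule continuous_within_tendsto_compose)
        then have "(\<lambda>n. \<integral>r. \<bar>g (\<tau> (Suc n) s) r - g s r\<bar> \<partial>lborel) \<longlonglongrightarrow> 0"
          unfolding \<open>d s = 0\<close> unfolding d_def .
        then have "(\<lambda>n. \<integral>r. excess_deriv M (g (\<tau> (Suc n) s) r) * line_collision (g s) r \<partial>lborel)
           \<longlonglongrightarrow> (\<integral>r. excess_deriv M (g s r) * line_collision (g s) r \<partial>lborel)"
          by (intro tendsto_integral_lipschitz_mult[where L="2 / M"] P.integrable_profile P.collision_integrable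
              measurable_excess excess_deriv_nonneg excess_deriv_le excess_deriv_lipschitz M)
        then show ?thesis unfolding F_def by (intro tendsto_mult_left)
      qed simp
    qed
  qed measurable
  then show ?thesis by (rule LIMSEQ_le_const) (use step' in auto)
qed

lemma sup_bound:
  assumes M: "0 < M" and init: "AE r in lborel. g 0 r \<le> M"
    and cond: "\<And>t r. t \<in> {0..T} \<Longrightarrow> 0 \<le> r \<Longrightarrow> 2 * r * moment 2 (g t) \<le> M * (2 * moment 1 (g t) + r ^ 4 / 30)"
    and t: "t \<in> {0..T}"
  shows "AE r in lborel. g t r \<le> M"
proof -
  define H where "H t = (\<integral>r. excess M (g t r) \<partial>lborel)" for t
  have ex: "integrable lborel (\<lambda>r. excess M (g t r))" for t
    using profile.integrable_profile[OF P.profile_excess[OF M]] .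
  have H_nonneg: "0 \<le> H t" for t
    unfolding H_def by (intro integral_nonneg_AE AE_I2 excess_nonneg[OF M])
  have H_cont: "continuous_on {0..T} H"
  proof (rule continuous_L1[where k=0])
    fix s t
    have "\<bar>H s - H t\<bar> = \<bar>\<integral>r. excess M (g s r) - excess M (g t r) \<partial>lborel\<bar>"
      using ex by (simp add: H_def)
    also have "\<dots> \<le> (\<integral>r. \<bar>excess M (g s r) - excess M (g t r)\<bar> \<partial>lborel)" by (rule integral_abs_bound)
    also have "\<dots> \<le> (\<integral>r. \<bar>g s r - g t r\<bar> \<partial>lborel)"
      by (intro integral_mono integrable_abs Bochner_Integration.integrable_diff ex P.integrable_profile excess_lipschitz[OF M])
    finally show "\<bar>H s - H t\<bar> \<le> (\<integral>r. \<bar>g s r - g t r\<bar> * r ^ 0 \<partial>lborel)" by simp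
  qed simp
  have "H 0 = (\<integral>r. 0 \<partial>(lborel :: real measure))"
    unfolding H_def
  proof (rule integral_cong_AE)
    show "AE r in lborel. excess M (g 0 r) = 0"
      using init by eventually_elim (rule excess_below[OF M])
  qed measurable
  then have H0: "H 0 = 0" by simp
  obtain B2 where B2: "0 < B2" "\<And>t. t \<in> {0..T} \<Longrightarrow> moment 2 (g t) \<le> B2" using moment_bounded[of 2] by auto
  \<comment> \<open>\<open>W + 1\<close> replaces \<open>W\<close>, which may be 0, because Gronwall
    is stated for a positive constant.\<close>
  define K where "K = (W + 1) * (4 * B2)"
  have K: "0 < K" unfolding K_def using W_nonneg B2 by (intro mult_pos_pos) auto
  have "H t \<le> (\<integral>s. indicator {0..t} s * (K * H s) \<partial>lborel)" if tT: "t \<in> {0..T}" for t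
  proof (cases "t = 0")
    case True
    have "0 \<le> (\<integral>s. indicator {0..t} s * (K * H s) \<partial>lborel)"
      by (intro integral_nonneg_AE AE_I2) (use K H_nonneg in auto)
    then show ?thesis using True H0 by simp
  next
    case False
    then have t0: "0 < t" "t \<le> T" using tT by auto
    have "H t - H 0 \<le> (\<integral>s. indicator {0<..t} s * (w s * (\<integral>r. excess_deriv M (g s r) * line_collision (g s) r \<partial>lborel)) \<partial>lborel)"
      unfolding H_def by (rule excess_chain[OF M t0])
    also have "\<dots> \<le> (\<integral>s. indicator {0..t} s * (K * H s) \<partial>lborel)"
    proof (rule integral_mono')
      have "continuous_on {0..t} (\<lambda>s. K * H s)"
        using t0 by (intro continuous_intros continuous_on_subset[OF H_cont]) auto
      from borel_integrable_compact[OF _ this]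
      show "integrable lborel (\<lambda>s. indicator {0..t} s * (K * H s))" by simp
      fix s
      show "indicator {0<..t} s * (w s * (\<integral>r. excess_deriv M (g s r) * line_collision (g s) r \<partial>lborel)) \<le> indicator {0..t} s * (K * H s)"
      proof (cases "s \<in> {0<..t}")
        case True
        then have sT: "s \<in> {0..T}" using t0 by auto
        have "(\<integral>r. excess_deriv M (g s r) * line_collision (g s) r \<partial>lborel) \<le> 4 * moment 2 (g s) * H s"
          unfolding H_def by (rule P.excess_collision[OF M cond[OF sT]])
        also have "\<dots> \<le> 4 * B2 * H s"
          using B2(2)[OF sT] H_nonneg by (intro mult_right_mono) auto
        finally have "w s * (\<integral>r. excess_deriv M (g s r) * line_collision (g s) r \<partial>lborel) \<le> w s * (4 * B2 * H s)"
          by (rule mult_left_mono) (rule w_bounds)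
        also have "\<dots> \<le> (W + 1) * (4 * B2 * H s)"
          using w_bounds[of s] B2 H_nonneg[of s] by (intro mult_right_mono) auto
        finally show ?thesis using True by (simp add: K_def mult.assoc)
      next
        case False
        moreover have "0 \<le> indicator {0..t} s * (K * H s)" using K H_nonneg[of s] by simp
        ultimately show ?thesis by simp
      qed
      show "0 \<le> indicator {0..t} s * (K * H s)" using K H_nonneg[of s] by simp
    qed
    finally show ?thesis using H0 by simp
  qed
  from gronwall_zero[OF H_cont H_nonneg K this t]
  have "(\<integral>r. excess M (g t r) \<partial>lborel) = 0" by (simp add: H_def)
  then have "AE r in lborel. excess M (g t r) = 0"
    using integral_nonneg_eq_0_iff_AE[OF ex] excess_nonneg[OF M] by simp
  then show ?thesis by eventually_elim (rule excess_eq_0_imp[OF M])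
qed

text \<open>Energy conservation cancels the terms \<open>2 * R * n1\<close> at the two times,
  leaving the weak form of the concave test. The radius beyond which the right-hand side is
  nonpositive depends on \<open>s\<close>. Its positive part is bounded uniformly and eventually
  zero for each \<open>s\<close>, so dominated convergence in time removes \<open>R\<close>.\<close>

lemma second_moment_growth:
  assumes ab: "0 \<le> a" "a \<le> b" "b \<le> T"
    and dom: "\<And>s. s \<in> {a<..b} \<Longrightarrow> \<forall>\<^sub>F R in at_top. 4 * (moment 1 (g s) * moment 3 (g s) + (moment 2 (g s))\<^sup>2)
      \<le> (\<integral>x. indicator {0..R} x * (x ^ 7 * g s x) \<partial>lborel) / 70"
  shows "moment 2 (g b) \<le> moment 2 (g a)"
proof -
  define D where "D s R = 4 * (moment 1 (g s) * moment 3 (g s) + (moment 2 (g s))\<^sup>2) - (\<integral>x. indicator {0..R} x * (x ^ 7 * g s x) \<partial>lborel) / 70" for s R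
  obtain B1 where B1: "0 < B1" "\<And>t. t \<in> {0..T} \<Longrightarrow> moment 1 (g t) \<le> B1" using moment_bounded[of 1] by auto
  obtain B2 where B2: "0 < B2" "\<And>t. t \<in> {0..T} \<Longrightarrow> moment 2 (g t) \<le> B2" using moment_bounded[of 2] by auto
  obtain B3 where B3: "0 < B3" "\<And>t. t \<in> {0..T} \<Longrightarrow> moment 3 (g t) \<le> B3" using moment_bounded[of 3] by auto
  define B where "B = 4 * (B1 * B3 + B2\<^sup>2)"
  have D_le: "max 0 (D s R) \<le> B" if s: "s \<in> {0..T}" for s R
  proof -
    have "moment 1 (g s) * moment 3 (g s) \<le> B1 * B3"
      using B1 B3 s by (intro mult_mono P.moment_nonneg) auto
    moreover have "(moment 2 (g s))\<^sup>2 \<le> B2\<^sup>2" using B2(2)[OF s] by (intro power_mono P.moment_nonneg) auto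
    moreover have "0 \<le> (\<integral>x. indicator {0..R} x * (x ^ 7 * g s x) \<partial>lborel)"
      by (intro integral_nonneg_AE AE_I2) (auto simp: indicator_def P.nonneg)
    moreover have "0 \<le> B1 * B3" "0 \<le> B2\<^sup>2" using B1 B3 by auto
    ultimately show ?thesis unfolding D_def B_def by simp
  qed
  have B0: "0 \<le> B" using B1 B3 by (simp add: B_def)
  have [measurable]: "(\<lambda>s. D s R) \<in> borel_measurable borel" for R
    unfolding D_def moment_def by measurable
  have bnd: "integrable lborel (\<lambda>s. W * B * indicator {a<..b} s)"
    by (intro integrable_mult_right integrable_real_indicator) (use ab in auto)
  have pt: "indicator {a<..b} s * (w s * max 0 (D s R)) \<le> W * B * indicator {a<..b} s"
    "0 \<le> indicator {a<..b} s * (w s * max 0 (D s R))" for s R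
    using w_bounds[of s] D_le[of s R] ab by (auto simp: indicator_def intro!: mult_mono W_nonneg)
  have int: "integrable lborel (\<lambda>s. indicator {a<..b} s * (w s * max 0 (D s R)))" for R
    by (rule Bochner_Integration.integrable_bound[OF bnd]) (use pt B0 W_nonneg in \<open>auto intro!: AE_I2 simp: abs_of_nonneg\<close>)
  have ineq: "(2 * R * moment 1 (g b) - (\<integral>r. concave_test R r * g b r \<partial>lborel)) - (2 * R * moment 1 (g a) - (\<integral>r. concave_test R r * g a r \<partial>lborel))
      \<le> (\<integral>s. indicator {a<..b} s * (w s * max 0 (D s R)) \<partial>lborel)" if R: "0 \<le> R" for R
  proof -
    note W = weak_form[OF ab measurable_concave_test concave_test_abs[OF R]]
    have "(2 * R * moment 1 (g b) - (\<integral>r. concave_test R r * g b r \<partial>lborel)) - (2 * R * moment 1 (g a) - (\<integral>r. concave_test R r * g a r \<partial>lborel))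
      = - (\<integral>s. indicator {a<..b} s * (w s * (\<integral>r. concave_test R r * line_collision (g s) r \<partial>lborel)) \<partial>lborel)"
      unfolding W(2)[symmetric] using energy[of a] energy[of b] ab by simp
    also have "\<dots> = (\<integral>s. indicator {a<..b} s * (w s * - (\<integral>r. concave_test R r * line_collision (g s) r \<partial>lborel)) \<partial>lborel)"
      by simp
    also have "\<dots> \<le> (\<integral>s. indicator {a<..b} s * (w s * max 0 (D s R)) \<partial>lborel)"
    proof (rule integral_mono'[OF int])
      fix s
      have "- (\<integral>r. concave_test R r * line_collision (g s) r \<partial>lborel) \<le> max 0 (D s R)"
        using P.concave_test_collision[OF R, of s] by (simp add: D_def)
      then show "indicator {a<..b} s * (w s * - (\<integral>r. concave_test R r * line_collision (g s) r \<partial>lborel)) \<le> indicator {a<..b} s * (w s * max 0 (D s R))"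
        using w_bounds(1)[of s] by (intro mult_left_mono) auto
    qed (rule pt)
    finally show ?thesis .
  qed
  have "((\<lambda>R. \<integral>s. indicator {a<..b} s * (w s * max 0 (D s R)) \<partial>lborel) \<longlongrightarrow> (\<integral>s. 0 \<partial>(lborel :: real measure))) at_top"
  proof (rule integral_dominated_convergence_at_top[OF _ _ bnd])
    show "AE s in lborel. ((\<lambda>R. indicator {a<..b} s * (w s * max 0 (D s R))) \<longlongrightarrow> 0) at_top"
    proof (rule AE_I2)
      fix s
      show "((\<lambda>R. indicator {a<..b} s * (w s * max 0 (D s R))) \<longlongrightarrow> 0) at_top"
      proof (cases "s \<in> {a<..b}")
        case True
        have "\<forall>\<^sub>F R in at_top. D s R \<le> 0" using dom[OF True] by (simp add: D_def)
        then have "\<forall>\<^sub>F R in at_top. indicator {a<..b} s * (w s * max 0 (D s R)) = 0"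
          by eventually_elim (simp add: max_absorb1)
        then show ?thesis by (rule tendsto_eventually)
      qed simp
    qed
    show "\<forall>\<^sub>F R in at_top. AE s in lborel. norm (indicator {a<..b} s * (w s * max 0 (D s R))) \<le> W * B * indicator {a<..b} s"
      using pt by (intro always_eventually allI AE_I2) (auto simp: abs_of_nonneg)
  qed measurable
  then have r: "((\<lambda>R. \<integral>s. indicator {a<..b} s * (w s * max 0 (D s R)) \<partial>lborel) \<longlongrightarrow> 0) at_top" by simp
  have l: "((\<lambda>R. (2 * R * moment 1 (g b) - (\<integral>r. concave_test R r * g b r \<partial>lborel)) - (2 * R * moment 1 (g a) - (\<integral>r. concave_test R r * g a r \<partial>lborel)))
     \<longlongrightarrow> moment 2 (g b) - moment 2 (g a)) at_top"
    by (intro tendsto_diff P.truncated_second_moment)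
  have "moment 2 (g b) - moment 2 (g a) \<le> 0"
    by (rule tendsto_le[OF _ r l]) (use ineq in \<open>auto intro!: eventually_mono[OF eventually_ge_at_top[of 0]]\<close>)
  then show ?thesis by simp
qed

text \<open>After the last time at which the second moment is at most the bound, it stays above the
  level where the seventh moment dominates, so it cannot have grown since that time.\<close>

lemma second_moment_bound:
  assumes n1: "0 < moment 1 (g 0)" and t: "t \<in> {0..T}"
  shows "moment 2 (g t) \<le> max (moment 2 (g 0)) (5 * moment 1 (g 0) powr (5/4))"
proof (rule ccontr)
  define B where "B = max (moment 2 (g 0)) (5 * moment 1 (g 0) powr (5/4))"
  assume "\<not> ?thesis"
  then have gt: "B < moment 2 (g t)" by (simp add: B_def not_le)
  define S where "S = {s \<in> {0..t}. moment 2 (g s) \<le> B}"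
  have cont: "continuous_on {0..t} (\<lambda>s. moment 2 (g s))"
    using t by (intro continuous_on_subset[OF moment_continuous]) auto
  have "closed S" unfolding S_def
    by (rule continuous_on_closed_Collect_le) (auto intro: cont continuous_on_const)
  then have "compact S"
    unfolding compact_eq_bounded_closed S_def by (auto intro: bounded_subset[OF bounded_closed_interval])
  moreover have "0 \<in> S" using t by (simp add: S_def B_def)
  ultimately obtain a where a: "a \<in> S" "\<And>s. s \<in> S \<Longrightarrow> s \<le> a"
    using compact_attains_sup[of S] by auto
  have "moment 2 (g t) \<le> moment 2 (g a)"
  proof (rule second_moment_growth)
    fix s assume s: "s \<in> {a<..t}"
    then have "s \<notin> S" "s \<in> {0..t}" using a by (force, simp add: S_def)
    then have "B < moment 2 (g s)" by (simp add: S_def)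
    then have lt: "5 * moment 1 (g 0) powr (5/4) \<le> moment 2 (g s)" by (simp add: B_def)
    have sT: "s \<in> {0..T}" using s a t by (auto simp: S_def)
    have "625 * moment 1 (g 0) ^ 5 = (5 * moment 1 (g 0) powr (5/4)) ^ 4"
      using n1 by (simp add: power_mult_distrib powr_power)
    also have "\<dots> \<le> moment 2 (g s) ^ 4" by (rule power_mono[OF lt]) simp
    finally show "\<forall>\<^sub>F R in at_top. 4 * (moment 1 (g s) * moment 3 (g s) + (moment 2 (g s))\<^sup>2)
      \<le> (\<integral>x. indicator {0..R} x * (x ^ 7 * g s x) \<partial>lborel) / 70"
      using energy[OF sT] n1 by (intro P.seventh_moment_dominates) auto
  qed (use a t in \<open>auto simp: S_def\<close>)
  moreover have "moment 2 (g a) \<le> B" using a by (simp add: S_def)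
  ultimately show False using gt by simp
qed

lemma mass_balance:
  assumes t: "t \<in> {0..T}"
  shows "moment 0 (g t) - moment 0 (g 0) = (\<integral>s. indicator {0<..t} s * (w s * (\<integral>r. line_collision (g s) r \<partial>lborel)) \<partial>lborel)"
  using weak_form(2)[of 0 t "\<lambda>_. 1" 1] t by (simp add: moment_def)

end

section \<open>Solutions of the condensate system\<close>

lemma line_collision_nonpos:
  assumes "\<And>x. x \<le> 0 \<Longrightarrow> G x = 0" "r \<le> 0"
  shows "line_collision G r = 0"
proof -
  have z: "(\<integral>s. G s * G (r - s) \<partial>lborel) = (\<integral>s. 0 \<partial>(lborel :: real measure))"
  proof (rule Bochner_Integration.integral_cong[OF refl])
    fix s
    show "G s * G (r - s) = 0" using assms by (cases "s \<le> 0") auto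
  qed
  have l: "linear_gain G r = (\<integral>s. 0 \<partial>(lborel :: real measure))"
    unfolding linear_gain_def
    by (rule Bochner_Integration.integral_cong) (use assms in \<open>auto simp: indicator_def\<close>)
  show ?thesis using assms z l by (cases "r = 0") (auto simp: line_collision_def indicator_def)
qed

text \<open>Three of the four terms see the density through integrals only and the loss also through
  its value at \<open>r\<close>, so almost-everywhere equality plus equality at that one point
  suffices. This transfers the equation to the positive part of the density.\<close>

lemma line_collision_cong_AE:
  assumes [measurable]: "F \<in> borel_measurable borel" "G \<in> borel_measurable borel"
    and ae: "AE x in lborel. F x = G x" and r: "F r = G r"
  shows "line_collision F r = line_collision G r"
proof -
  have ae1: "AE s in lborel. F (r + (-1) * s) = G (r + (-1) * s)"
    by (rule AE_borel_affine[OF _ _ ae]) auto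
  have ae2: "AE s in lborel. F (- r + 1 * s) = G (- r + 1 * s)"
    by (rule AE_borel_affine[OF _ _ ae]) auto
  have "(\<integral>s. F s * F (r - s) \<partial>lborel) = (\<integral>s. G s * G (r - s) \<partial>lborel)"
    using ae ae1 by (intro integral_cong_AE) auto
  moreover have "(\<integral>s. F s * F (s - r) \<partial>lborel) = (\<integral>s. G s * G (s - r) \<partial>lborel)"
    using ae ae2 by (intro integral_cong_AE) auto
  moreover have "linear_gain F r = linear_gain G r"
    unfolding linear_gain_def indicator_def atLeastAtMost_iff
    using ae by (intro integral_cong_AE) auto
  moreover have "loss_rate F r = loss_rate G r"
    unfolding loss_rate_def using ae by (intro arg_cong[where f="\<lambda>x. r ^ 5 / 30 + x"] integral_cong_AE) auto
  ultimately show ?thesis using r by (simp add: line_collision_def)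
qed

lemma collision_eq_line_collision:
  assumes G: "\<And>x. 0 \<le> x \<Longrightarrow> G x = F x * x\<^sup>2" "\<And>x. x < 0 \<Longrightarrow> G x = 0"
    and int0: "integrable lborel G" and int2: "integrable lborel (\<lambda>x. x ^ 2 * G x)" and r: "0 \<le> r"
  shows "collision F r * r\<^sup>2 = line_collision G r"
\<comment> \<open>At the origin the division by zero in \<open>collision\<close> is multiplied by 0,
  and the right-hand side vanishes because \<open>G 0 = 0\<close>.\<close>
proof (cases "r = 0")
  case True
  have "G x = 0" if "x \<le> 0" for x using G[of x] that by (cases "x = 0") auto
  then show ?thesis using line_collision_nonpos[of G r] True by simp
next
  case False
  then have r0: "0 < r" using r by simp
  note [measurable] = borel_measurable_integrable[OF int0]
  have int: "integrable lborel (\<lambda>s. h s * G s)"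
    if [measurable]: "h \<in> borel_measurable borel" and h: "\<And>s. 0 \<le> s \<Longrightarrow> \<bar>h s\<bar> \<le> 8 * (r\<^sup>2 + s\<^sup>2)" for h
  proof (rule Bochner_Integration.integrable_bound)
    show "integrable lborel (\<lambda>s. 8 * (r\<^sup>2 * G s + s ^ 2 * G s))"
      by (intro integrable_mult_right Bochner_Integration.integrable_add int0 int2)
    show "AE s in lborel. norm (h s * G s) \<le> norm (8 * (r\<^sup>2 * G s + s ^ 2 * G s))"
    proof (rule AE_I2)
      fix s
      show "norm (h s * G s) \<le> norm (8 * (r\<^sup>2 * G s + s ^ 2 * G s))"
      proof (cases "0 \<le> s")
        case True
        have "\<bar>h s\<bar> * \<bar>G s\<bar> \<le> 8 * (r\<^sup>2 + s\<^sup>2) * \<bar>G s\<bar>" by (intro mult_right_mono h True) auto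
        moreover have "norm (8 * (r\<^sup>2 * G s + s ^ 2 * G s)) = 8 * (r\<^sup>2 + s\<^sup>2) * \<bar>G s\<bar>"
          by (simp add: distrib_right[symmetric] abs_mult)
        ultimately show ?thesis by (simp add: abs_mult)
      qed (simp add: G)
    qed
  qed measurable
  \<comment> \<open>The three weights left by the terms proportional to \<open>f r\<close>: distance
    to a larger radius, distance to a smaller one, and the sum. They are integrated separately
    because the integral is linear only on integrable functions.\<close>
  define a where "a s = (if r \<le> s then (s - r)\<^sup>2 else 0)" for s
  define b where "b s = (if s \<le> r then (r - s)\<^sup>2 else 0)" for s
  define c where "c s = (r + s)\<^sup>2" for s
  have [measurable]: "a \<in> borel_measurable borel" "b \<in> borel_measurable borel" "c \<in> borel_measurable borel"
    unfolding a_def b_def c_def by measurable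
  have ineq: "(s - r)\<^sup>2 \<le> 2 * (r\<^sup>2 + s\<^sup>2)" "(r - s)\<^sup>2 \<le> 2 * (r\<^sup>2 + s\<^sup>2)" "(r + s)\<^sup>2 \<le> 2 * (r\<^sup>2 + s\<^sup>2)" for s
    using sum_squares_bound[of r s] zero_le_power2[of "r + s"] by (auto simp: power2_eq_square algebra_simps)
  have bnd: "\<bar>a s\<bar> \<le> 8 * (r\<^sup>2 + s\<^sup>2)" "\<bar>b s\<bar> \<le> 8 * (r\<^sup>2 + s\<^sup>2)" "\<bar>c s\<bar> \<le> 8 * (r\<^sup>2 + s\<^sup>2)" for s
    using ineq[of s] zero_le_power2[of r] zero_le_power2[of s]
    unfolding a_def b_def c_def by (auto simp del: zero_le_power2 power2_diff power2_sum intro: order_trans)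
  have I: "integrable lborel (\<lambda>s. a s * G s)" "integrable lborel (\<lambda>s. b s * G s)" "integrable lborel (\<lambda>s. c s * G s)"
    using bnd by (auto intro!: int)
  have T1: "(LINT s:{0..r}|lborel. kernel s (r - s) * F s * F (r - s)) = r\<^sup>2 * (\<integral>s. G s * G (r - s) \<partial>lborel)"
    unfolding set_lebesgue_integral_def integral_mult_right_zero[symmetric]
    by (rule Bochner_Integration.integral_cong) (auto simp: indicator_def G kernel_def)
  have T2: "(LINT s:{r..}|lborel. kernel r (s - r) * F s * F (s - r)) = r\<^sup>2 * (\<integral>s. G s * G (s - r) \<partial>lborel)"
    unfolding set_lebesgue_integral_def integral_mult_right_zero[symmetric]
    by (rule Bochner_Integration.integral_cong) (use r in \<open>auto simp: indicator_def G kernel_def\<close>)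
  have A: "(LINT s:{r..}|lborel. kernel r (s - r) * F s) = r\<^sup>2 * (\<integral>s. a s * G s \<partial>lborel)"
    unfolding set_lebesgue_integral_def integral_mult_right_zero[symmetric]
    by (rule Bochner_Integration.integral_cong) (use r in \<open>auto simp: indicator_def G kernel_def a_def\<close>)
  have B: "(LINT s:{0..r}|lborel. kernel s (r - s) * F s) = r\<^sup>2 * (\<integral>s. b s * G s \<partial>lborel)"
    unfolding set_lebesgue_integral_def integral_mult_right_zero[symmetric]
    by (rule Bochner_Integration.integral_cong) (use r in \<open>auto simp: indicator_def G kernel_def b_def\<close>)
  have C: "(LINT s:{0..}|lborel. kernel r s * F s) = r\<^sup>2 * (\<integral>s. c s * G s \<partial>lborel)"
    unfolding set_lebesgue_integral_def integral_mult_right_zero[symmetric]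
    by (rule Bochner_Integration.integral_cong) (use r in \<open>auto simp: indicator_def G kernel_def c_def\<close>)
  have lin: "linear_gain G r = r\<^sup>2 * (\<integral>s. a s * G s \<partial>lborel)"
    unfolding linear_gain_def integral_mult_right_zero[symmetric]
    by (rule Bochner_Integration.integral_cong) (use r in \<open>auto simp: indicator_def a_def\<close>)
  have D: "(LINT s:{0..r}|lborel. kernel s (r - s)) = r\<^sup>2 * (r ^ 5 / 30)"
    unfolding set_lebesgue_integral_def integral_poly_power2(1)[OF r, symmetric] integral_mult_right_zero[symmetric]
    by (rule Bochner_Integration.integral_cong) (auto simp: kernel_def)
  have lk: "loss_kernel r s = 2 * c s + 2 * b s - 2 * a s" for s
    using r by (auto simp: loss_kernel_def a_def b_def c_def power2_eq_square algebra_simps)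
  have "(\<integral>s. loss_kernel r s * G s \<partial>lborel) = (\<integral>s. 2 * (c s * G s) + 2 * (b s * G s) - 2 * (a s * G s) \<partial>lborel)"
    by (simp add: lk algebra_simps)
  also have "\<dots> = 2 * (\<integral>s. c s * G s \<partial>lborel) + 2 * (\<integral>s. b s * G s \<partial>lborel) - 2 * (\<integral>s. a s * G s \<partial>lborel)"
    using I by simp
  finally have L: "loss_rate G r = r ^ 5 / 30 + (2 * (\<integral>s. c s * G s \<partial>lborel) + 2 * (\<integral>s. b s * G s \<partial>lborel) - 2 * (\<integral>s. a s * G s \<partial>lborel))"
    by (simp add: loss_rate_def)
  have "collision F r * r\<^sup>2 = Q_quad F r + Q_lin F r" using r0 by (simp add: collision_def)
  also have "\<dots> = line_collision G r"
    unfolding Q_quad_def Q_lin_def T1 T2 A B C D line_collision_def lin L G(1)[OF r]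
    using r by (simp add: algebra_simps)
  finally show ?thesis .
qed

lemma abs_continuous_imp_continuous_on:
  assumes "abs_continuous_on_interval l u h"
  shows "continuous_on {l..u} h"
  unfolding continuous_on_iff
proof (intro ballI allI impI)
  fix x e :: real assume x: "x \<in> {l..u}" and e: "0 < e"
  from assms e obtain \<eta> where \<eta>: "0 < \<eta>"
    and small: "\<forall>(n::nat) a b. (\<forall>i<n. l \<le> a i \<and> a i \<le> b i \<and> b i \<le> u) \<and>
        (\<forall>i<n. \<forall>j<n. i \<noteq> j \<longrightarrow> {a i<..<b i} \<inter> {a j<..<b j} = {}) \<and>
        (\<Sum>i<n. b i - a i) < \<eta> \<longrightarrow> (\<Sum>i<n. \<bar>h (b i) - h (a i)\<bar>) < e"
    unfolding abs_continuous_on_interval_def by blast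
  have le: "\<bar>h z - h y\<bar> < e" if "l \<le> y" "y \<le> z" "z \<le> u" "z - y < \<eta>" for y z
    using small[rule_format, of 1 "\<lambda>_. y" "\<lambda>_. z"] that by simp
  show "\<exists>d>0. \<forall>y\<in>{l..u}. dist y x < d \<longrightarrow> dist (h y) (h x) < e"
  proof (intro exI conjI ballI impI)
    fix y assume y: "y \<in> {l..u}" "dist y x < \<eta>"
    show "dist (h y) (h x) < e"
    proof (cases "x \<le> y")
      case True
      then show ?thesis using le[of x y] x y by (simp add: dist_real_def)
    next
      case False
      then show ?thesis using le[of y x] x y by (simp add: dist_real_def abs_minus_commute)
    qed
  qed (rule \<eta>)
qed

section \<open>From a solution of the system to an evolution of line densities\<close>

locale solution =
  fixes \<kappa> T :: real and f\<^sub>0 :: "real \<Rightarrow> real" and f :: "real \<Rightarrow> real \<Rightarrow> real" and nc :: "real \<Rightarrow> real"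
  assumes \<kappa>: "0 < \<kappa>" and T: "0 < T"
    and f0_meas: "set_borel_measurable lborel {0..} f\<^sub>0"
    and sol: "radial_solution \<kappa> T f\<^sub>0 f nc"
    and nc_pos: "t \<in> {0..T} \<Longrightarrow> 0 < nc t"
    and nc_ac: "abs_continuous_on_interval 0 T nc"
begin

text \<open>The cut-off in time as well as in radius makes the density a measurable profile for
  every real \<open>t\<close>, as \<open>evolution\<close> asks.\<close>

definition raw_line_density :: "real \<Rightarrow> real \<Rightarrow> real" where
  "raw_line_density t r = (if t \<in> {0..T} \<and> 0 \<le> r then f t r * r\<^sup>2 else 0)"

text \<open>Solutions are nonnegative only almost everywhere; taking the positive part yields a \<open>profile\<close>.\<close>

definition line_density :: "real \<Rightarrow> real \<Rightarrow> real" where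
  "line_density t r = max 0 (raw_line_density t r)"

definition rate :: "real \<Rightarrow> real" where
  "rate s = indicator {0..T} s * (\<kappa> / nc s)"

lemma f_meas: "set_borel_measurable lborel ({0..T} \<times> {0..}) (\<lambda>(t, r). f t r)"
  and f_nonneg: "t \<in> {0..T} \<Longrightarrow> AE r in lborel. 0 \<le> r \<longrightarrow> 0 \<le> f t r"
  and f_moments: "k \<le> 5 \<Longrightarrow> t \<in> {0..T} \<Longrightarrow> set_integrable lborel {0..} (\<lambda>r. f t r * r ^ (k + 2))"
  and f_cont: "k \<le> 5 \<Longrightarrow> t \<in> {0..T} \<Longrightarrow>
    ((\<lambda>s. LINT r:{0..}|lborel. \<bar>f s r - f t r\<bar> * r ^ (k + 2)) \<longlongrightarrow> 0) (at t within {0..T})"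
  and f_init: "AE r in lborel. 0 \<le> r \<longrightarrow> f 0 r = f\<^sub>0 r"
  and f_energy: "t \<in> {0..T} \<Longrightarrow> line_moment 3 (f t) = line_moment 3 f\<^sub>0"
  and f_eq: "t \<in> {0..T} \<Longrightarrow> AE r in lborel. 0 \<le> r \<longrightarrow>
        set_integrable lborel {0..t} (\<lambda>s. \<kappa> / nc s * collision (f s) r) \<and>
        f t r = f\<^sub>0 r + (LINT s:{0..t}|lborel. \<kappa> / nc s * collision (f s) r)"
  and nc_eq: "t \<in> {0..T} \<Longrightarrow> nc t = nc 0 - (LINT s:{0..t}|lborel. \<kappa> / nc s * collision_mass (f s))"
  using sol unfolding radial_solution_def by blast+

lemma raw_line_density_meas [measurable]: "case_prod raw_line_density \<in> borel_measurable (borel \<Otimes>\<^sub>M borel)"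
proof -
  have "(\<lambda>x. indicator ({0..T} \<times> {0..}) x *\<^sub>R (case x of (t, r) \<Rightarrow> f t r)) \<in> borel_measurable (borel \<Otimes>\<^sub>M borel)"
    using f_meas unfolding set_borel_measurable_def borel_prod by simp
  then have "(\<lambda>x. (indicator ({0..T} \<times> {0..}) x *\<^sub>R (case x of (t, r) \<Rightarrow> f t r)) * (snd x)\<^sup>2) \<in> borel_measurable (borel \<Otimes>\<^sub>M borel)"
    by measurable
  also have "(\<lambda>x. (indicator ({0..T} \<times> {0..}) x *\<^sub>R (case x of (t, r) \<Rightarrow> f t r)) * (snd x)\<^sup>2) = case_prod raw_line_density"
    by (auto simp: raw_line_density_def indicator_def)
  finally show ?thesis .
qed

lemma line_density_meas [measurable]: "case_prod line_density \<in> borel_measurable (borel \<Otimes>\<^sub>M borel)"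
  unfolding line_density_def by measurable

lemma line_density_AE: "AE r in lborel. raw_line_density t r = line_density t r"
proof (cases "t \<in> {0..T}")
  case True
  from f_nonneg[OF True] show ?thesis
    by eventually_elim (auto simp: line_density_def raw_line_density_def)
qed (auto simp: line_density_def raw_line_density_def)

lemma raw_line_density_moments:
  assumes "k \<le> 5"
  shows "integrable lborel (\<lambda>r. r ^ k * raw_line_density t r)"
proof (cases "t \<in> {0..T}")
  case True
  have "(\<lambda>r. r ^ k * raw_line_density t r) = (\<lambda>r. indicator {0..} r *\<^sub>R (f t r * r ^ (k + 2)))"
    by (rule ext) (use True in \<open>auto simp: raw_line_density_def indicator_def power2_eq_square\<close>)
  then show ?thesis using f_moments[OF assms True] by (simp add: set_integrable_def)
next
  case False
  then have "(\<lambda>r. r ^ k * raw_line_density t r) = (\<lambda>r. 0)" by (auto simp: raw_line_density_def)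
  then show ?thesis by simp
qed

lemma line_density_profile: "profile (line_density t)"
proof
  show "line_density t \<in> borel_measurable borel" by measurable
  show "0 \<le> line_density t x" for x by (simp add: line_density_def)
  show "line_density t x = 0" if "x < 0" for x using that by (simp add: line_density_def raw_line_density_def)
  show "integrable lborel (\<lambda>x. x ^ k * line_density t x)" if "k \<le> 5" for k
    by (rule Bochner_Integration.integrable_bound[OF raw_line_density_moments[OF that, of t]])
      (auto simp: line_density_def abs_mult intro!: AE_I2 mult_left_mono)
qed

lemma line_density_moment:
  assumes "t \<in> {0..T}"
  shows "moment k (line_density t) = line_moment (k + 2) (f t)"
proof -
  have "moment k (line_density t) = (\<integral>r. r ^ k * raw_line_density t r \<partial>lborel)"
    unfolding moment_def using line_density_AE[of t] by (intro integral_cong_AE) auto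
  also have "\<dots> = line_moment (k + 2) (f t)"
    unfolding line_moment_def set_lebesgue_integral_def
    by (rule Bochner_Integration.integral_cong) (use assms in \<open>auto simp: raw_line_density_def indicator_def power2_eq_square\<close>)
  finally show ?thesis .
qed

text \<open>The curve starts from \<open>f\<^sub>0\<close> only almost everywhere, and
  \<open>lborel\<close> is not complete; measurability of the initial profile is what equates the
  two integrals.\<close>

lemma initial_moment: "moment k (line_density 0) = line_moment (k + 2) f\<^sub>0"
proof -
  have [measurable]: "(\<lambda>r. indicator {0..} r * f\<^sub>0 r) \<in> borel_measurable borel"
    using f0_meas by (simp add: set_borel_measurable_def)
  have "(\<lambda>r. (indicator {0..} r * f\<^sub>0 r) * r ^ (k + 2)) \<in> borel_measurable borel" by measurable
  then have m: "(\<lambda>r. indicator {0..} r *\<^sub>R (f\<^sub>0 r * r ^ (k + 2))) \<in> borel_measurable lborel" by (simp add: mult.assoc)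
  have "moment k (line_density 0) = (\<integral>r. r ^ k * line_density 0 r \<partial>lborel)" by (simp add: moment_def)
  also have "\<dots> = line_moment (k + 2) f\<^sub>0"
    unfolding line_moment_def set_lebesgue_integral_def
  proof (rule integral_cong_AE)
    show "AE r in lborel. r ^ k * line_density 0 r = indicator {0..} r *\<^sub>R (f\<^sub>0 r * r ^ (k + 2))"
      using line_density_AE[of 0] f_init
    proof eventually_elim
      fix r assume "raw_line_density 0 r = line_density 0 r" "0 \<le> r \<longrightarrow> f 0 r = f\<^sub>0 r"
      then show "r ^ k * line_density 0 r = indicator {0..} r *\<^sub>R (f\<^sub>0 r * r ^ (k + 2))"
        using T by (auto simp: raw_line_density_def indicator_def power2_eq_square split: if_splits)
    qed
  qed (use m in measurable)
  finally show ?thesis .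
qed

lemma nc_cont: "continuous_on {0..T} nc"
  by (rule abs_continuous_imp_continuous_on[OF nc_ac])

lemma rate_meas [measurable]: "rate \<in> borel_measurable borel"
proof -
  have "continuous_on {0..T} (\<lambda>s. \<kappa> / nc s)"
    using nc_pos by (intro continuous_intros nc_cont) force
  from borel_measurable_continuous_on_indicator[OF _ this]
  show ?thesis by (simp add: rate_def[abs_def])
qed

text \<open>A continuous positive function on a compact interval has a positive minimum, so the
  factor \<open>\<kappa> / nc\<close> is bounded.\<close>

lemma rate_bounded: obtains W where "\<And>s. rate s \<le> W"
proof -
  obtain m where m: "m \<in> {0..T}" "\<And>s. s \<in> {0..T} \<Longrightarrow> nc m \<le> nc s"
    using continuous_attains_inf[OF _ _ nc_cont] T by auto
  show thesis
  proof (rule that)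
    fix s
    show "rate s \<le> \<kappa> / nc m"
    proof (cases "s \<in> {0..T}")
      case True
      then show ?thesis
        using m(2)[OF True] nc_pos[OF True] nc_pos[OF m(1)] \<kappa> by (simp add: rate_def divide_left_mono)
    next
      case False
      then show ?thesis using nc_pos[OF m(1)] \<kappa> by (simp add: rate_def)
    qed
  qed
qed

lemma collision_line:
  assumes "s \<in> {0..T}" "0 \<le> r"
  shows "collision (f s) r * r\<^sup>2 = line_collision (raw_line_density s) r"
proof (rule collision_eq_line_collision[OF _ _ _ _ assms(2)])
  show "raw_line_density s x = f s x * x\<^sup>2" if "0 \<le> x" for x using that assms by (simp add: raw_line_density_def)
  show "raw_line_density s x = 0" if "x < 0" for x using that by (simp add: raw_line_density_def)
  show "integrable lborel (raw_line_density s)" using raw_line_density_moments[of 0 s] by simp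
  show "integrable lborel (\<lambda>x. x ^ 2 * raw_line_density s x)" by (rule raw_line_density_moments) simp
qed

lemma line_collision_line_density:
  "raw_line_density s r = line_density s r \<Longrightarrow> line_collision (raw_line_density s) r = line_collision (line_density s) r"
  by (rule line_collision_cong_AE[OF _ _ line_density_AE]) measurable

text \<open>At each time the density agrees with its positive part for almost every radius, but the
  time integral at a fixed radius needs agreement for almost every time. Joint measurability permits
  the exchange of the two quantifiers.\<close>

lemma line_density_eq:
  assumes t: "t \<in> {0..T}"
  shows "AE r in lborel. line_density t r = line_density 0 r + (\<integral>s. indicator {0..t} s * (rate s * line_collision (line_density s) r) \<partial>lborel)"
proof -
  have "AE s in lborel. AE r in lborel. raw_line_density s r = line_density s r"
    by (rule AE_I2) (rule line_density_AE)
  moreover have "{x \<in> space (lborel \<Otimes>\<^sub>M lborel). raw_line_density (fst x) (snd x) = line_density (fst x) (snd x)} \<in> sets (lborel \<Otimes>\<^sub>M lborel)"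
    by measurable
  ultimately have "AE r in lborel. AE s in lborel. raw_line_density s r = line_density s r"
    by (rule lborel_pair.AE_commute[where P="\<lambda>s r. raw_line_density s r = line_density s r", THEN iffD1, rotated])
  then show ?thesis
    using f_eq[OF t] f_init line_density_AE[of t] line_density_AE[of 0]
  proof eventually_elim
    fix r
    assume ae: "AE s in lborel. raw_line_density s r = line_density s r"
      and eq: "0 \<le> r \<longrightarrow> set_integrable lborel {0..t} (\<lambda>s. \<kappa> / nc s * collision (f s) r) \<and>
        f t r = f\<^sub>0 r + (LINT s:{0..t}|lborel. \<kappa> / nc s * collision (f s) r)"
      and init: "0 \<le> r \<longrightarrow> f 0 r = f\<^sub>0 r"
      and dt: "raw_line_density t r = line_density t r" and d0: "raw_line_density 0 r = line_density 0 r"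
    show "line_density t r = line_density 0 r + (\<integral>s. indicator {0..t} s * (rate s * line_collision (line_density s) r) \<partial>lborel)"
    proof (cases "0 \<le> r")
      case False
      have "line_collision (line_density s) r = 0" for s
        by (rule line_collision_nonpos) (use False in \<open>auto simp: line_density_def raw_line_density_def\<close>)
      then show ?thesis using False by (simp add: line_density_def raw_line_density_def)
    next
      case True
      then have int: "set_integrable lborel {0..t} (\<lambda>s. \<kappa> / nc s * collision (f s) r)"
        and e: "f t r = f\<^sub>0 r + (LINT s:{0..t}|lborel. \<kappa> / nc s * collision (f s) r)" and i: "f 0 r = f\<^sub>0 r"
        using eq init by auto
      have "line_density t r = line_density 0 r + (LINT s:{0..t}|lborel. \<kappa> / nc s * collision (f s) r) * r\<^sup>2"
        unfolding dt[symmetric] d0[symmetric] using True t T e i by (simp add: raw_line_density_def algebra_simps)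
      also have "(LINT s:{0..t}|lborel. \<kappa> / nc s * collision (f s) r) * r\<^sup>2
        = (\<integral>s. indicator {0..t} s *\<^sub>R (\<kappa> / nc s * collision (f s) r) * r\<^sup>2 \<partial>lborel)"
        unfolding set_lebesgue_integral_def by (rule integral_mult_left_zero[symmetric])
      also have "\<dots> = (\<integral>s. indicator {0..t} s * (rate s * line_collision (line_density s) r) \<partial>lborel)"
      proof (rule integral_cong_AE)
        have "(\<lambda>s. indicator {0..t} s *\<^sub>R (\<kappa> / nc s * collision (f s) r)) \<in> borel_measurable lborel"
          using int unfolding set_integrable_def by (rule borel_measurable_integrable)
        then show "(\<lambda>s. indicator {0..t} s *\<^sub>R (\<kappa> / nc s * collision (f s) r) * r\<^sup>2) \<in> borel_measurable lborel"
          by measurable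
        show "(\<lambda>s. indicator {0..t} s * (rate s * line_collision (line_density s) r)) \<in> borel_measurable lborel"
          unfolding line_collision_def linear_gain_def loss_rate_def indicator_def atLeastAtMost_iff atLeast_iff
          by measurable
        show "AE s in lborel. indicator {0..t} s *\<^sub>R (\<kappa> / nc s * collision (f s) r) * r\<^sup>2
          = indicator {0..t} s * (rate s * line_collision (line_density s) r)"
          using ae
        proof eventually_elim
          fix s assume s: "raw_line_density s r = line_density s r"
          show "indicator {0..t} s *\<^sub>R (\<kappa> / nc s * collision (f s) r) * r\<^sup>2
            = indicator {0..t} s * (rate s * line_collision (line_density s) r)"
          proof (cases "s \<in> {0..t}")
            case sT: True
            then have "s \<in> {0..T}" using t by auto
            from collision_line[OF this True] line_collision_line_density[OF s] sT \<open>s \<in> {0..T}\<close>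
            show ?thesis by (simp add: rate_def mult.assoc)
          qed simp
        qed
      qed
      finally show ?thesis .
    qed
  qed
qed

lemma line_density_cont:
  assumes k: "k \<le> 5" and t: "t \<in> {0..T}"
  shows "((\<lambda>s. \<integral>r. \<bar>line_density s r - line_density t r\<bar> * r ^ k \<partial>lborel) \<longlongrightarrow> 0) (at t within {0..T})"
proof (rule Lim_transform_eventually[OF f_cont[OF assms]])
  have pk: "r ^ (k + 2) = r\<^sup>2 * r ^ k" for r :: real by (simp add: power2_eq_square)
  show "\<forall>\<^sub>F s in at t within {0..T}. (LINT r:{0..}|lborel. \<bar>f s r - f t r\<bar> * r ^ (k + 2)) = (\<integral>r. \<bar>line_density s r - line_density t r\<bar> * r ^ k \<partial>lborel)"
    unfolding eventually_at_filter
  proof (rule always_eventually, intro allI impI)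
    fix s assume s: "s \<in> {0..T}"
    have "(LINT r:{0..}|lborel. \<bar>f s r - f t r\<bar> * r ^ (k + 2)) = (\<integral>r. \<bar>raw_line_density s r - raw_line_density t r\<bar> * r ^ k \<partial>lborel)"
      unfolding set_lebesgue_integral_def
    proof (rule Bochner_Integration.integral_cong[OF refl])
      fix r
      have "\<bar>f s r - f t r\<bar> * r\<^sup>2 = \<bar>f s r * r\<^sup>2 - f t r * r\<^sup>2\<bar>"
        by (simp add: abs_mult flip: left_diff_distrib)
      then show "indicator {0..} r *\<^sub>R (\<bar>f s r - f t r\<bar> * r ^ (k + 2)) = \<bar>raw_line_density s r - raw_line_density t r\<bar> * r ^ k"
        using s t by (auto simp: raw_line_density_def indicator_def pk mult.assoc[symmetric] simp del: add_2_eq_Suc' add_2_eq_Suc)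
    qed
    also have "\<dots> = (\<integral>r. \<bar>line_density s r - line_density t r\<bar> * r ^ k \<partial>lborel)"
      using line_density_AE[of s] line_density_AE[of t] by (intro integral_cong_AE) auto
    finally show "(LINT r:{0..}|lborel. \<bar>f s r - f t r\<bar> * r ^ (k + 2)) = (\<integral>r. \<bar>line_density s r - line_density t r\<bar> * r ^ k \<partial>lborel)" .
  qed
qed

lemma evolution_line_density: obtains W where "evolution T W rate line_density"
proof -
  obtain W where W: "\<And>s. rate s \<le> W" by (rule rate_bounded) blast
  have "evolution T W rate line_density"
  proof (rule evolution.intro)
    show "0 \<le> T" using T by simp
    show "0 \<le> rate s" for s using nc_pos[of s] \<kappa> by (auto simp: rate_def indicator_def)
    show "moment 1 (line_density t) = moment 1 (line_density 0)" if "t \<in> {0..T}" for t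
      using line_density_moment[OF that, of 1] initial_moment[of 1] f_energy[OF that] by (simp add: eval_nat_numeral)
  qed (use W line_density_profile line_density_cont line_density_eq in auto)
  then show thesis by (rule that)
qed

lemma collision_mass_eq:
  assumes "s \<in> {0..T}"
  shows "collision_mass (f s) = (\<integral>r. line_collision (line_density s) r \<partial>lborel)"
proof -
  have "collision_mass (f s) = (\<integral>r. line_collision (raw_line_density s) r \<partial>lborel)"
    unfolding collision_mass_def set_lebesgue_integral_def
  proof (rule Bochner_Integration.integral_cong[OF refl])
    fix r
    have "line_collision (raw_line_density s) r = 0" if "r < 0"
      by (rule line_collision_nonpos) (use that in \<open>auto simp: raw_line_density_def\<close>)
    then show "indicator {0..} r *\<^sub>R (collision (f s) r * r\<^sup>2) = line_collision (raw_line_density s) r"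
      using collision_line[OF assms, of r] by (auto simp: indicator_def)
  qed
  also have "\<dots> = (\<integral>r. line_collision (line_density s) r \<partial>lborel)"
  proof (rule integral_cong_AE)
    show "line_collision (raw_line_density s) \<in> borel_measurable lborel" "line_collision (line_density s) \<in> borel_measurable lborel"
      unfolding line_collision_def linear_gain_def loss_rate_def indicator_def atLeastAtMost_iff atLeast_iff
      by measurable
    show "AE r in lborel. line_collision (raw_line_density s) r = line_collision (line_density s) r"
      using line_density_AE[of s] by eventually_elim (rule line_collision_line_density)
  qed
  finally show ?thesis .
qed

text \<open>Testing the density equation with the constant 1 produces the same integral that drives
  \<open>nc\<close>, with the opposite sign.\<close>

lemma total_mass_conserved:
  assumes t: "t \<in> {0..T}"
  shows "nc t + moment 0 (line_density t) = nc 0 + moment 0 (line_density 0)"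
proof -
  obtain W where "evolution T W rate line_density" by (rule evolution_line_density)
  then interpret E: evolution T W rate line_density .
  have "(LINT s:{0..t}|lborel. \<kappa> / nc s * collision_mass (f s))
     = (\<integral>s. indicator {0..t} s * (rate s * (\<integral>r. line_collision (line_density s) r \<partial>lborel)) \<partial>lborel)"
    unfolding set_lebesgue_integral_def
    by (rule Bochner_Integration.integral_cong) (use t in \<open>auto simp: rate_def indicator_def collision_mass_eq\<close>)
  also have "\<dots> = (\<integral>s. indicator {0<..t} s * (rate s * (\<integral>r. line_collision (line_density s) r \<partial>lborel)) \<partial>lborel)"
  proof (rule integral_cong_AE)
    show "AE s in lborel. indicator {0..t} s * (rate s * (\<integral>r. line_collision (line_density s) r \<partial>lborel))
       = indicator {0<..t} s * (rate s * (\<integral>r. line_collision (line_density s) r \<partial>lborel))"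
      using AE_lborel_singleton[of 0] by eventually_elim (auto simp: indicator_def)
  qed measurable
  finally show ?thesis using nc_eq[OF t] E.mass_balance[OF t] by simp
qed

end

section \<open>The case of zero energy, and assembly of the threshold\<close>

lemma (in profile) massless:
  assumes "moment 1 g \<le> 0"
  shows "moment 0 g = 0"
proof -
  have nn: "AE x in lborel. 0 \<le> x ^ 1 * g x"
  proof (rule AE_I2)
    fix x show "0 \<le> x ^ 1 * g x" by (cases "0 \<le> x") (auto simp: nonneg zero)
  qed
  have "(\<integral>x. x ^ 1 * g x \<partial>lborel) = 0"
    using assms moment_nonneg[of 1] by (simp add: moment_def)
  then have "AE x in lborel. x ^ 1 * g x = 0"
    using integral_nonneg_eq_0_iff_AE[OF moments[of 1] nn] by simp
  then have "AE x in lborel. g x = 0"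
    using AE_lborel_singleton[of 0] by eventually_elim simp
  then have "(\<integral>x. g x \<partial>lborel) = (\<integral>x. 0 \<partial>(lborel :: real measure))"
    by (intro integral_cong_AE) auto
  then show ?thesis by (simp add: moment_def)
qed

lemma Linf_norm_AE:
  assumes "Linf_norm h < \<infinity>"
  shows "AE r in lborel. 0 \<le> r \<longrightarrow> \<bar>h r\<bar> \<le> real_of_ereal (Linf_norm h)"
proof -
  have "AE r in restrict_space lborel {0..}. ereal \<bar>h r\<bar> \<le> Linf_norm h"
    unfolding Linf_norm_def by (rule esssup_AE)
  then have "AE r in lborel. r \<in> {0..} \<longrightarrow> ereal \<bar>h r\<bar> \<le> Linf_norm h"
    by (subst (asm) AE_restrict_space_iff) auto
  then show ?thesis
  proof eventually_elim
    fix r assume "r \<in> {0..} \<longrightarrow> ereal \<bar>h r\<bar> \<le> Linf_norm h"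
    then show "0 \<le> r \<longrightarrow> \<bar>h r\<bar> \<le> real_of_ereal (Linf_norm h)"
      using assms by (cases "Linf_norm h") auto
  qed
qed

context solution
begin

lemma condensate_bounded_below:
  assumes "\<And>t. t \<in> {0..T} \<Longrightarrow> moment 0 (line_density t) \<le> A"
    and "A - line_moment 2 f\<^sub>0 + \<delta> \<le> nc 0"
  shows "\<delta> \<le> (INF s\<in>{0..T}. nc s)"
proof (rule cINF_greatest)
  show "{0..T} \<noteq> {}" using T by simp
  fix s assume s: "s \<in> {0..T}"
  show "\<delta> \<le> nc s"
    using total_mass_conserved[OF s] initial_moment[of 0] assms(1)[OF s] assms(2) by (simp add: numeral_2_eq_2)
qed

lemma density_mass_le_threshold:
  assumes m3: "0 < line_moment 3 f\<^sub>0" and Linf: "Linf_norm (\<lambda>r. f\<^sub>0 r * r\<^sup>2) < \<infinity>" and t: "t \<in> {0..T}"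
  shows "moment 0 (line_density t) \<le> mass_threshold 5 f\<^sub>0"
proof -
  obtain W where "evolution T W rate line_density" by (rule evolution_line_density)
  then interpret E: evolution T W rate line_density .
  define m where "m = line_moment 3 f\<^sub>0"
  define N where "N = max (line_moment 4 f\<^sub>0) (5 * m powr (5/4))"
  \<comment> \<open>The first entry covers the initial density. The second is the Young condition
    with \<open>a = c\<^sub>0\<close>, \<open>b = m\<close> and the bound \<open>N\<close> on the
    second moment, valid at all times.\<close>
  define M where "M = max (real_of_ereal (Linf_norm (\<lambda>r. f\<^sub>0 r * r\<^sup>2))) (3 * N / (2 * c\<^sub>0 powr (1/4) * m powr (3/4)))"
  have m_pos: "0 < m" using m3 by (simp add: m_def)
  have "0 < 5 * m powr (5/4)" using m_pos by simp
  then have N_pos: "0 < N" unfolding N_def by linarith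
  have "0 < 3 * N / (2 * c\<^sub>0 powr (1/4) * m powr (3/4))" using N_pos m_pos by (simp add: c0_eq)
  then have M_pos: "0 < M" unfolding M_def by linarith
  have m1: "moment 1 (line_density s) = m" if "s \<in> {0..T}" for s
    using E.energy[OF that] initial_moment[of 1] by (simp add: m_def eval_nat_numeral)
  have m2: "moment 2 (line_density s) \<le> N" if "s \<in> {0..T}" for s
    using E.second_moment_bound[OF _ that] m1[of 0] initial_moment[of 2] m_pos T by (simp add: N_def)
  have "AE r in lborel. line_density t r \<le> M"
  proof (rule E.sup_bound[OF M_pos _ _ t])
    show "AE r in lborel. line_density 0 r \<le> M"
      using line_density_AE[of 0] f_init Linf_norm_AE[OF Linf]
    proof eventually_elim
      fix r
      assume "raw_line_density 0 r = line_density 0 r" "0 \<le> r \<longrightarrow> f 0 r = f\<^sub>0 r"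
        "0 \<le> r \<longrightarrow> \<bar>f\<^sub>0 r * r\<^sup>2\<bar> \<le> real_of_ereal (Linf_norm (\<lambda>r. f\<^sub>0 r * r\<^sup>2))"
      then show "line_density 0 r \<le> M"
        using M_pos by (auto simp: raw_line_density_def M_def split: if_splits)
    qed
    fix s r :: real assume s: "s \<in> {0..T}" and r: "0 \<le> r"
    have "2 * r * moment 2 (line_density s) \<le> 2 * r * N"
      using m2[OF s] r by (intro mult_left_mono) auto
    also have "\<dots> \<le> M * (2 * m + c\<^sub>0 * r ^ 4)"
      by (rule young_threshold) (use m_pos r N_pos in \<open>auto simp: c0_eq M_def\<close>)
    finally show "2 * r * moment 2 (line_density s) \<le> M * (2 * moment 1 (line_density s) + r ^ 4 / 30)"
      unfolding m1[OF s] by (simp add: c0_eq)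
  qed
  from E.P.mass_le_sqrt[OF M_pos this] m1[OF t] m_pos
  have "moment 0 (line_density t) \<le> 2 * sqrt (m * M)" by simp
  then show ?thesis by (simp add: mass_threshold_def m_def N_def M_def Let_def)
qed

end

theorem theorem5p1:
  shows "\<exists>C>0. \<forall>f\<^sub>0 :: real \<Rightarrow> real.
    set_borel_measurable lborel {0..} f\<^sub>0 \<and>
    (AE r in lborel. 0 \<le> r \<longrightarrow> 0 \<le> f\<^sub>0 r) \<and>
    set_integrable lborel {0..} (\<lambda>r. f\<^sub>0 r * r ^ 3) \<and>
    set_integrable lborel {0..} (\<lambda>r. f\<^sub>0 r * r ^ 4) \<and>
    Linf_norm (\<lambda>r. f\<^sub>0 r * r\<^sup>2) < \<infinity> \<longrightarrow>
    (\<exists>threshold>0.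
       (line_moment 3 f\<^sub>0 > 0 \<longrightarrow> threshold = mass_threshold C f\<^sub>0) \<and>
       (\<forall>\<kappa>\<^sub>0>0. \<forall>T>0. \<forall>(f :: real \<Rightarrow> real \<Rightarrow> real) (nc :: real \<Rightarrow> real).
          radial_solution \<kappa>\<^sub>0 T f\<^sub>0 f nc \<and>
          (\<forall>t\<in>{0..T}. nc t > 0) \<and>
          abs_continuous_on_interval 0 T nc \<longrightarrow>
          (\<forall>\<delta>>0. nc 0 \<ge> threshold - line_moment 2 f\<^sub>0 + \<delta> \<longrightarrow>
             (INF s\<in>{0..T}. nc s) \<ge> \<delta>)))"
proof (rule exI[of _ 5], rule conjI[OF _ allI[OF impI]])
  fix f\<^sub>0 :: "real \<Rightarrow> real"
  assume hyp: "set_borel_measurable lborel {0..} f\<^sub>0 \<and>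
    (AE r in lborel. 0 \<le> r \<longrightarrow> 0 \<le> f\<^sub>0 r) \<and>
    set_integrable lborel {0..} (\<lambda>r. f\<^sub>0 r * r ^ 3) \<and>
    set_integrable lborel {0..} (\<lambda>r. f\<^sub>0 r * r ^ 4) \<and>
    Linf_norm (\<lambda>r. f\<^sub>0 r * r\<^sup>2) < \<infinity>"
  then have f0: "set_borel_measurable lborel {0..} f\<^sub>0" and Linf: "Linf_norm (\<lambda>r. f\<^sub>0 r * r\<^sup>2) < \<infinity>" by auto
  \<comment> \<open>The value 1 is an arbitrary positive number for the case of zero energy, where
    the formula would give 0.\<close>
  define A where "A = (if line_moment 3 f\<^sub>0 > 0 then mass_threshold 5 f\<^sub>0 else 1)"
  have "0 < mass_threshold 5 f\<^sub>0" if "line_moment 3 f\<^sub>0 > 0"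
  proof -
    let ?m = "line_moment 3 f\<^sub>0"
    have "0 < 5 * ?m powr (5/4)" using that by simp
    then have "0 < max (line_moment 4 f\<^sub>0) (5 * ?m powr (5/4))" by linarith
    then have "0 < 3 * max (line_moment 4 f\<^sub>0) (5 * ?m powr (5/4)) / (2 * c\<^sub>0 powr (1/4) * ?m powr (3/4))"
      using that by (intro divide_pos_pos mult_pos_pos) (auto simp: c0_eq)
    then have "0 < max (real_of_ereal (Linf_norm (\<lambda>r. f\<^sub>0 r * r\<^sup>2)))
        (3 * max (line_moment 4 f\<^sub>0) (5 * ?m powr (5/4)) / (2 * c\<^sub>0 powr (1/4) * ?m powr (3/4)))" by linarith
    from mult_pos_pos[OF that this] show ?thesis unfolding mass_threshold_def Let_def by simp
  qed
  then have A_pos: "0 < A" by (simp add: A_def)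
  show "\<exists>threshold>0.
       (line_moment 3 f\<^sub>0 > 0 \<longrightarrow> threshold = mass_threshold 5 f\<^sub>0) \<and>
       (\<forall>\<kappa>\<^sub>0>0. \<forall>T>0. \<forall>(f :: real \<Rightarrow> real \<Rightarrow> real) (nc :: real \<Rightarrow> real).
          radial_solution \<kappa>\<^sub>0 T f\<^sub>0 f nc \<and>
          (\<forall>t\<in>{0..T}. nc t > 0) \<and>
          abs_continuous_on_interval 0 T nc \<longrightarrow>
          (\<forall>\<delta>>0. nc 0 \<ge> threshold - line_moment 2 f\<^sub>0 + \<delta> \<longrightarrow>
             (INF s\<in>{0..T}. nc s) \<ge> \<delta>))"
  proof (intro exI[of _ A] conjI allI impI A_pos)
    show "A = mass_threshold 5 f\<^sub>0" if "line_moment 3 f\<^sub>0 > 0" using that by (simp add: A_def)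
  next
    fix \<kappa> T :: real and f :: "real \<Rightarrow> real \<Rightarrow> real" and nc :: "real \<Rightarrow> real" and \<delta> :: real
    assume "0 < \<kappa>" "0 < T" and sol: "radial_solution \<kappa> T f\<^sub>0 f nc \<and> (\<forall>t\<in>{0..T}. nc t > 0) \<and> abs_continuous_on_interval 0 T nc"
      and \<delta>: "nc 0 \<ge> A - line_moment 2 f\<^sub>0 + \<delta>"
    interpret solution \<kappa> T f\<^sub>0 f nc
      by unfold_locales (use \<open>0 < \<kappa>\<close> \<open>0 < T\<close> sol f0 in auto)
    show "(INF s\<in>{0..T}. nc s) \<ge> \<delta>"
    proof (rule condensate_bounded_below[OF _ \<delta>])
      fix t assume t: "t \<in> {0..T}"
      show "moment 0 (line_density t) \<le> A"
      proof (cases "line_moment 3 f\<^sub>0 > 0")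
        case True
        then show ?thesis using density_mass_le_threshold[OF True Linf t] by (simp add: A_def)
      next
        case False
        interpret P: profile "line_density t" by (rule line_density_profile)
        have "moment 1 (line_density t) \<le> 0"
          using line_density_moment[OF t, of 1] f_energy[OF t] False by (simp add: eval_nat_numeral)
        from P.massless[OF this] show ?thesis using A_pos by simp
      qed
    qed
  qed
qed simp

end
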